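(* (Type $A$ Chamber Ansatz.) Let $G=\mathrm{SL}_n(\mathbb{C})$, $v\leq w$ in $W=S_n$, and $(\mathbf v,\mathbf w)\in\mathrm{Red}(v,w)$. Let $g:=\mathbf g_{\mathbf v,\mathbf w}(\mathbf t)$ with $\mathbf t\in(\mathbb{C}^* )^{J_{\mathbf v}^\circ}$ and $\vec y:=[g^T\dot w]_L^+$. Let $g_\cap\in N\dot v\cap\dot vN$ be the element with $gB_-=g_\cap B_-$ and $\overleftarrow y:=[\dot w\,g_\cap^T]_R^+$. Then for all $r\in J_{\mathbf v}^\circ$, $$t_r=\frac{\vec\Delta_{C_r^{\mathrm{up}}}(\vec y)\,\vec\Delta_{C_r^{\mathrm{down}}}(\vec y)}{\vec\Delta_{C_r^{\mathrm{left}}}(\vec y)\,\vec\Delta_{C_r^{\mathrm{right}}}(\vec y)}=\frac{\overleftarrow\Delta_{C_r^{\mathrm{up}}}(\overleftarrow y)\,\overleftarrow\Delta_{C_r^{\mathrm{down}}}(\overleftarrow y)}{\overleftarrow\Delta_{C_r^{\mathrm{left}}}(\overleftarrow y)\,\overleftarrow\Delta_{C_r^{\mathrm{right}}}(\overleftarrow y)}.$$ Conversely, for each chamber $C$ of the wiring diagram of $\mathbf w$, we have $$\vec\Delta_C(\vec y)=\prod_{r\in J_{\mathbf v}^\circ:\ C\in\mathrm{Up}_r}t_r^{-1}\qquad\text{and}\qquad\overleftarrow\Delta_C(\overleftarrow y)=\prod_{r\in J_{\mathbf v}^\circ:\ C\in\mathrm{Down}_r}t_r^{-1},$$ where $\mathrm{Up}_r$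 and $\mathrm{Down}_r$ denote the upstream and downstream wedges of the $r$-th crossing.
   Context: $G=\mathrm{SL}_n(\mathbb{C})$; $B,B_-,N,N_-$ are the upper triangular, lower triangular, upper unitriangular and lower unitriangular matrices; $W=S_n$ with Bruhat order $\leq$. $x_i(t)$ is the identity matrix with an extra entry $t$ in position $(i,i+1)$; $\dot s_i$ is the matrix with block $\begin{pmatrix}0&1\\-1&0\end{pmatrix}$ in rows and columns $i,i+1$ and the identity elsewhere; for a reduced word $w=s_{i_1}\cdots s_{i_m}$ put $\dot w=\dot s_{i_1}\cdots\dot s_{i_m}$. $g^T$ is the transpose. For $g\in BB_-$, $[g]_L^+\in N$ is defined by $g\in[g]_L^+B_-$; for $g\in B_-B$, $[g]_R^+\in N$ is defined by $g\in B_-[g]_R^+$. $\Delta^I_J$ is the minor with row set $I$ and column set $J$ ($\Delta^\emptyset_\emptyset=1$). MR-parametrization: for $v\leq w$ and a reduced expression $\mathbf w=(i_1,\dots,i_m)$ of $w$, the positive distinguished subexpression $\mathbf v$ for $v$ is the rightmost reduced subexpression: set $v_{(m)}=v$ and, for $r=m,\dots,1$, $v_{(r-1)}=v_{(r)}s_{i_r}$ if $v_{(r)}s_{i_r}<v_{(r)}$, and $v_{(r-1)}=v_{(r)}$ otherwise. $J_{\mathbf v}^\circ\subset[m]$ is the set of $r$ with $v_{(r-1)}=v_{(r)}$ (indices not used in $\mathbf v$). $\mathrm{Red}(v,w)$ is the set of such pairs $(\mathbf v,\mathbf w)$. For $\mathbf t=(t_r)\in(\mathbb{C}^* )^{J_{\mathbf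 v}^\circ}$, $\mathbf g_{\mathbf v,\mathbf w}(\mathbf t)=g_1\cdots g_m\in N\dot v\cap B_-wB_-$ with $g_r=\dot s_{i_r}$ if $r\notin J_{\mathbf v}^\circ$ and $g_r=x_{i_r}(t_r)$ if $r\in J_{\mathbf v}^\circ$. Wiring diagram of $\mathbf w$: draw $n$ horizontal strands (at vertical coordinates $1,\dots,n$ from bottom to top) and for each $r\in[m]$ place a crossing with horizontal coordinate $r$ between the strands at vertical coordinates $i_r$ and $i_r+1$. Chambers are the connected components of the complement of the diagram (in the strip between the left and right endpoints). $C_r^{\mathrm{right}},C_r^{\mathrm{up}},C_r^{\mathrm{left}},C_r^{\mathrm{down}}$ are the chambers immediately to the right of, above, to the left of, and below the $r$-th crossing. The strands of the diagram are called $\mathbf w$-strands. A $\mathbf v$-strand is a left-to-right path that follows (passes through) the crossings not in $J_{\mathbf v}^\circ$ and ignores the crossings in $J_{\mathbf v}^\circ$ (i.e. keeps its vertical coordinate there). Left and right endpoints of strands are labeled $1,\dots,n$ from bottom to top. For a chamber $C$ put $\vec\Delta_C=\Delta^{I}_{J}$ with $I$ (resp. $J$) the set of right endpoints of the $\mathbf v$-strands (resp. $\mathbf w$-strands) passing below $C$; and $\overleftarrow\Delta_C=\Delta^{I'}_{J'}$ with $I'$ (resp. $J'$) the set of left endpoints of the $\mathbf w$-strands (resp. $\mathbf v$-strands) passing above $C$. Wedges: let $S_1,S_2$ be the two $\mathbf w$-strands participating in the $r$-th crossing. The upstream wedge $\mathrm{Up}_r$ (resp. downstream wedge $\mathrm{Down}_r$)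 is the union of the chambers located vertically between $S_1$ and $S_2$ to the left (resp. to the right) of the $r$-th crossing. *)

theory Defs
  imports
    "HOL-Combinatorics.Permutations"
    "Jordan_Normal_Form.Determinant"
    "Jordan_Normal_Form.DL_Submatrix"
begin

text \<open>
  All indices are 0-based, as in the matrix library: rows, columns and strands are
  \<open>0, \<dots>, n - 1\<close>, the simple generators of \<open>S\<^sub>n\<close> are \<open>s\<^sub>0, \<dots>, s\<^sub>n\<^sub>-\<^sub>2\<close> with
  \<open>s\<^sub>i = (i, i + 1)\<close>, and the crossings of a word of length \<open>m\<close> are \<open>0, \<dots>, m - 1\<close>.
  \<open>S\<^sub>n\<close> is the set of \<open>u :: nat \<Rightarrow> nat\<close> with \<open>u permutes {..<n}\<close>, multiplied by composition.
\<close>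

section \<open>Words and Bruhat order in the symmetric group\<close>

definition simple_refl :: "nat \<Rightarrow> nat \<Rightarrow> nat" where
  "simple_refl i = Transposition.transpose i (Suc i)"

definition word_perm :: "nat list \<Rightarrow> nat \<Rightarrow> nat" where
  "word_perm ws = foldr (\<circ>) (map simple_refl ws) id"

definition is_word :: "nat \<Rightarrow> nat list \<Rightarrow> (nat \<Rightarrow> nat) \<Rightarrow> bool" where
  "is_word n ws u \<longleftrightarrow> (\<forall>i\<in>set ws. Suc i < n) \<and> word_perm ws = u"

definition coxeter_length :: "nat \<Rightarrow> (nat \<Rightarrow> nat) \<Rightarrow> nat" where
  "coxeter_length n u = (LEAST k. \<exists>ws. length ws = k \<and> is_word n ws u)"

definition reduced_word :: "nat \<Rightarrow> nat list \<Rightarrow> (nat \<Rightarrow> nat) \<Rightarrow> bool" where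
  "reduced_word n ws u \<longleftrightarrow> is_word n ws u \<and> length ws = coxeter_length n u"

definition bruhat_step :: "nat \<Rightarrow> ((nat \<Rightarrow> nat) \<times> (nat \<Rightarrow> nat)) set" where
  "bruhat_step n = {(u, u'). u permutes {..<n} \<and>
     (\<exists>a b. a < b \<and> b < n \<and> u' = u \<circ> Transposition.transpose a b) \<and>
     coxeter_length n u < coxeter_length n u'}"

definition bruhat_le :: "nat \<Rightarrow> (nat \<Rightarrow> nat) \<Rightarrow> (nat \<Rightarrow> nat) \<Rightarrow> bool" where
  "bruhat_le n u u' \<longleftrightarrow> (u, u') \<in> (bruhat_step n)\<^sup>*"

definition bruhat_less :: "nat \<Rightarrow> (nat \<Rightarrow> nat) \<Rightarrow> (nat \<Rightarrow> nat) \<Rightarrow> bool" where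
  "bruhat_less n u u' \<longleftrightarrow> bruhat_le n u u' \<and> u \<noteq> u'"

text \<open>
  A subexpression is encoded by the list \<open>vs = [v\<^sub>(\<^sub>0\<^sub>), \<dots>, v\<^sub>(\<^sub>m\<^sub>)]\<close>. The step from
  \<open>vs ! r\<close> to \<open>vs ! Suc r\<close> belongs to the 0-based crossing \<open>r\<close>, with letter \<open>ws ! r\<close>.
\<close>

definition pos_dist_subexpr ::
    "nat \<Rightarrow> (nat \<Rightarrow> nat) \<Rightarrow> nat list \<Rightarrow> (nat \<Rightarrow> nat) list \<Rightarrow> bool" where
  "pos_dist_subexpr n v ws vs \<longleftrightarrow>
     length vs = Suc (length ws) \<and> vs ! length ws = v \<and>
     (\<forall>r<length ws. vs ! r =
        (if bruhat_less n (vs ! Suc r \<circ> simple_refl (ws ! r)) (vs ! Suc r)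
         then vs ! Suc r \<circ> simple_refl (ws ! r)
         else vs ! Suc r))"

definition Red ::
    "nat \<Rightarrow> (nat \<Rightarrow> nat) \<Rightarrow> (nat \<Rightarrow> nat) \<Rightarrow> ((nat \<Rightarrow> nat) list \<times> nat list) set" where
  "Red n v w = {(vs, ws). reduced_word n ws w \<and> pos_dist_subexpr n v ws vs}"

definition Jo :: "(nat \<Rightarrow> nat) list \<Rightarrow> nat set" where
  "Jo vs = {r. Suc r < length vs \<and> vs ! r = vs ! Suc r}"


section \<open>Matrices\<close>

definition Borel_minus :: "nat \<Rightarrow> complex mat set" where
  "Borel_minus n = {A \<in> carrier_mat n n. upper_triangular (transpose_mat A) \<and> det A = 1}"

definition Unip :: "nat \<Rightarrow> complex mat set" where
  "Unip n = {A \<in> carrier_mat n n. upper_triangular A \<and> (\<forall>i<n. A $$ (i, i) = 1)}"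

definition x_mat :: "nat \<Rightarrow> nat \<Rightarrow> complex \<Rightarrow> complex mat" where
  "x_mat n i t = mat n n (\<lambda>(j, k). if j = k then 1 else if j = i \<and> k = Suc i then t else 0)"

definition sdot :: "nat \<Rightarrow> nat \<Rightarrow> complex mat" where
  "sdot n i = mat n n (\<lambda>(j, k).
     if j = i \<and> k = Suc i then 1
     else if j = Suc i \<and> k = i then - 1
     else if j = k \<and> j \<noteq> i \<and> j \<noteq> Suc i then 1
     else 0)"

definition prod_mats :: "nat \<Rightarrow> complex mat list \<Rightarrow> complex mat" where
  "prod_mats n As = foldr (*) As (1\<^sub>m n)"

text \<open>The matrix \<open>dot n u\<close> does not depend on the reduced word chosen for \<open>u\<close>.\<close>

definition dot :: "nat \<Rightarrow> (nat \<Rightarrow> nat) \<Rightarrow> complex mat" where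
  "dot n u = prod_mats n (map (sdot n) (SOME ws. reduced_word n ws u))"

text \<open>Used only for \<open>g \<in> B B\<^sub>-\<close>, respectively \<open>g \<in> B\<^sub>- B\<close>, where the factor is unique.\<close>

definition left_unip :: "nat \<Rightarrow> complex mat \<Rightarrow> complex mat" where
  "left_unip n g = (THE y. y \<in> Unip n \<and> (\<exists>b\<in>Borel_minus n. g = y * b))"

definition right_unip :: "nat \<Rightarrow> complex mat \<Rightarrow> complex mat" where
  "right_unip n g = (THE y. y \<in> Unip n \<and> (\<exists>b\<in>Borel_minus n. g = b * y))"

definition MR_param ::
    "nat \<Rightarrow> (nat \<Rightarrow> nat) list \<Rightarrow> nat list \<Rightarrow> (nat \<Rightarrow> complex) \<Rightarrow> complex mat" where
  "MR_param n vs ws t = prod_mats n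
     (map (\<lambda>r. if r \<in> Jo vs then x_mat n (ws ! r) (t r) else sdot n (ws ! r)) [0..<length ws])"

text \<open>
  Each coset \<open>g B\<^sub>-\<close> with \<open>g \<in> N (dot n v) B\<^sub>-\<close> contains exactly one element of
  \<open>N (dot n v) \<inter> (dot n v) N\<close>.
\<close>

definition cap_rep :: "nat \<Rightarrow> (nat \<Rightarrow> nat) \<Rightarrow> complex mat \<Rightarrow> complex mat" where
  "cap_rep n v g = (THE h.
     h \<in> (\<lambda>x. x * dot n v) ` Unip n \<inter> (\<lambda>x. dot n v * x) ` Unip n \<and>
     (\<lambda>b. g * b) ` Borel_minus n = (\<lambda>b. h * b) ` Borel_minus n)"

definition minor :: "nat set \<Rightarrow> nat set \<Rightarrow> complex mat \<Rightarrow> complex" where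
  "minor I J A = det (submatrix A I J)"


section \<open>Wiring diagrams\<close>

text \<open>
  The crossings cut the strip into the columns \<open>0, \<dots>, m\<close>; crossing \<open>r\<close> separates
  the columns \<open>r\<close> and \<open>Suc r\<close>. Inside a column, the \<open>n\<close> strands at heights
  \<open>0, \<dots>, n - 1\<close> bound \<open>n + 1\<close> cells: the cell \<open>(c, h)\<close> has exactly the heights
  \<open>0, \<dots>, h - 1\<close> of column \<open>c\<close> below it. Horizontally adjacent cells
  \<open>(r, h)\<close> and \<open>(Suc r, h)\<close> are separated precisely when crossing \<open>r\<close> is between the
  heights \<open>h - 1\<close> and \<open>h\<close>, i.e. \<open>h = Suc (ws ! r)\<close>. The chambers are the
  connected components of this complex of cells.
\<close>

type_synonym cell = "nat \<times> nat"

definition cells :: "nat \<Rightarrow> nat list \<Rightarrow> cell set" where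
  "cells n ws = {..length ws} \<times> {..n}"

definition cell_adj :: "nat \<Rightarrow> nat list \<Rightarrow> (cell \<times> cell) set" where
  "cell_adj n ws = {((r, h), (Suc r, h)) |r h. r < length ws \<and> h \<le> n \<and> h \<noteq> Suc (ws ! r)}"

definition cell_conn :: "nat \<Rightarrow> nat list \<Rightarrow> (cell \<times> cell) set" where
  "cell_conn n ws = (cell_adj n ws \<union> (cell_adj n ws)\<inverse>)\<^sup>*"

definition chambers :: "nat \<Rightarrow> nat list \<Rightarrow> cell set set" where
  "chambers n ws = cells n ws // cell_conn n ws"

definition chamber_of :: "nat \<Rightarrow> nat list \<Rightarrow> cell \<Rightarrow> cell set" where
  "chamber_of n ws p = cell_conn n ws `` {p}"

definition C_left :: "nat \<Rightarrow> nat list \<Rightarrow> nat \<Rightarrow> cell set" where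
  "C_left n ws r = chamber_of n ws (r, Suc (ws ! r))"

definition C_right :: "nat \<Rightarrow> nat list \<Rightarrow> nat \<Rightarrow> cell set" where
  "C_right n ws r = chamber_of n ws (Suc r, Suc (ws ! r))"

definition C_up :: "nat \<Rightarrow> nat list \<Rightarrow> nat \<Rightarrow> cell set" where
  "C_up n ws r = chamber_of n ws (r, Suc (Suc (ws ! r)))"

definition C_down :: "nat \<Rightarrow> nat list \<Rightarrow> nat \<Rightarrow> cell set" where
  "C_down n ws r = chamber_of n ws (r, ws ! r)"

text \<open>
  \<open>strand ws U a c\<close> is the height in column \<open>c\<close> of the path with left endpoint \<open>a\<close>
  that follows the crossings in \<open>U\<close> and ignores the others.
\<close>

primrec strand :: "nat list \<Rightarrow> nat set \<Rightarrow> nat \<Rightarrow> nat \<Rightarrow> nat" where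
  "strand ws U a 0 = a"
| "strand ws U a (Suc r) =
     (if r \<in> U then simple_refl (ws ! r) (strand ws U a r) else strand ws U a r)"

abbreviation w_strand :: "nat list \<Rightarrow> nat \<Rightarrow> nat \<Rightarrow> nat" where
  "w_strand ws \<equiv> strand ws {..<length ws}"

abbreviation v_strand :: "(nat \<Rightarrow> nat) list \<Rightarrow> nat list \<Rightarrow> nat \<Rightarrow> nat \<Rightarrow> nat" where
  "v_strand vs ws \<equiv> strand ws ({..<length ws} - Jo vs)"

definition passes_below :: "(nat \<Rightarrow> nat) \<Rightarrow> cell set \<Rightarrow> bool" where
  "passes_below S C \<longleftrightarrow> (\<forall>(c, h)\<in>C. S c < h)"

definition passes_above :: "(nat \<Rightarrow> nat) \<Rightarrow> cell set \<Rightarrow> bool" where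
  "passes_above S C \<longleftrightarrow> (\<forall>(c, h)\<in>C. h \<le> S c)"

definition Delta_right ::
    "nat \<Rightarrow> (nat \<Rightarrow> nat) list \<Rightarrow> nat list \<Rightarrow> cell set \<Rightarrow> complex mat \<Rightarrow> complex" where
  "Delta_right n vs ws C = minor
     {v_strand vs ws a (length ws) |a. a < n \<and> passes_below (v_strand vs ws a) C}
     {w_strand ws a (length ws) |a. a < n \<and> passes_below (w_strand ws a) C}"

definition Delta_left ::
    "nat \<Rightarrow> (nat \<Rightarrow> nat) list \<Rightarrow> nat list \<Rightarrow> cell set \<Rightarrow> complex mat \<Rightarrow> complex" where
  "Delta_left n vs ws C = minor
     {a. a < n \<and> passes_above (w_strand ws a) C}
     {a. a < n \<and> passes_above (v_strand vs ws a) C}"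

definition between :: "(nat \<Rightarrow> nat) \<Rightarrow> (nat \<Rightarrow> nat) \<Rightarrow> cell \<Rightarrow> bool" where
  "between S1 S2 = (\<lambda>(c, h). min (S1 c) (S2 c) < h \<and> h \<le> max (S1 c) (S2 c))"

definition crossing_strands :: "nat \<Rightarrow> nat list \<Rightarrow> nat \<Rightarrow> nat \<Rightarrow> nat \<Rightarrow> bool" where
  "crossing_strands n ws r a b \<longleftrightarrow> a < n \<and> b < n \<and>
     w_strand ws a r = ws ! r \<and> w_strand ws b r = Suc (ws ! r)"

definition Up_wedge :: "nat \<Rightarrow> nat list \<Rightarrow> nat \<Rightarrow> cell set set" where
  "Up_wedge n ws r = {C \<in> chambers n ws. \<exists>a b. crossing_strands n ws r a b \<and>
     (\<forall>(c, h)\<in>C. c \<le> r \<and> between (w_strand ws a) (w_strand ws b) (c, h))}"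

definition Down_wedge :: "nat \<Rightarrow> nat list \<Rightarrow> nat \<Rightarrow> cell set set" where
  "Down_wedge n ws r = {C \<in> chambers n ws. \<exists>a b. crossing_strands n ws r a b \<and>
     (\<forall>(c, h)\<in>C. r < c \<and> between (w_strand ws a) (w_strand ws b) (c, h))}"

end

theory Submission
  imports Defs
begin

text \<open>
  Write \<open>w\<^sub>k\<close>, \<open>v\<^sub>k\<close>, \<open>g\<^sub>k\<close> for the products of the first \<open>k\<close> factors of \<open>w\<close>, of \<open>v\<close> and of
  \<open>g\<close>. For the left-hand variant put \<open>Z = y\<^sup>T \<in> N\<^sub>-\<close>. Then \<open>Z w B\<^sub>- = g B\<^sub>-\<close>, and since the word is
  reduced this propagates to \<open>Z w\<^sub>k = g\<^sub>k b\<^sub>k\<close> with \<open>b\<^sub>k \<in> B\<^sub>-\<close> for every \<open>k\<close>. As \<open>g\<^sub>k \<in> N v\<^sub>k\<close>, the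
  minor of \<open>Z\<close> attached to the chamber at height \<open>h\<close> of column \<open>k\<close> is the product of the diagonal
  entries of \<open>b\<^sub>k\<close> with index \<open>\<ge> h\<close>. A computation with \<open>2 \<times> 2\<close> matrices shows that, from \<open>b\<^sub>k\<close> to
  \<open>b\<^sub>k\<^sub>+\<^sub>1\<close>, the diagonal entry that follows a strand going up (down) through an unused crossing is
  divided (multiplied) by \<open>t\<close>, and is unchanged otherwise; this gives both formulas. Transposition in the
  antidiagonal reverses the word and turns the right-hand variant into the same statement about \<open>Z\<close>.
\<close>

section \<open>Matrices that are triangular with respect to an order of the indices\<close>

text \<open>Two obstacles shape the proof. Signs: multiplication by \<open>sdot n i\<close> negates
  a minor whose column set contains \<open>i\<close> but not \<open>Suc i\<close>. The column sets
  that occur are the positions of all strands above, or all strands below, a given height; since two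
  strands cross at most once, the bad configuration never arises. Positivity: a factor
  \<open>x_i(t)\<close> can be pulled through \<open>v_k\<close> into \<open>N\<close> only if
  \<open>i\<close> is an ascent of \<open>v_k\<close>. To treat \<open>N\<close>,
  \<open>N_-\<close>, \<open>B_-\<close> and all their conjugates by permutations at once,
  triangularity is taken with respect to a function \<open>f\<close> that orders the indices:
  \<open>int\<close> gives upper, \<open>lower\<close> gives lower triangular matrices, and
  conjugation by a permutation composes \<open>f\<close> with it. Wedges arise by telescoping: in a
  product over all strands on one side of a chamber, the two factors of a crossing cancel unless the
  chamber lies between its two strands.\<close>

definition ord_tri :: "nat \<Rightarrow> (nat \<Rightarrow> int) \<Rightarrow> complex mat set" where
  "ord_tri n f = {A \<in> carrier_mat n n. \<forall>a<n. \<forall>b<n. A $$ (a, b) \<noteq> 0 \<longrightarrow> f a \<le> f b}"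

definition ord_unip :: "nat \<Rightarrow> (nat \<Rightarrow> int) \<Rightarrow> complex mat set" where
  "ord_unip n f = {A \<in> ord_tri n f. \<forall>a<n. A $$ (a, a) = 1}"

definition ord_borel :: "nat \<Rightarrow> (nat \<Rightarrow> int) \<Rightarrow> complex mat set" where
  "ord_borel n f = {A \<in> ord_tri n f. det A = 1}"

abbreviation "lower \<equiv> (\<lambda>a::nat. - int a)"

lemma ord_tri_carrier: "A \<in> ord_tri n f \<Longrightarrow> A \<in> carrier_mat n n"
  and ord_unip_carrier: "A \<in> ord_unip n f \<Longrightarrow> A \<in> carrier_mat n n"
  and ord_borel_carrier: "A \<in> ord_borel n f \<Longrightarrow> A \<in> carrier_mat n n"
  by (auto simp: ord_tri_def ord_unip_def ord_borel_def)

lemma ord_triD: "A \<in> ord_tri n f \<Longrightarrow> a < n \<Longrightarrow> b < n \<Longrightarrow> f b < f a \<Longrightarrow> A $$ (a, b) = 0"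
  by (force simp: ord_tri_def)

lemma mult_mat_nth:
  assumes "A \<in> carrier_mat n m" "B \<in> carrier_mat m k" "r < n" "c < k"
  shows "(A * B) $$ (r, c) = (\<Sum>j<m. A $$ (r, j) * B $$ (j, c))"
  using assms by (auto simp: scalar_prod_def atLeast0LessThan intro!: sum.cong)

text \<open>A permutation preserves the sum of \<open>f\<close> over \<open>S\<close>, so if no
  value drops along \<open>p\<close>, none rises either, and injectivity fixes every point. In the
  Leibniz expansion this leaves only the identity.\<close>

lemma permutes_decreasing_imp_id:
  assumes "finite S" "p permutes S" "inj_on f S" "\<And>a. a \<in> S \<Longrightarrow> (f a :: int) \<le> f (p a)"
  shows "p = id"
proof -
  have "(\<Sum>a\<in>S. f (p a)) = (\<Sum>a\<in>S. f a)"
    using sum.permute[OF assms(2), of f] by (simp add: o_def)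
  then have "(\<Sum>a\<in>S. f (p a) - f a) = 0" by (simp add: sum_subtractf)
  then have "\<forall>a\<in>S. f (p a) - f a = 0"
    using assms by (subst (asm) sum_nonneg_eq_0_iff) auto
  then have "p a = a" for a
    using assms(2,3) permutes_in_image[OF assms(2), of a] permutes_not_in[OF assms(2), of a]
    by (cases "a \<in> S") (auto dest: inj_onD)
  then show ?thesis by auto
qed

lemma det_ord_tri:
  assumes inj: "inj_on f {..<n}" and A: "A \<in> ord_tri n f"
  shows "det A = (\<Prod>a<n. A $$ (a, a))"
proof -
  have car: "A \<in> carrier_mat n n" using A by (rule ord_tri_carrier)
  have z: "(\<Prod>i = 0..<n. A $$ (i, p i)) = 0" if p: "p permutes {0..<n}" "p \<noteq> id" for p
  proof (rule ccontr)
    assume nz: "\<not> ?thesis"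
    have "f a \<le> f (p a)" if "a \<in> {0..<n}" for a
    proof -
      have "A $$ (a, p a) \<noteq> 0" using nz that by auto
      moreover have "p a < n" using permutes_in_image[OF p(1)] that by auto
      ultimately show ?thesis using that ord_triD[OF A, of a "p a"] by force
    qed
    then have "p = id"
      using permutes_decreasing_imp_id[of "{0..<n}" p f] p inj by (auto simp: atLeast0LessThan)
    then show False using p by simp
  qed
  have "det A = (\<Sum>p\<in>{p. p permutes {0..<n}}. signof p * (\<Prod>i = 0..<n. A $$ (i, p i)))"
    by (rule det_def'[OF car])
  also have "\<dots> = (\<Sum>p\<in>{id}. signof p * (\<Prod>i = 0..<n. A $$ (i, p i)))"
    by (rule sum.mono_neutral_right)
       (auto simp: finite_permutations permutes_id z)
  finally show ?thesis by (simp add: atLeast0LessThan)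
qed

lemma ord_tri_mult:
  assumes "A \<in> ord_tri n f" "B \<in> ord_tri n f"
  shows "A * B \<in> ord_tri n f"
proof -
  have car: "A \<in> carrier_mat n n" "B \<in> carrier_mat n n" using assms by (auto simp: ord_tri_carrier)
  have "f a \<le> f b" if "a < n" "b < n" "(A * B) $$ (a, b) \<noteq> 0" for a b
  proof -
    have "\<exists>j<n. A $$ (a, j) * B $$ (j, b) \<noteq> 0"
      using that mult_mat_nth[OF car, of a b] by (metis (no_types, lifting) lessThan_iff sum.neutral)
    then obtain j where "j < n" "A $$ (a, j) \<noteq> 0" "B $$ (j, b) \<noteq> 0" by auto
    then have "f a \<le> f j" "f j \<le> f b" using assms that by (auto simp: ord_tri_def)
    then show ?thesis by simp
  qed
  then show ?thesis using car by (auto simp: ord_tri_def)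
qed

lemma ord_tri_mult_diag:
  assumes inj: "inj_on f {..<n}" and A: "A \<in> ord_tri n f" and B: "B \<in> ord_tri n f" and a: "a < n"
  shows "(A * B) $$ (a, a) = A $$ (a, a) * B $$ (a, a)"
proof -
  have "A $$ (a, j) * B $$ (j, a) = 0" if "j < n" "j \<noteq> a" for j
  proof (rule ccontr)
    assume "\<not> ?thesis"
    then have "f a \<le> f j" "f j \<le> f a" using A B a that by (auto simp: ord_tri_def)
    then show False using inj a that by (auto dest: inj_onD)
  qed
  then have "(\<Sum>j<n. A $$ (a, j) * B $$ (j, a)) = (\<Sum>j\<in>{a}. A $$ (a, j) * B $$ (j, a))"
    using a by (intro sum.mono_neutral_right) auto
  then show ?thesis
    by (simp add: mult_mat_nth[OF ord_tri_carrier[OF A] ord_tri_carrier[OF B] a a])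
qed

lemma ord_unip_mult:
  "inj_on f {..<n} \<Longrightarrow> A \<in> ord_unip n f \<Longrightarrow> B \<in> ord_unip n f \<Longrightarrow> A * B \<in> ord_unip n f"
  by (auto simp: ord_unip_def ord_tri_mult ord_tri_mult_diag)

lemma ord_borel_mult:
  "A \<in> ord_borel n f \<Longrightarrow> B \<in> ord_borel n f \<Longrightarrow> A * B \<in> ord_borel n f"
  by (auto simp: ord_borel_def ord_tri_mult det_mult[OF ord_tri_carrier ord_tri_carrier])

lemma ord_unip_borel: "inj_on f {..<n} \<Longrightarrow> A \<in> ord_unip n f \<Longrightarrow> A \<in> ord_borel n f"
  by (auto simp: ord_unip_def ord_borel_def det_ord_tri)

lemma one_ord_unip: "1\<^sub>m n \<in> ord_unip n f"
  by (auto simp: ord_unip_def ord_tri_def)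

lemma one_ord_borel: "1\<^sub>m n \<in> ord_borel n f"
  by (auto simp: ord_borel_def ord_tri_def)

section \<open>Inverses inside the triangular groups\<close>

lemma det_nonzero_inverse:
  assumes "(A :: complex mat) \<in> carrier_mat n n" "det A \<noteq> 0"
  obtains B where "B \<in> carrier_mat n n" "A * B = 1\<^sub>m n" "B * A = 1\<^sub>m n"
proof -
  have "\<exists>B. B \<in> carrier_mat n n \<and> B * A = 1\<^sub>m n \<and> A * B = 1\<^sub>m n"
    using det_non_zero_imp_unit[OF assms, of undefined] by (auto simp: Units_def ring_mat_def)
  then show ?thesis using that by blast
qed

lemma mult_left_cancel_mat:
  assumes A: "(A :: complex mat) \<in> carrier_mat n n" and d: "det A \<noteq> 0"
    and X: "X \<in> carrier_mat n k" and Y: "Y \<in> carrier_mat n k" and eq: "A * X = A * Y"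
  shows "X = Y"
proof -
  obtain B where B: "B \<in> carrier_mat n n" "A * B = 1\<^sub>m n" "B * A = 1\<^sub>m n"
    by (rule det_nonzero_inverse[OF A d])
  have "B * (A * X) = X" "B * (A * Y) = Y"
    by (simp_all only: assoc_mult_mat[OF B(1) A X, symmetric] assoc_mult_mat[OF B(1) A Y, symmetric]
        B(3) left_mult_one_mat[OF X] left_mult_one_mat[OF Y])
  then show ?thesis using eq by metis
qed

lemma ord_borel_diag_nonzero:
  assumes "inj_on f {..<n}" "A \<in> ord_borel n f" "a < n"
  shows "A $$ (a, a) \<noteq> 0"
proof -
  have "(\<Prod>a<n. A $$ (a, a)) = 1"
    using det_ord_tri[OF assms(1), of A] assms(2) by (simp add: ord_borel_def)
  then have "(\<Prod>a<n. A $$ (a, a)) \<noteq> 0" by (simp only: one_neq_zero not_False_eq_True)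
  then show ?thesis using assms(3) by (simp add: prod_zero_iff)
qed

lemma finite_obtain_maximal:
  assumes "finite S" "S \<noteq> {}"
  obtains c where "c \<in> S" "\<And>x. x \<in> S \<Longrightarrow> f x \<le> (f c :: int)"
proof -
  have "Max (f ` S) \<in> f ` S" using assms by (intro Max_in) auto
  then obtain c where "c \<in> S" "f c = Max (f ` S)" by auto
  then show ?thesis using assms by (intro that[of c]) auto
qed

lemma ord_borel_inverse:
  assumes inj: "inj_on f {..<n}" and A: "A \<in> ord_borel n f"
  obtains B where "B \<in> ord_borel n f" "A * B = 1\<^sub>m n" "B * A = 1\<^sub>m n"
proof -
  have car: "A \<in> carrier_mat n n" and tri: "A \<in> ord_tri n f" and dA: "det A = 1"
    using A by (auto simp: ord_borel_def ord_tri_carrier)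
  obtain B where B: "B \<in> carrier_mat n n" "A * B = 1\<^sub>m n" "B * A = 1\<^sub>m n"
    using det_nonzero_inverse[OF car] dA by auto
  have "f a \<le> f b" if "a < n" "b < n" "B $$ (a, b) \<noteq> 0" for a b
  proof (rule ccontr)
    assume "\<not> f a \<le> f b"
    \<comment> \<open>Among the nonzero entries of column \<open>b\<close> of the inverse, the one
      whose row \<open>c\<close> is largest for \<open>f\<close> meets only the diagonal entry of
      row \<open>c\<close> of \<open>A\<close>. Then \<open>A * B\<close> would be nonzero at
      \<open>(c, b)\<close>, although \<open>c\<close> differs from \<open>b\<close>.\<close>
    define S where "S = {a. a < n \<and> B $$ (a, b) \<noteq> 0}"
    have "finite S" "S \<noteq> {}" using that by (auto simp: S_def)
    then obtain c where c: "c \<in> S" "\<And>x. x \<in> S \<Longrightarrow> f x \<le> f c"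
      by (rule finite_obtain_maximal[of S f]) blast
    have cn: "c < n" and cb: "c \<noteq> b"
      using c(1) c(2)[of a] that \<open>\<not> f a \<le> f b\<close> by (auto simp: S_def)
    have "A $$ (c, j) * B $$ (j, b) = 0" if j: "j < n" "j \<noteq> c" for j
    proof (rule ccontr)
      assume nz: "\<not> ?thesis"
      then have "f c \<le> f j" using tri cn j by (auto simp: ord_tri_def)
      moreover have "f j \<le> f c" using nz j by (intro c(2)) (auto simp: S_def)
      ultimately show False using inj cn j by (auto dest: inj_onD)
    qed
    then have "(\<Sum>j<n. A $$ (c, j) * B $$ (j, b)) = (\<Sum>j\<in>{c}. A $$ (c, j) * B $$ (j, b))"
      using cn by (intro sum.mono_neutral_right) auto
    then have "(A * B) $$ (c, b) = A $$ (c, c) * B $$ (c, b)"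
      by (simp add: mult_mat_nth[OF car B(1) cn that(2)])
    moreover have "A $$ (c, c) \<noteq> 0" by (rule ord_borel_diag_nonzero[OF inj A cn])
    moreover have "B $$ (c, b) \<noteq> 0" using c(1) by (auto simp: S_def)
    moreover have "(A * B) $$ (c, b) = 0" using B(2) cn that(2) cb by simp
    ultimately show False by simp
  qed
  moreover have "det B = 1" using arg_cong[OF B(2), of det] det_mult[OF car B(1)] dA by simp
  ultimately have "B \<in> ord_borel n f" using B(1) by (auto simp: ord_borel_def ord_tri_def)
  then show ?thesis using B that by blast
qed

lemma ord_unip_inverse:
  assumes inj: "inj_on f {..<n}" and A: "A \<in> ord_unip n f"
  obtains B where "B \<in> ord_unip n f" "A * B = 1\<^sub>m n" "B * A = 1\<^sub>m n"
proof -
  obtain B where B: "B \<in> ord_borel n f" "A * B = 1\<^sub>m n" "B * A = 1\<^sub>m n"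
    using ord_borel_inverse[OF inj ord_unip_borel[OF inj A]] by metis
  have "B $$ (a, a) = 1" if "a < n" for a
    using ord_tri_mult_diag[OF inj, of A B a] A B(1) that arg_cong[OF B(2), of "\<lambda>M. M $$ (a, a)"]
    by (auto simp: ord_unip_def ord_borel_def)
  then show ?thesis using B that by (auto simp: ord_unip_def ord_borel_def)
qed

text \<open>The statement \<open>N \<inter> B_- = 1\<close> for an arbitrary order. It is the source
  of the uniqueness behind \<open>left_unip\<close>, \<open>right_unip\<close> and
  \<open>cap_rep\<close>.\<close>

lemma ord_unip_opposite_trivial:
  assumes inj: "inj_on f {..<n}" and A: "A \<in> ord_unip n f" "A \<in> ord_borel n (\<lambda>a. - f a)"
  shows "A = 1\<^sub>m n"
proof -
  have "A $$ (a, b) = 0" if "a < n" "b < n" "a \<noteq> b" for a b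
  proof -
    have "f a \<noteq> f b" using inj that by (auto dest: inj_onD)
    then show ?thesis using A that by (fastforce simp: ord_unip_def ord_borel_def ord_tri_def)
  qed
  then show ?thesis
    using A by (auto simp: ord_unip_def ord_tri_def intro!: eq_matI)
qed

lemma transpose_ord_tri: "A \<in> ord_tri n f \<Longrightarrow> transpose_mat A \<in> ord_tri n (\<lambda>a. - f a)"
  by (auto simp: ord_tri_def)

lemma transpose_ord_unip: "A \<in> ord_unip n f \<Longrightarrow> transpose_mat A \<in> ord_unip n (\<lambda>a. - f a)"
  by (auto simp: ord_unip_def transpose_ord_tri) (auto simp: ord_tri_def)

lemma transpose_ord_borel: "A \<in> ord_borel n f \<Longrightarrow> transpose_mat A \<in> ord_borel n (\<lambda>a. - f a)"
  by (auto simp: ord_borel_def transpose_ord_tri det_transpose[OF ord_tri_carrier])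

lemma Unip_eq: "Unip n = ord_unip n int"
proof -
  have "A \<in> carrier_mat n n \<Longrightarrow> upper_triangular A \<longleftrightarrow> A \<in> ord_tri n int" for A
    by (auto simp: ord_tri_def upper_triangular_def) (metis not_le less_trans)+
  then show ?thesis by (auto simp: Unip_def ord_unip_def ord_tri_carrier)
qed

lemma Borel_minus_eq: "Borel_minus n = ord_borel n lower"
proof -
  have "A \<in> carrier_mat n n \<Longrightarrow> upper_triangular (transpose_mat A) \<longleftrightarrow> A \<in> ord_tri n lower" for A
    by (auto simp: ord_tri_def upper_triangular_def) (metis not_le less_trans)+
  then show ?thesis by (auto simp: Borel_minus_def ord_borel_def ord_tri_carrier)
qed

lemma inj_lower: "inj_on lower A" by (auto simp: inj_on_def)


section \<open>Elementary matrices\<close>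

declare index_mult_mat(1) [simp del]

lemma square_mult_carrier [simp]:
  "A \<in> carrier_mat n n \<Longrightarrow> B \<in> carrier_mat n n \<Longrightarrow> A * B \<in> carrier_mat n n"
  by (rule mult_carrier_mat)

lemma sdot_carrier [simp]: "sdot n i \<in> carrier_mat n n"
  and x_mat_carrier [simp]: "x_mat n i t \<in> carrier_mat n n"
  by (auto simp: sdot_def x_mat_def)

lemma sdot_dim [simp]: "dim_row (sdot n i) = n" "dim_col (sdot n i) = n"
  and x_mat_dim [simp]: "dim_row (x_mat n i t) = n" "dim_col (x_mat n i t) = n"
  by (auto simp: sdot_def x_mat_def)

lemma sdot_nth: "a < n \<Longrightarrow> b < n \<Longrightarrow> sdot n i $$ (a, b) =
    (if a = i \<and> b = Suc i then 1 else if a = Suc i \<and> b = i then - 1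
     else if a = b \<and> a \<noteq> i \<and> a \<noteq> Suc i then 1 else 0)"
  and x_mat_nth: "a < n \<Longrightarrow> b < n \<Longrightarrow> x_mat n i t $$ (a, b) =
    (if a = b then 1 else if a = i \<and> b = Suc i then t else 0)"
  by (simp_all add: sdot_def x_mat_def)

lemma sum_two_support:
  assumes "i < n" "j < n" "i \<noteq> j" "\<And>k. k < n \<Longrightarrow> k \<noteq> i \<Longrightarrow> k \<noteq> j \<Longrightarrow> g k = (0 :: 'a :: comm_monoid_add)"
  shows "(\<Sum>k<(n::nat). g k) = g i + g j"
proof -
  have "(\<Sum>k<n. g k) = (\<Sum>k\<in>{i, j}. g k)"
    using assms by (intro sum.mono_neutral_right) auto
  then show ?thesis using assms by simp
qed

lemma sum_one_support:
  assumes "i < n" "\<And>k. k < n \<Longrightarrow> k \<noteq> i \<Longrightarrow> g k = (0 :: 'a :: comm_monoid_add)"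
  shows "(\<Sum>k<(n::nat). g k) = g i"
proof -
  have "(\<Sum>k<n. g k) = (\<Sum>k\<in>{i}. g k)"
    using assms by (intro sum.mono_neutral_right) auto
  then show ?thesis by simp
qed

lemma mult_sdot_nth:
  assumes "A \<in> carrier_mat p n" "Suc i < n" "r < p" "c < n"
  shows "(A * sdot n i) $$ (r, c) =
    (if c = i then - A $$ (r, Suc i) else if c = Suc i then A $$ (r, i) else A $$ (r, c))"
proof -
  have "(A * sdot n i) $$ (r, c) = (\<Sum>k<n. A $$ (r, k) * sdot n i $$ (k, c))"
    using assms by (intro mult_mat_nth) auto
  also have "\<dots> = A $$ (r, simple_refl i c) * sdot n i $$ (simple_refl i c, c)"
    using assms by (intro sum_one_support)
      (auto simp: sdot_def simple_refl_def Transposition.transpose_def split: if_splits)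
  finally show ?thesis
    using assms by (auto simp: sdot_def simple_refl_def Transposition.transpose_def)
qed

lemma sdot_mult_nth:
  assumes "A \<in> carrier_mat n p" "Suc i < n" "r < n" "c < p"
  shows "(sdot n i * A) $$ (r, c) =
    (if r = i then A $$ (Suc i, c) else if r = Suc i then - A $$ (i, c) else A $$ (r, c))"
proof -
  have "(sdot n i * A) $$ (r, c) = (\<Sum>k<n. sdot n i $$ (r, k) * A $$ (k, c))"
    using assms by (intro mult_mat_nth) auto
  also have "\<dots> = sdot n i $$ (r, simple_refl i r) * A $$ (simple_refl i r, c)"
    using assms by (intro sum_one_support)
      (auto simp: sdot_def simple_refl_def Transposition.transpose_def split: if_splits)
  finally show ?thesis
    using assms by (auto simp: sdot_def simple_refl_def Transposition.transpose_def)
qed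

lemma mult_x_mat_nth:
  assumes "A \<in> carrier_mat p n" "Suc i < n" "r < p" "c < n"
  shows "(A * x_mat n i t) $$ (r, c) = A $$ (r, c) + (if c = Suc i then t * A $$ (r, i) else 0)"
proof -
  have *: "(A * x_mat n i t) $$ (r, c) = (\<Sum>k<n. A $$ (r, k) * x_mat n i t $$ (k, c))"
    using assms by (intro mult_mat_nth) auto
  show ?thesis
  proof (cases "c = Suc i")
    case True
    have "(\<Sum>k<n. A $$ (r, k) * x_mat n i t $$ (k, c)) =
        A $$ (r, i) * x_mat n i t $$ (i, c) + A $$ (r, Suc i) * x_mat n i t $$ (Suc i, c)"
      using assms True by (intro sum_two_support) (auto simp: x_mat_def)
    then show ?thesis using * assms True by (auto simp: x_mat_def)
  next
    case False
    have "(\<Sum>k<n. A $$ (r, k) * x_mat n i t $$ (k, c)) = A $$ (r, c) * x_mat n i t $$ (c, c)"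
      using assms False by (intro sum_one_support) (auto simp: x_mat_def)
    then show ?thesis using * assms False by (auto simp: x_mat_def)
  qed
qed

lemma x_mat_mult_nth:
  assumes "A \<in> carrier_mat n p" "Suc i < n" "r < n" "c < p"
  shows "(x_mat n i t * A) $$ (r, c) = A $$ (r, c) + (if r = i then t * A $$ (Suc i, c) else 0)"
proof -
  have *: "(x_mat n i t * A) $$ (r, c) = (\<Sum>k<n. x_mat n i t $$ (r, k) * A $$ (k, c))"
    using assms by (intro mult_mat_nth) auto
  show ?thesis
  proof (cases "r = i")
    case True
    have "(\<Sum>k<n. x_mat n i t $$ (r, k) * A $$ (k, c)) =
        x_mat n i t $$ (r, i) * A $$ (i, c) + x_mat n i t $$ (r, Suc i) * A $$ (Suc i, c)"
      using assms True by (intro sum_two_support) (auto simp: x_mat_def)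
    then show ?thesis using * assms True by (auto simp: x_mat_def)
  next
    case False
    have "(\<Sum>k<n. x_mat n i t $$ (r, k) * A $$ (k, c)) = x_mat n i t $$ (r, r) * A $$ (r, c)"
      using assms False by (intro sum_one_support) (auto simp: x_mat_def)
    then show ?thesis using * assms False by (auto simp: x_mat_def)
  qed
qed

lemma sdot_orth:
  assumes "Suc i < n"
  shows "sdot n i * transpose_mat (sdot n i) = 1\<^sub>m n" "transpose_mat (sdot n i) * sdot n i = 1\<^sub>m n"
proof -
  show "sdot n i * transpose_mat (sdot n i) = 1\<^sub>m n"
    by (rule eq_matI, use assms in \<open>auto simp: sdot_mult_nth[where p = n] sdot_nth\<close>)
  show "transpose_mat (sdot n i) * sdot n i = 1\<^sub>m n"
    by (rule eq_matI, use assms in \<open>auto simp: mult_sdot_nth[where p = n] sdot_nth\<close>)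
qed

lemma x_mat_ord_unip:
  assumes "Suc i < n" "f i \<le> f (Suc i)"
  shows "x_mat n i t \<in> ord_unip n f"
  using assms by (auto simp: ord_unip_def ord_tri_def x_mat_def)

lemma det_x_mat: "Suc i < n \<Longrightarrow> det (x_mat n i t) = 1"
  using ord_unip_borel[OF _ x_mat_ord_unip[of i n int t]] by (auto simp: ord_borel_def)

lemma det_sdot:
  assumes "Suc i < n"
  shows "det (sdot n i) = 1"
proof -
  \<comment> \<open>\<open>sdot n i\<close> is this diagonal matrix with rows \<open>i\<close> and
    \<open>Suc i\<close> exchanged; the sign of the exchange cancels the entry
    \<open>- 1\<close>.\<close>
  define D :: "complex mat" where "D = mat n n (\<lambda>(a, b). if a = b then if a = i then - 1 else 1 else 0)"
  have D: "D \<in> ord_tri n int" by (auto simp: D_def ord_tri_def)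
  have "det D = (\<Prod>a<n. if a = i then - 1 else 1)"
    by (subst det_ord_tri[OF _ D]) (auto simp: D_def intro!: prod.cong)
  also have "\<dots> = - 1" using assms by simp
  finally have det: "det D = - 1" .
  have p: "Transposition.transpose i (Suc i) permutes {0..<n}"
    using assms by (intro permutes_swap_id) auto
  have "sdot n i = mat n n (\<lambda>(a, b). D $$ (Transposition.transpose i (Suc i) a, b))"
    by (rule eq_matI, use assms in \<open>auto simp: sdot_nth D_def Transposition.transpose_def\<close>)
  then have "det (sdot n i) = signof (Transposition.transpose i (Suc i)) * det D"
    using det_permute_rows[OF ord_tri_carrier[OF D] p] by simp
  then show ?thesis by (simp add: det sign_swap_id)
qed

lemma sdot_conj_nth:
  assumes "X \<in> carrier_mat n n" "Suc i < n" "r < n" "c < n"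
  shows "(sdot n i * X * transpose_mat (sdot n i)) $$ (r, c) =
      (if r = Suc i then - 1 else 1) * (if c = Suc i then - 1 else 1) *
        X $$ (simple_refl i r, simple_refl i c)"
    (is ?A)
    and "(transpose_mat (sdot n i) * X * sdot n i) $$ (r, c) =
      (if r = i then - 1 else 1) * (if c = i then - 1 else 1) *
        X $$ (simple_refl i r, simple_refl i c)"
    (is ?B)
proof -
  have car: "sdot n i * transpose_mat X \<in> carrier_mat n n" "transpose_mat X * sdot n i \<in> carrier_mat n n"
    "sdot n i * X \<in> carrier_mat n n"  "X * sdot n i \<in> carrier_mat n n"
    "transpose_mat X \<in> carrier_mat n n"
    using assms by auto
  have 1: "sdot n i * X * transpose_mat (sdot n i) = transpose_mat (sdot n i * (transpose_mat (sdot n i * X)))"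
    using assms by (subst transpose_mult[of _ n n _ n]) auto
  have 2: "transpose_mat (sdot n i) * X * sdot n i = transpose_mat (transpose_mat X * sdot n i) * sdot n i"
    using assms by (subst transpose_mult[of _ n n _ n]) auto
  show ?A unfolding 1 using assms car
    by (auto simp: carrier_matD sdot_mult_nth[where p = n] simple_refl_def Transposition.transpose_def)
  show ?B unfolding 2 using assms car
    by (auto simp: carrier_matD mult_sdot_nth[where p = n] simple_refl_def Transposition.transpose_def)
qed

lemma simple_refl_simps [simp]:
  "simple_refl i i = Suc i" "simple_refl i (Suc i) = i" "simple_refl i (simple_refl i a) = a"
  "a \<noteq> i \<Longrightarrow> a \<noteq> Suc i \<Longrightarrow> simple_refl i a = a"
  by (auto simp: simple_refl_def)

lemma simple_refl_comp [simp]: "simple_refl i \<circ> simple_refl i = id"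
  "f \<circ> simple_refl i \<circ> simple_refl i = f"
  by (auto simp: fun_eq_iff)

lemma simple_refl_less: "Suc i < n \<Longrightarrow> simple_refl i a < n \<longleftrightarrow> a < n"
  by (auto simp: simple_refl_def Transposition.transpose_def)

lemma simple_refl_permutes: "Suc i < n \<Longrightarrow> simple_refl i permutes {..<n}"
  unfolding simple_refl_def by (rule permutes_swap_id) auto

lemma simple_refl_inj: "simple_refl i a = simple_refl i b \<longleftrightarrow> a = b"
  by (metis simple_refl_simps(3))

text \<open>Up to signs, conjugation by \<open>sdot n i\<close> in either direction relabels the
  indices by the involution \<open>simple_refl i\<close>, and triangularity depends only on which
  entries vanish.\<close>

lemma sdot_conj_ord_tri:
  assumes "X \<in> ord_tri n (g \<circ> simple_refl i)" "Suc i < n"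
  shows "sdot n i * X * transpose_mat (sdot n i) \<in> ord_tri n g"
    "transpose_mat (sdot n i) * X * sdot n i \<in> ord_tri n g"
proof -
  note X = ord_tri_carrier[OF assms(1)]
  have *: "g a \<le> g b" if "X $$ (simple_refl i a, simple_refl i b) \<noteq> 0" "a < n" "b < n" for a b
  proof -
    have "simple_refl i a < n" "simple_refl i b < n" using that assms(2) by (simp_all add: simple_refl_less)
    then show ?thesis using that assms(1) by (fastforce simp: ord_tri_def)
  qed
  have car: "sdot n i * X * transpose_mat (sdot n i) \<in> carrier_mat n n"
     "transpose_mat (sdot n i) * X * sdot n i \<in> carrier_mat n n" using X by auto
  show "sdot n i * X * transpose_mat (sdot n i) \<in> ord_tri n g"
    using * car by (auto simp: ord_tri_def sdot_conj_nth[OF X assms(2)])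
  show "transpose_mat (sdot n i) * X * sdot n i \<in> ord_tri n g"
    using * car by (auto simp: ord_tri_def sdot_conj_nth[OF X assms(2)])
qed

lemma sdot_conj_cancel:
  assumes "X \<in> carrier_mat n n" "Suc i < n"
  shows "sdot n i * X * transpose_mat (sdot n i) * sdot n i = sdot n i * X"
    "sdot n i * (transpose_mat (sdot n i) * X * sdot n i) = X * sdot n i"
proof -
  let ?s = "sdot n i" and ?t = "transpose_mat (sdot n i)"
  have t: "?t \<in> carrier_mat n n" by simp
  have "?s * X * ?t * ?s = ?s * X * (?t * ?s)"
    by (rule assoc_mult_mat[of _ n n _ n _ n]) (use assms t in simp_all)
  then show "?s * X * ?t * ?s = ?s * X" using assms by (simp add: sdot_orth)
  have "?s * (?t * X * ?s) = ?s * (?t * (X * ?s))"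
    using assoc_mult_mat[of ?t n n X n ?s n] assms by simp
  also have "\<dots> = (?s * ?t) * (X * ?s)"
    by (rule assoc_mult_mat[of _ n n _ n _ n, symmetric]) (use assms t in simp_all)
  finally show "?s * (?t * X * ?s) = X * ?s" using assms by (simp add: sdot_orth)
qed

lemma sdot_conj_det:
  assumes "X \<in> carrier_mat n n" "Suc i < n"
  shows "det (sdot n i * X * transpose_mat (sdot n i)) = det X"
    "det (transpose_mat (sdot n i) * X * sdot n i) = det X"
  using assms by (simp_all add: det_mult[of _ n] det_transpose[of _ n] det_sdot)

lemma sdot_conj_diag:
  assumes "X \<in> carrier_mat n n" "Suc i < n" "a < n"
  shows "(sdot n i * X * transpose_mat (sdot n i)) $$ (a, a) = X $$ (simple_refl i a, simple_refl i a)"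
    "(transpose_mat (sdot n i) * X * sdot n i) $$ (a, a) = X $$ (simple_refl i a, simple_refl i a)"
  using assms by (simp_all add: sdot_conj_nth)

lemma sdot_move_left:
  assumes "Suc i < n"
  shows "X \<in> ord_unip n (g \<circ> simple_refl i) \<Longrightarrow> \<exists>Y\<in>ord_unip n g. sdot n i * X = Y * sdot n i"
    and "X \<in> ord_borel n (g \<circ> simple_refl i) \<Longrightarrow> \<exists>Y\<in>ord_borel n g. sdot n i * X = Y * sdot n i"
proof -
  show "\<exists>Y\<in>ord_unip n g. sdot n i * X = Y * sdot n i" if "X \<in> ord_unip n (g \<circ> simple_refl i)"
    using sdot_conj_ord_tri(1)[of X n g i] sdot_conj_diag(1)[OF ord_unip_carrier[OF that] assms]
      sdot_conj_cancel(1)[OF ord_unip_carrier[OF that] assms] assms that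
    by (intro bexI[of _ "sdot n i * X * transpose_mat (sdot n i)"])
      (simp_all add: ord_unip_def simple_refl_less)
  show "\<exists>Y\<in>ord_borel n g. sdot n i * X = Y * sdot n i" if "X \<in> ord_borel n (g \<circ> simple_refl i)"
    using sdot_conj_ord_tri(1)[of X n g i] sdot_conj_det(1)[OF ord_borel_carrier[OF that] assms]
      sdot_conj_cancel(1)[OF ord_borel_carrier[OF that] assms] assms that
    by (intro bexI[of _ "sdot n i * X * transpose_mat (sdot n i)"])
      (simp_all add: ord_borel_def)
qed

lemma sdot_move_right:
  assumes "Suc i < n"
  shows "X \<in> ord_unip n g \<Longrightarrow> \<exists>Y\<in>ord_unip n (g \<circ> simple_refl i). X * sdot n i = sdot n i * Y"
    and "X \<in> ord_borel n g \<Longrightarrow> \<exists>Y\<in>ord_borel n (g \<circ> simple_refl i). X * sdot n i = sdot n i * Y"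
proof -
  show "\<exists>Y\<in>ord_unip n (g \<circ> simple_refl i). X * sdot n i = sdot n i * Y" if "X \<in> ord_unip n g"
    using sdot_conj_ord_tri(2)[of X n "g \<circ> simple_refl i" i] sdot_conj_diag(2)[OF ord_unip_carrier[OF that] assms]
      sdot_conj_cancel(2)[OF ord_unip_carrier[OF that] assms] assms that
    by (intro bexI[of _ "transpose_mat (sdot n i) * X * sdot n i"])
      (simp_all add: ord_unip_def simple_refl_less)
  show "\<exists>Y\<in>ord_borel n (g \<circ> simple_refl i). X * sdot n i = sdot n i * Y" if "X \<in> ord_borel n g"
    using sdot_conj_ord_tri(2)[of X n "g \<circ> simple_refl i" i] sdot_conj_det(2)[OF ord_borel_carrier[OF that] assms]
      sdot_conj_cancel(2)[OF ord_borel_carrier[OF that] assms] assms that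
    by (intro bexI[of _ "transpose_mat (sdot n i) * X * sdot n i"])
      (simp_all add: ord_borel_def)
qed

text \<open>If the entry at \<open>(Suc i, i)\<close> vanishes, a lower triangular matrix stays
  triangular after \<open>i\<close> and \<open>Suc i\<close> are exchanged in the order. This
  describes the group \<open>B_- \<inter> s B_- s\<close>, whose elements cross \<open>s\<close> in
  both directions without leaving \<open>B_-\<close>.\<close>

lemma sdot_lower_move:
  assumes "Suc i < n" "X \<in> ord_borel n lower" "X $$ (Suc i, i) = 0"
  shows "\<exists>Y\<in>ord_borel n lower. sdot n i * X = Y * sdot n i"
    and "\<exists>Y\<in>ord_borel n lower. X * sdot n i = sdot n i * Y"
proof -
  have X: "X \<in> ord_borel n (lower \<circ> simple_refl i)"
  proof -
    have "lower (simple_refl i a) \<le> lower (simple_refl i b)"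
      if "X $$ (a, b) \<noteq> 0" "a < n" "b < n" for a b
    proof -
      have "b \<le> a" using assms that by (auto simp: ord_borel_def ord_tri_def)
      moreover have "\<not> (a = Suc i \<and> b = i)" using assms that by auto
      ultimately show ?thesis by (auto simp: simple_refl_def Transposition.transpose_def)
    qed
    then show ?thesis using assms by (auto simp: ord_borel_def ord_tri_def)
  qed
  then show "\<exists>Y\<in>ord_borel n lower. sdot n i * X = Y * sdot n i"
    by (rule sdot_move_left(2)[OF assms(1)])
  show "\<exists>Y\<in>ord_borel n lower. X * sdot n i = sdot n i * Y"
    using sdot_move_right(2)[OF assms(1) X] by (simp add: comp_assoc)
qed


section \<open>Minors\<close>

lemma minor_eq_det:
  assumes "A \<in> carrier_mat n n" "I \<subseteq> {..<n}" "J \<subseteq> {..<n}"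
  shows "minor I J A = det (mat (card I) (card J) (\<lambda>(i, j). A $$ (pick I i, pick J j)))"
proof -
  have "{i. i < n \<and> i \<in> I} = I" "{i. i < n \<and> i \<in> J} = J" using assms by auto
  then show ?thesis using assms by (simp add: minor_def submatrix_def)
qed

lemma pick_in_subset: "I \<subseteq> {..<n} \<Longrightarrow> j < card I \<Longrightarrow> pick I j < (n::nat)"
  using pick_in_set_le by blast

lemma pick_eqI: "x \<in> I \<Longrightarrow> card {a \<in> I. a < x} = j \<Longrightarrow> pick I j = x"
  using pick_card_in_set by auto

lemma pick_inj_on: "inj_on (pick S) {..<card S}"
proof (rule inj_onI)
  fix b b' assume "b \<in> {..<card S}" "b' \<in> {..<card S}" and eq: "pick S b = pick S b'"
  then have lt: "b < card S" "b' < card S" by auto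
  show "b = b'" using card_pick_le[OF lt(1)] card_pick_le[OF lt(2)] unfolding eq by (rule trans[OF sym])
qed

lemma pick_strict_mono_image:
  assumes "strict_mono_on C f" "j < card C"
  shows "pick (f ` C) j = f (pick C j)"
proof (rule pick_eqI)
  have C: "pick C j \<in> C" by (rule pick_in_set_le[OF assms(2)])
  show "f (pick C j) \<in> f ` C" using C by auto
  have inj: "inj_on f C" using assms(1) by (rule strict_mono_on_imp_inj_on)
  have "{a \<in> f ` C. a < f (pick C j)} = f ` {a \<in> C. a < pick C j}"
    using C strict_mono_on_less[OF assms(1)] by auto
  then have "card {a \<in> f ` C. a < f (pick C j)} = card {a \<in> C. a < pick C j}"
    using inj by (simp add: card_image inj_on_subset)
  then show "card {a \<in> f ` C. a < f (pick C j)} = j" using card_pick_le[OF assms(2)] by simp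
qed

lemma pick_lessThan: "j < m \<Longrightarrow> pick {..<m} j = (j::nat)"
proof (rule pick_eqI)
  assume "j < m"
  then have "{a \<in> {..<m}. a < j} = {..<j}" by auto
  then show "card {a \<in> {..<m}. a < j} = j" by simp
qed auto

lemma pick_interval: "j < n - h \<Longrightarrow> pick {h..<n} j = h + j"
proof -
  assume j: "j < n - h"
  have eq: "{h..<n} = (+) h ` {..<n - h}"
  proof (intro subset_antisym subsetI)
    fix x assume "x \<in> {h..<n}"
    then show "x \<in> (+) h ` {..<n - h}" by (intro image_eqI[of _ _ "x - h"]) auto
  qed auto
  show ?thesis unfolding eq
    by (subst pick_strict_mono_image) (use j in \<open>auto simp: strict_mono_on_def pick_lessThan\<close>)
qed

lemma minor_transpose:
  assumes "A \<in> carrier_mat n n" "I \<subseteq> {..<n}" "J \<subseteq> {..<n}" "card I = card J"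
  shows "minor J I (transpose_mat A) = minor I J A"
proof -
  let ?M = "mat (card I) (card J) (\<lambda>(i, j). A $$ (pick I i, pick J j))"
  have "mat (card J) (card I) (\<lambda>(i, j). transpose_mat A $$ (pick J i, pick I j)) = transpose_mat ?M"
    using assms pick_in_subset[OF assms(2)] pick_in_subset[OF assms(3)] by (intro eq_matI) auto
  moreover have "det (transpose_mat ?M) = det ?M"
    using assms by (intro det_transpose[of _ "card I"]) auto
  ultimately show ?thesis using assms by (simp add: minor_eq_det[of _ n])
qed

text \<open>Only column \<open>i\<close> of \<open>A * sdot n i\<close> is negated. If
  \<open>i\<close> is not selected, the selected columns are columns of \<open>A\<close> in
  unchanged order. If it is, the hypothesis selects its neighbour too, and the operation is a
  smaller \<open>sdot\<close> on the selected columns, of determinant 1. Selecting \<open>i\<close>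
  without \<open>Suc i\<close> would produce a sign.\<close>

lemma minor_mult_sdot:
  assumes A: "A \<in> carrier_mat n n" and R: "R \<subseteq> {..<n}" and C: "C \<subseteq> {..<n}"
    and i: "Suc i < n" and card: "card R = card C" and imp: "i \<in> C \<Longrightarrow> Suc i \<in> C"
  shows "minor R C (A * sdot n i) = minor R (simple_refl i ` C) A"
proof -
  have sC: "simple_refl i ` C \<subseteq> {..<n}" using C i by (auto simp: simple_refl_less)
  have cardC: "card (simple_refl i ` C) = card C"
    by (rule card_image) (simp add: inj_on_def simple_refl_inj)
  have AS: "A * sdot n i \<in> carrier_mat n n" using A by simp
  show ?thesis
  proof (cases "i \<in> C")
    case False
    have mono: "strict_mono_on C (simple_refl i)"
    proof (rule strict_mono_onI)
      fix x y assume "x \<in> C" "y \<in> C" "x < y"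
      then show "simple_refl i x < simple_refl i y"
        using False by (auto simp: simple_refl_def Transposition.transpose_def)
    qed
    have "(A * sdot n i) $$ (pick R a, pick C b) = A $$ (pick R a, pick (simple_refl i ` C) b)"
      if "a < card R" "b < card C" for a b
    proof -
      have "pick C b \<in> C" by (rule pick_in_set_le[OF that(2)])
      then have "pick C b \<noteq> i" "pick C b < n" using False C by auto
      then show ?thesis
        using pick_in_subset[OF R that(1)] i
        by (cases "pick C b = Suc i")
          (simp_all add: mult_sdot_nth[OF A i] pick_strict_mono_image[OF mono that(2)])
    qed
    then show ?thesis
      unfolding minor_eq_det[OF AS R C] minor_eq_det[OF A R sC] cardC
      by (intro arg_cong[of _ _ det] eq_matI) auto
  next
    case True
    then have both: "i \<in> C" "Suc i \<in> C" using imp by auto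
    then have sCeq: "simple_refl i ` C = C"
      by (auto simp: simple_refl_def Transposition.transpose_def image_iff split: if_splits)
    \<comment> \<open>The position of \<open>i\<close> within \<open>C\<close>. Since
      \<open>Suc i\<close> follows at position \<open>Suc q\<close>, the restricted matrix is
      multiplied by \<open>sdot (card C) q\<close>.\<close>
    define q where "q = card {a \<in> C. a < i}"
    have fin: "finite C" using C finite_subset by blast
    have pq: "pick C q = i" unfolding q_def by (rule pick_card_in_set[OF both(1)])
    have "{a \<in> C. a < Suc i} = insert i {a \<in> C. a < i}" using both by auto
    then have q2: "card {a \<in> C. a < Suc i} = Suc q" using fin by (simp add: q_def)
    then have pq2: "pick C (Suc q) = Suc i" using pick_card_in_set[OF both(2)] by simp
    have "card {a \<in> C. a < Suc i} < card C"
      by (rule psubset_card_mono[OF fin]) (use both in auto)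
    then have qd: "Suc q < card C" using q2 by simp
    have pinj: "pick C b = pick C b' \<longleftrightarrow> b = b'" if "b < card C" "b' < card C" for b b'
      using inj_on_eq_iff[OF pick_inj_on[of C]] that by simp
    let ?M = "mat (card R) (card C) (\<lambda>(a, b). A $$ (pick R a, pick C b))"
    have "(A * sdot n i) $$ (pick R a, pick C b) = (?M * sdot (card C) q) $$ (a, b)"
      if a: "a < card R" and b: "b < card C" for a b
    proof -
      have "pick C b = i \<longleftrightarrow> b = q" "pick C b = Suc i \<longleftrightarrow> b = Suc q"
        using pinj[OF b, of q] pinj[OF b, of "Suc q"] pq pq2 qd by simp_all
      then show ?thesis
        using pick_in_subset[OF R a] pick_in_subset[OF C b] a b qd i
        by (simp add: mult_sdot_nth[OF A i] mult_sdot_nth[where p = "card R"] pq pq2 del: pick.simps)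
    qed
    then have "mat (card R) (card C) (\<lambda>(a, b). (A * sdot n i) $$ (pick R a, pick C b)) = ?M * sdot (card C) q"
      by (intro eq_matI) auto
    moreover have "det (?M * sdot (card C) q) = det ?M"
      using card qd by (subst det_mult[of _ "card C"]) (auto simp: det_sdot)
    ultimately show ?thesis
      unfolding minor_eq_det[OF AS R C] sCeq minor_eq_det[OF A R C] by simp
  qed
qed

text \<open>Cauchy-Binet with one surviving term: the columns \<open>{h..<n}\<close> of a lower
  triangular \<open>B\<close> vanish in all rows below index \<open>h\<close>, so only the same
  columns of \<open>A\<close> contribute, and the corresponding block of \<open>B\<close> is again
  lower triangular.\<close>

lemma minor_mult_lower:
  assumes A: "A \<in> carrier_mat n n" and B: "B \<in> ord_tri n lower" and R: "R \<subseteq> {..<n}"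
    and card: "card R = n - h"
  shows "minor R {h..<n} (A * B) = minor R {h..<n} A * (\<Prod>j\<in>{h..<n}. B $$ (j, j))"
proof -
  let ?d = "n - h"
  have Bc: "B \<in> carrier_mat n n" by (rule ord_tri_carrier[OF B])
  have AB: "A * B \<in> carrier_mat n n" using A Bc by simp
  let ?M = "mat ?d ?d (\<lambda>(a, b). A $$ (pick R a, pick {h..<n} b))"
  let ?N = "mat ?d ?d (\<lambda>(a, b). B $$ (h + a, h + b))"
  have int: "{h..<n} \<subseteq> {..<n}" by auto
  have "(A * B) $$ (pick R a, pick {h..<n} b) = (?M * ?N) $$ (a, b)" if a: "a < ?d" and b: "b < ?d" for a b
  proof -
    have r: "pick R a < n" using pick_in_subset[OF R] a card by simp
    have "(A * B) $$ (pick R a, h + b) = (\<Sum>k<n. A $$ (pick R a, k) * B $$ (k, h + b))"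
      using r b by (intro mult_mat_nth[OF A Bc]) auto
    also have "\<dots> = (\<Sum>k\<in>{h..<n}. A $$ (pick R a, k) * B $$ (k, h + b))"
      using b by (intro sum.mono_neutral_right) (auto simp: ord_triD[OF B])
    also have "\<dots> = (\<Sum>k<?d. A $$ (pick R a, h + k) * B $$ (h + k, h + b))"
      by (rule sum.reindex_bij_witness[of _ "\<lambda>k. h + k" "\<lambda>k. k - h"]) auto
    also have "\<dots> = (\<Sum>k<?d. ?M $$ (a, k) * ?N $$ (k, b))"
      using a b by (intro sum.cong) (auto simp: pick_interval)
    also have "\<dots> = (?M * ?N) $$ (a, b)"
      using a b by (intro mult_mat_nth[symmetric]) auto
    finally show ?thesis using b by (simp add: pick_interval)
  qed
  then have "minor R {h..<n} (A * B) = det (?M * ?N)"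
    unfolding minor_eq_det[OF AB R int] using card by (intro arg_cong[of _ _ det] eq_matI) auto
  also have "\<dots> = det ?M * det ?N" by (rule det_mult) auto
  also have "det ?M = minor R {h..<n} A"
    unfolding minor_eq_det[OF A R int] using card by simp
  also have "det ?N = (\<Prod>a<?d. ?N $$ (a, a))"
  proof (rule det_ord_tri[OF inj_lower])
    have "b \<le> a" if "a < ?d" "b < ?d" "B $$ (h + a, h + b) \<noteq> 0" for a b
      using ord_triD[OF B, of "h + a" "h + b"] that by force
    then show "?N \<in> ord_tri ?d lower" by (auto simp: ord_tri_def)
  qed
  also have "\<dots> = (\<Prod>j\<in>{h..<n}. B $$ (j, j))"
    by (rule prod.reindex_bij_witness[of _ "\<lambda>k. k - h" "\<lambda>k. h + k"]) auto
  finally show ?thesis .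
qed

lemma minor_principal_ord_unip:
  assumes inj: "inj_on f {..<n}" and X: "X \<in> ord_unip n f" and S: "S \<subseteq> {..<n}"
  shows "minor S S X = 1"
proof -
  let ?M = "mat (card S) (card S) (\<lambda>(a, b). X $$ (pick S a, pick S b))"
  have tri: "X \<in> ord_tri n f" using X by (simp add: ord_unip_def)
  have pS: "pick S a < n" if "a < card S" for a by (rule pick_in_subset[OF S that])
  have inj': "inj_on (f \<circ> pick S) {..<card S}"
    by (rule comp_inj_on[OF pick_inj_on]) (rule inj_on_subset[OF inj], use pS in auto)
  have M: "?M \<in> ord_tri (card S) (f \<circ> pick S)"
    using tri pS by (auto simp: ord_tri_def)
  have "det ?M = (\<Prod>a<card S. ?M $$ (a, a))" by (rule det_ord_tri[OF inj' M])
  also have "\<dots> = 1" using X pS by (intro prod.neutral) (auto simp: ord_unip_def)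
  finally show ?thesis by (simp add: minor_eq_det[OF ord_tri_carrier[OF tri] S S])
qed

text \<open>The same reversal acts on rows and on columns, so its sign enters squared.\<close>

lemma det_reverse:
  assumes "M \<in> carrier_mat d d"
  shows "det (mat d d (\<lambda>(a, b). M $$ (d - Suc a, d - Suc b))) = det M"
proof -
  define p where "p = (\<lambda>a. if a < d then d - Suc a else a)"
  have p: "p permutes {0..<d}"
  proof (rule bij_imp_permutes)
    show "bij_betw p {0..<d} {0..<d}"
      by (rule bij_betw_byWitness[where f' = p]) (auto simp: p_def)
  qed (auto simp: p_def)
  let ?N = "mat d d (\<lambda>(a, b). M $$ (p a, b))"
  have N: "det ?N = signof p * det M" by (rule det_permute_rows[OF assms p])
  have "det (mat d d (\<lambda>(a, b). transpose_mat ?N $$ (p a, b))) = signof p * det (transpose_mat ?N)"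
    by (rule det_permute_rows[OF _ p]) auto
  also have "\<dots> = signof p * signof p * det M" using N by (simp add: det_transpose[of _ d])
  also have "\<dots> = det M" by (simp add: sign_def)
  also have "mat d d (\<lambda>(a, b). transpose_mat ?N $$ (p a, b)) =
      transpose_mat (mat d d (\<lambda>(a, b). M $$ (d - Suc a, d - Suc b)))"
    by (rule eq_matI) (auto simp: p_def)
  also have "det \<dots> = det (mat d d (\<lambda>(a, b). M $$ (d - Suc a, d - Suc b)))"
    by (rule det_transpose[of _ d]) auto
  finally show ?thesis .
qed

lemma pick_reverse:
  assumes I: "I \<subseteq> {..<n}" and j: "j < card I"
  shows "pick ((\<lambda>a. n - Suc a) ` I) j = n - Suc (pick I (card I - Suc j))"
proof (rule pick_eqI)
  let ?x = "pick I (card I - Suc j)"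
  have lt: "card I - Suc j < card I" using j by simp
  have x: "?x \<in> I" by (rule pick_in_set_le[OF lt])
  show "n - Suc ?x \<in> (\<lambda>a. n - Suc a) ` I" using x by auto
  have fin: "finite I" using I finite_subset by blast
  have "{a \<in> (\<lambda>a. n - Suc a) ` I. a < n - Suc ?x} = (\<lambda>a. n - Suc a) ` {a \<in> I. ?x < a}"
    using I x by auto
  moreover have "inj_on (\<lambda>a. n - Suc a) {a \<in> I. ?x < a}"
    by (rule inj_on_subset[of _ "{..<n}"]) (use I in \<open>auto simp: inj_on_def\<close>)
  ultimately have "card {a \<in> (\<lambda>a. n - Suc a) ` I. a < n - Suc ?x} = card {a \<in> I. ?x < a}"
    by (simp add: card_image)
  also have "{a \<in> I. ?x < a} = I - insert ?x {a \<in> I. a < ?x}" by auto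
  also have "card \<dots> = card I - card (insert ?x {a \<in> I. a < ?x})"
    using x fin by (intro card_Diff_subset) auto
  also have "\<dots> = j" using fin j card_pick_le[OF lt] by simp
  finally show "card {a \<in> (\<lambda>a. n - Suc a) ` I. a < n - Suc ?x} = j" .
qed

lemma minor_reverse:
  assumes A: "A \<in> carrier_mat n n" and I: "I \<subseteq> {..<n}" and J: "J \<subseteq> {..<n}" and card: "card I = card J"
  shows "minor ((\<lambda>a. n - Suc a) ` I) ((\<lambda>a. n - Suc a) ` J) (mat n n (\<lambda>(r, c). A $$ (n - Suc r, n - Suc c)))
    = minor I J A" (is "minor ?I ?J ?A = _")
proof -
  have inj: "inj_on (\<lambda>a. n - Suc a) {..<n}" by (auto simp: inj_on_def)
  have cards: "card ?I = card J" "card ?J = card J"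
    using card card_image[OF inj_on_subset[OF inj I]] card_image[OF inj_on_subset[OF inj J]] by simp_all
  have sub: "?I \<subseteq> {..<n}" "?J \<subseteq> {..<n}" using I J by auto
  let ?M = "mat (card J) (card J) (\<lambda>(a, b). A $$ (pick I a, pick J b))"
  have "minor ?I ?J ?A = det (mat (card J) (card J) (\<lambda>(a, b). ?M $$ (card J - Suc a, card J - Suc b)))"
    unfolding minor_eq_det[OF _ sub, of ?A, simplified] cards
  proof (intro arg_cong[of _ _ det] eq_matI, goal_cases)
    case (1 a b)
    then have ab: "a < card J" "b < card J" by auto
    have "pick I (card J - Suc a) < n" "pick J (card J - Suc b) < n"
      using pick_in_subset[OF I] pick_in_subset[OF J] ab card by auto
    then show ?case using ab card pick_reverse[OF I, of a] pick_reverse[OF J, of b] by simp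
  qed auto
  also have "\<dots> = det ?M" by (rule det_reverse) auto
  also have "\<dots> = minor I J A" using card by (simp add: minor_eq_det[OF A I J])
  finally show ?thesis .
qed


section \<open>Products of the representatives of simple reflections\<close>

lemma mult_assoc_mat:
  "A \<in> carrier_mat n n \<Longrightarrow> B \<in> carrier_mat n n \<Longrightarrow> C \<in> carrier_mat n n \<Longrightarrow> A * B * C = A * (B * C)"
  by (rule assoc_mult_mat)

primrec mseq :: "nat \<Rightarrow> (nat \<Rightarrow> complex mat) \<Rightarrow> nat \<Rightarrow> complex mat" where
  "mseq n E 0 = 1\<^sub>m n"
| "mseq n E (Suc k) = mseq n E k * E k"

primrec pseq :: "(nat \<Rightarrow> nat) \<Rightarrow> nat set \<Rightarrow> nat \<Rightarrow> nat \<Rightarrow> nat" where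
  "pseq i K 0 = id"
| "pseq i K (Suc k) = (if k \<in> K then pseq i K k \<circ> simple_refl (i k) else pseq i K k)"

lemma mseq_carrier:
  "(\<And>k. k < m \<Longrightarrow> E k \<in> carrier_mat n n) \<Longrightarrow> k \<le> m \<Longrightarrow> mseq n E k \<in> carrier_mat n n"
  by (induction k) auto

lemma det_mseq:
  assumes "\<And>k. k < m \<Longrightarrow> E k \<in> carrier_mat n n" "\<And>k. k < m \<Longrightarrow> det (E k) = 1" "k \<le> m"
  shows "det (mseq n E k) = 1"
  using assms(3)
proof (induction k)
  case (Suc k)
  then show ?case
    using assms(1,2)[of k] mseq_carrier[of m E n k, OF assms(1)] by (simp add: det_mult[of _ n])
qed simp

text \<open>Closed form of a product of \<open>sdot\<close> along a reduced word: the sign in column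
  \<open>c\<close> counts the inversions of \<open>u\<close> with left position \<open>c\<close>. As
  it depends on \<open>u\<close> alone, \<open>dot\<close> can be computed along any reduced word,
  in particular along the used letters of the subexpression for \<open>v\<close>.\<close>

definition signed_perm_mat :: "nat \<Rightarrow> (nat \<Rightarrow> nat) \<Rightarrow> complex mat" where
  "signed_perm_mat n u = mat n n (\<lambda>(r, c). if r = u c
     then (\<Prod>k<n. if c < k \<and> u k < u c then - 1 else 1) else 0)"

text \<open>Letters outside \<open>K\<close> are skipped, so one locale covers both products:
  \<open>K = UNIV\<close> for \<open>w\<close>, and \<open>K = - J\<close> for the subexpression of
  \<open>v\<close>. The ascent condition expresses that the used letters form a reduced word. Read
  on the diagram, \<open>pseq i K k\<close> sends a height in column \<open>k\<close> to the left
  endpoint of the strand found there.\<close>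

locale ascending =
  fixes n m :: nat and i :: "nat \<Rightarrow> nat" and K :: "nat set"
  assumes bound: "k < m \<Longrightarrow> Suc (i k) < n"
    and asc: "k < m \<Longrightarrow> k \<in> K \<Longrightarrow> pseq i K k (i k) < pseq i K k (Suc (i k))"
begin

abbreviation "\<pi> \<equiv> pseq i K"
abbreviation "V \<equiv> mseq n (\<lambda>k. if k \<in> K then sdot n (i k) else 1\<^sub>m n)"

lemma pi_permutes: "k \<le> m \<Longrightarrow> \<pi> k permutes {..<n}"
proof (induction k)
  case (Suc k)
  then show ?case
    using permutes_compose[OF simple_refl_permutes[OF bound[of k]], of "\<pi> k"] by auto
qed (simp add: permutes_id)

lemma pi_less: "k \<le> m \<Longrightarrow> \<pi> k a < n \<longleftrightarrow> a < n"
  using permutes_in_image[OF pi_permutes, of k a] by simp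

lemma V_carrier [simp]: "k \<le> m \<Longrightarrow> V k \<in> carrier_mat n n"
  by (rule mseq_carrier) auto

lemma det_V: "k \<le> m \<Longrightarrow> det (V k) = 1"
  by (rule det_mseq) (auto simp: det_sdot bound)

lemma V_move_left:
  assumes "k \<le> m"
  shows "X \<in> ord_unip n (g \<circ> \<pi> k) \<Longrightarrow> \<exists>Y\<in>ord_unip n g. V k * X = Y * V k"
  using assms
proof (induction k arbitrary: X)
  case 0
  then have "V 0 * X = X * V 0" using ord_unip_carrier[OF 0(1)] by simp
  then show ?case using 0 by auto
next
  case (Suc k)
  note IH = Suc.IH[OF _ Suc_leD[OF Suc.prems(2)]]
  show ?case
  proof (cases "k \<in> K")
    case True
    have i: "Suc (i k) < n" using bound Suc.prems by auto
    have V: "V k \<in> carrier_mat n n" using Suc.prems by simp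
    obtain Y where Y: "Y \<in> ord_unip n (g \<circ> \<pi> k)" "sdot n (i k) * X = Y * sdot n (i k)"
      using sdot_move_left(1)[OF i, of X "g \<circ> \<pi> k"] Suc.prems True by (auto simp: comp_def)
    obtain Y' where Y': "Y' \<in> ord_unip n g" "V k * Y = Y' * V k" using IH[OF Y(1)] by auto
    have car: "X \<in> carrier_mat n n" "Y \<in> carrier_mat n n" "Y' \<in> carrier_mat n n"
      using Suc.prems(1) Y(1) Y'(1) by (simp_all add: ord_unip_carrier)
    have "V k * sdot n (i k) * X = V k * Y * sdot n (i k)"
      using V car Y(2) by (simp add: mult_assoc_mat[of _ n])
    also have "\<dots> = Y' * (V k * sdot n (i k))"
      unfolding Y'(2) using V car by (simp add: mult_assoc_mat[of _ n])
    finally show ?thesis using True Y'(1) by auto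
  next
    case False
    then show ?thesis using IH[of X] Suc.prems right_mult_one_mat[OF V_carrier[of k]]
      by (simp add: comp_def)
  qed
qed

lemma V_move_right:
  assumes "k \<le> m"
  shows "X \<in> ord_unip n g \<Longrightarrow> \<exists>Y\<in>ord_unip n (g \<circ> \<pi> k). X * V k = V k * Y"
    and "X \<in> ord_borel n g \<Longrightarrow> \<exists>Y\<in>ord_borel n (g \<circ> \<pi> k). X * V k = V k * Y"
proof -
  have *: "\<exists>Y\<in>F n (g \<circ> \<pi> k). X * V k = V k * Y"
    if F: "\<And>X g j. Suc j < n \<Longrightarrow> X \<in> F n g \<Longrightarrow> \<exists>Y\<in>F n (g \<circ> simple_refl j). X * sdot n j = sdot n j * Y"
      and car: "\<And>X g. X \<in> F n g \<Longrightarrow> X \<in> carrier_mat n n" and X: "X \<in> F n g" for F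
    using assms
  proof (induction k)
    case 0
    have "X * V 0 = V 0 * X" using car[OF X] by simp
    then show ?case using X by auto
  next
    case (Suc k)
    then obtain Y where Y: "Y \<in> F n (g \<circ> \<pi> k)" "X * V k = V k * Y"
      using Suc_leD by blast
    have V: "V k \<in> carrier_mat n n" using Suc.prems by simp
    show ?case
    proof (cases "k \<in> K")
      case True
      obtain Y' where Y': "Y' \<in> F n (g \<circ> \<pi> k \<circ> simple_refl (i k))" "Y * sdot n (i k) = sdot n (i k) * Y'"
        using F[OF bound[of k] Y(1)] Suc.prems by auto
      have "X * (V k * sdot n (i k)) = V k * (Y * sdot n (i k))"
        using V car[OF X] car[OF Y(1)] by (simp add: mult_assoc_mat[of _ n, symmetric] Y(2))
      also have "\<dots> = V k * sdot n (i k) * Y'"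
        using V car[OF Y'(1)] by (simp add: mult_assoc_mat[of _ n] Y'(2))
      finally show ?thesis using True Y'(1) by (auto simp: comp_def)
    next
      case False
      then show ?thesis using Y V by (auto simp: comp_def)
    qed
  qed
  show "X \<in> ord_unip n g \<Longrightarrow> \<exists>Y\<in>ord_unip n (g \<circ> \<pi> k). X * V k = V k * Y"
    by (rule *[where F = ord_unip]) (auto simp: sdot_move_right ord_unip_carrier)
  show "X \<in> ord_borel n g \<Longrightarrow> \<exists>Y\<in>ord_borel n (g \<circ> \<pi> k). X * V k = V k * Y"
    by (rule *[where F = ord_borel]) (auto simp: sdot_move_right ord_borel_carrier)
qed

lemma V_orth: "k \<le> m \<Longrightarrow> V k * transpose_mat (V k) = 1\<^sub>m n"
proof (induction k)
  case (Suc k)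
  have V: "V k \<in> carrier_mat n n" using Suc.prems by simp
  have i: "Suc (i k) < n" using bound Suc.prems by auto
  have "V k * sdot n (i k) * transpose_mat (V k * sdot n (i k)) =
      V k * (sdot n (i k) * transpose_mat (sdot n (i k))) * transpose_mat (V k)"
    using V by (simp add: transpose_mult[of _ n n _ n] mult_assoc_mat[of _ n])
  then show ?case using Suc i right_mult_one_mat[OF V] by (simp add: sdot_orth)
qed simp

lemma V_orth': "k \<le> m \<Longrightarrow> transpose_mat (V k) * V k = 1\<^sub>m n"
  by (rule mat_mult_left_right_inverse[of _ n]) (simp_all add: V_orth)

text \<open>Only an exchange of neighbouring heights can restore the order of an inverted pair, and
  by \<open>asc\<close> the pair exchanged at a used letter is not inverted beforehand.\<close>

lemma inversion_step:
  assumes "k < m" "x < y" "\<pi> k y < \<pi> k x"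
    and "x' = (if k \<in> K then simple_refl (i k) x else x)" "y' = (if k \<in> K then simple_refl (i k) y else y)"
  shows "x' < y'"
proof (cases "k \<in> K")
  case True
  have "\<not> (x = i k \<and> y = Suc (i k))" using asc[OF assms(1) True] assms(3) by auto
  then show ?thesis
    using assms(2,4,5) True by (auto simp: simple_refl_def Transposition.transpose_def)
qed (use assms in simp)

lemma pi_inj: "k \<le> m \<Longrightarrow> \<pi> k a = \<pi> k b \<longleftrightarrow> a = b"
  using permutes_inj[OF pi_permutes] by (auto dest: injD)

text \<open>Two strands that have crossed never cross again.\<close>

lemma inversion_mono:
  assumes "j \<le> k" "k \<le> m" "\<pi> j x = \<pi> k x'" "\<pi> j y = \<pi> k y'" "x < y" "\<pi> j y < \<pi> j x"
  shows "x' < y'"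
  using assms(1,2,3,4)
proof (induction k arbitrary: x' y' rule: dec_induct)
  case base
  then show ?case using assms(5) by (simp add: pi_inj)
next
  case (step k)
  define x0 where "x0 = (if k \<in> K then simple_refl (i k) x' else x')"
  define y0 where "y0 = (if k \<in> K then simple_refl (i k) y' else y')"
  have 0: "\<pi> j x = \<pi> k x0" "\<pi> j y = \<pi> k y0" using step.prems by (auto simp: x0_def y0_def)
  have "x0 < y0" using step.IH[OF _ 0] step.prems(1) by simp
  moreover have "\<pi> k y0 < \<pi> k x0" using assms(6) unfolding 0 .
  moreover have "k < m" using step.prems by simp
  moreover have "x' = (if k \<in> K then simple_refl (i k) x0 else x0)"
    "y' = (if k \<in> K then simple_refl (i k) y0 else y0)" by (simp_all add: x0_def y0_def)
  ultimately show ?case using inversion_step by blast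
qed

text \<open>\<open>T\<close> is a set of strand labels, and the column set consists of the heights
  that these strands occupy, so it travels with them through the diagram. \<open>cond\<close>
  excludes the crossings where the strand from above belongs to \<open>T\<close> and the one from
  below does not, which is the case with a sign in \<open>minor_mult_sdot\<close>.\<close>

lemma minor_mult_V:
  assumes B: "B \<in> carrier_mat n n" and R: "R \<subseteq> {..<n}" and T: "T \<subseteq> {..<n}" "card R = card T"
    and jk: "j \<le> k" "k \<le> m"
    and cond: "\<And>l. j \<le> l \<Longrightarrow> l < k \<Longrightarrow> l \<in> K \<Longrightarrow> \<pi> l (Suc (i l)) \<in> T \<Longrightarrow> \<pi> l (i l) \<in> T"
  shows "minor R {c. c < n \<and> \<pi> k c \<in> T} (B * V k) = minor R {c. c < n \<and> \<pi> j c \<in> T} (B * V j)"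
  using jk cond
proof (induction k rule: dec_induct)
  case (step k)
  show ?case
  proof (cases "k \<in> K")
    case True
    let ?C = "{c. c < n \<and> \<pi> (Suc k) c \<in> T}"
    have i: "Suc (i k) < n" using step bound by auto
    have V: "V k \<in> carrier_mat n n" using step by simp
    have eq: "\<pi> (Suc k) ` ?C = T"
    proof (intro subset_antisym subsetI)
      fix a assume a: "a \<in> T"
      then have "a \<in> \<pi> (Suc k) ` {..<n}"
        using permutes_image[OF pi_permutes[of "Suc k"]] step.prems(1) T by auto
      then show "a \<in> \<pi> (Suc k) ` ?C" using a by blast
    qed blast
    have "inj_on (\<pi> (Suc k)) ?C"
      using permutes_inj[OF pi_permutes[of "Suc k"]] step.prems(1) by (auto intro: inj_on_subset)
    then have "card ?C = card T" using card_image eq by metis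
    then have card: "card R = card ?C" using T by simp
    have imp: "Suc (i k) \<in> ?C" if "i k \<in> ?C"
      using that True i step.prems(2)[of k] step.hyps by simp
    have "minor R ?C (B * V k * sdot n (i k)) = minor R (simple_refl (i k) ` ?C) (B * V k)"
      by (rule minor_mult_sdot[OF square_mult_carrier[OF B V] R _ i card imp]) auto
    also have "simple_refl (i k) ` ?C = {c. c < n \<and> \<pi> k c \<in> T}"
    proof (intro subset_antisym subsetI)
      fix c assume "c \<in> {c. c < n \<and> \<pi> k c \<in> T}"
      then show "c \<in> simple_refl (i k) ` ?C"
        using True i by (intro image_eqI[of _ _ "simple_refl (i k) c"]) (auto simp: simple_refl_less)
    qed (use True i in \<open>auto simp: simple_refl_less\<close>)
    also have "B * V k * sdot n (i k) = B * V (Suc k)"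
      using B V True by (simp add: mult_assoc_mat[of _ n])
    also have "minor R {c. c < n \<and> \<pi> k c \<in> T} (B * V k) = minor R {c. c < n \<and> \<pi> j c \<in> T} (B * V j)"
      using step by simp
    finally show ?thesis .
  next
    case False
    then show ?thesis using step right_mult_one_mat[OF V_carrier[of k]] by simp
  qed
qed simp

lemma V_eq_signed_perm_mat: "k \<le> m \<Longrightarrow> V k = signed_perm_mat n (\<pi> k)"
proof (induction k)
  case 0
  have "(\<Prod>k<n. if c < k \<and> k < c then - 1 else (1::complex)) = 1" for c
    by (intro prod.neutral) auto
  then show ?case by (intro eq_matI) (auto simp: signed_perm_mat_def)
next
  case (Suc k)
  show ?case
  proof (cases "k \<in> K")
    case False
    then show ?thesis using Suc by (simp add: signed_perm_mat_def)
  next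
    case True
    let ?s = "simple_refl (i k)" and ?u = "\<pi> k"
    define sg where "sg = (\<lambda>(u :: nat \<Rightarrow> nat) c. \<Prod>k<n. if c < k \<and> u k < u c then - 1 else (1::complex))"
    have i: "Suc (i k) < n" using Suc.prems bound by auto
    have up: "?u (i k) < ?u (Suc (i k))" using asc Suc.prems True by auto
    have V: "V k = signed_perm_mat n ?u" using Suc by simp
    have reindex: "sg (?u \<circ> ?s) c = (\<Prod>l<n. if c < ?s l \<and> ?u l < ?u (?s c) then - 1 else 1)" for c
      unfolding sg_def
      by (subst prod.permute[OF simple_refl_permutes[OF i]]) (simp add: o_def)
    have sg1: "sg (?u \<circ> ?s) c = sg ?u (?s c)" if "c \<noteq> i k" for c
      unfolding reindex unfolding sg_def
    proof (intro prod.cong refl if_cong)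
      fix l
      show "(c < ?s l \<and> ?u l < ?u (?s c)) = (?s c < l \<and> ?u l < ?u (?s c))"
        using that up by (auto simp: simple_refl_def Transposition.transpose_def)
    qed
    \<comment> \<open>Position \<open>i k\<close> gains exactly one inversion, with
      \<open>Suc (i k)\<close>. This is the sign with which \<open>sdot\<close> moves column
      \<open>Suc (i k)\<close> to column \<open>i k\<close>.\<close>
    have sg2: "sg (?u \<circ> ?s) (i k) = - sg ?u (Suc (i k))"
    proof -
      have "sg (?u \<circ> ?s) (i k) = (\<Prod>l<n. (if l = i k then - 1 else 1) *
          (if Suc (i k) < l \<and> ?u l < ?u (Suc (i k)) then - 1 else 1))"
        unfolding reindex
      proof (intro prod.cong refl)
        fix l
        show "(if i k < ?s l \<and> ?u l < ?u (?s (i k)) then - 1 else 1) =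
          (if l = i k then - 1 else 1) * (if Suc (i k) < l \<and> ?u l < ?u (Suc (i k)) then - 1 else (1::complex))"
          using up by (auto simp: simple_refl_def Transposition.transpose_def)
      qed
      also have "\<dots> = - sg ?u (Suc (i k))"
        using i by (simp add: prod.distrib sg_def)
      finally show ?thesis .
    qed
    have S: "signed_perm_mat n u = mat n n (\<lambda>(r, c). if r = u c then sg u c else 0)" for u
      unfolding signed_perm_mat_def sg_def ..
    have "(signed_perm_mat n ?u * sdot n (i k)) $$ (r, c) = signed_perm_mat n (?u \<circ> ?s) $$ (r, c)"
      if rc: "r < n" "c < n" for r c
    proof -
      have "(signed_perm_mat n ?u * sdot n (i k)) $$ (r, c) =
        (if c = i k then - signed_perm_mat n ?u $$ (r, Suc (i k))
         else if c = Suc (i k) then signed_perm_mat n ?u $$ (r, i k) else signed_perm_mat n ?u $$ (r, c))"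
        by (rule mult_sdot_nth[OF _ i rc]) (simp add: S)
      also have "\<dots> = signed_perm_mat n (?u \<circ> ?s) $$ (r, c)"
        using rc i sg1[of c] sg2 by (auto simp: S)
      finally show ?thesis .
    qed
    then have "signed_perm_mat n ?u * sdot n (i k) = signed_perm_mat n (?u \<circ> ?s)"
      by (intro eq_matI) (auto simp: S)
    then show ?thesis using True V by (simp add: comp_def)
  qed
qed

end


section \<open>Flags along a reduced word\<close>

lemma transpose_x_mult_nth:
  assumes "A \<in> carrier_mat n p" "Suc i < n" "r < n" "c < p"
  shows "(transpose_mat (x_mat n i t) * A) $$ (r, c) = A $$ (r, c) + (if r = Suc i then t * A $$ (i, c) else 0)"
proof -
  have "transpose_mat (x_mat n i t) * A = transpose_mat (transpose_mat A * x_mat n i t)"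
    using assms by (subst transpose_mult[of _ p n _ n]) auto
  then show ?thesis using assms by (simp add: mult_x_mat_nth[where p = p])
qed

lemma mult_transpose_x_nth:
  assumes "A \<in> carrier_mat p n" "Suc i < n" "r < p" "c < n"
  shows "(A * transpose_mat (x_mat n i t)) $$ (r, c) = A $$ (r, c) + (if c = i then t * A $$ (r, Suc i) else 0)"
proof -
  have "A * transpose_mat (x_mat n i t) = transpose_mat (x_mat n i t * transpose_mat A)"
    using assms by (subst transpose_mult[of _ n n _ p]) auto
  then show ?thesis using assms by (simp add: x_mat_mult_nth[where p = p])
qed

lemma mult_transpose_sdot_nth:
  assumes "A \<in> carrier_mat p n" "Suc i < n" "r < p" "c < n"
  shows "(A * transpose_mat (sdot n i)) $$ (r, c) =
    (if c = i then A $$ (r, Suc i) else if c = Suc i then - A $$ (r, i) else A $$ (r, c))"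
proof -
  have "A * transpose_mat (sdot n i) = transpose_mat (sdot n i * transpose_mat A)"
    using assms by (subst transpose_mult[of _ n n _ p]) auto
  then show ?thesis using assms by (simp add: sdot_mult_nth[where p = p])
qed

lemma transpose_x_borel:
  assumes "Suc i < n"
  shows "transpose_mat (x_mat n i t) \<in> ord_borel n lower"
  using transpose_ord_borel[OF ord_unip_borel[OF _ x_mat_ord_unip[of i n int t]]] assms by simp

lemma transpose_x_inverse:
  assumes "Suc i < n"
  shows "transpose_mat (x_mat n i (- t)) * transpose_mat (x_mat n i t) = 1\<^sub>m n"
  using assms by (intro eq_matI) (auto simp: transpose_x_mult_nth[where p = n] x_mat_nth)

lemma sdot_mult_transpose_x:
  assumes "Suc i < n"
  shows "sdot n i * transpose_mat (x_mat n i t) = x_mat n i (- t) * sdot n i"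
proof (rule eq_matI)
  fix r c assume "r < dim_row (x_mat n i (- t) * sdot n i)" "c < dim_col (x_mat n i (- t) * sdot n i)"
  then have rc: "r < n" "c < n" by auto
  have i: "i < n" using assms by simp
  show "(sdot n i * transpose_mat (x_mat n i t)) $$ (r, c) = (x_mat n i (- t) * sdot n i) $$ (r, c)"
    using rc assms i by (simp add: sdot_mult_nth[where p = n] x_mat_mult_nth[where p = n] sdot_nth x_mat_nth)
qed auto

text \<open>This is \<open>s B_- \<subseteq> B_- x_i(C) s\<close>. Only the entry at
  \<open>(Suc i, i)\<close> prevents a lower triangular factor from crossing \<open>s\<close> inside
  \<open>B_-\<close>, and that part reappears as a factor \<open>x_i(p)\<close>.\<close>

lemma sdot_peel:
  assumes i: "Suc i < n" and b: "b \<in> ord_borel n lower"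
  shows "\<exists>\<beta>\<in>ord_borel n lower. \<exists>p. sdot n i * b = \<beta> * x_mat n i p * sdot n i"
proof -
  \<comment> \<open>Chosen so that right multiplication by \<open>?y (- p)\<close> clears the entry
    at \<open>(Suc i, i)\<close>. The parameter in the conclusion is the negative of this
    \<open>p\<close>.\<close>
  define p where "p = b $$ (Suc i, i) / b $$ (Suc i, Suc i)"
  let ?y = "\<lambda>p. transpose_mat (x_mat n i p)"
  have bc: "b \<in> carrier_mat n n" using b by (rule ord_borel_carrier)
  have nz: "b $$ (Suc i, Suc i) \<noteq> 0" by (rule ord_borel_diag_nonzero[OF inj_lower b i])
  define b' where "b' = b * ?y (- p)"
  have b': "b' \<in> ord_borel n lower"
    unfolding b'_def using b transpose_x_borel[OF i] by (rule ord_borel_mult)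
  have b'c: "b' \<in> carrier_mat n n" using b' by (rule ord_borel_carrier)
  have z: "b' $$ (Suc i, i) = 0"
    using nz i bc by (simp add: b'_def mult_transpose_x_nth[where p = n] p_def)
  have y: "?y q \<in> carrier_mat n n" for q by simp
  have b_eq: "b = b' * ?y p"
    unfolding b'_def mult_assoc_mat[OF bc y y] transpose_x_inverse[OF i] using bc by simp
  obtain \<beta> where \<beta>: "\<beta> \<in> ord_borel n lower" "sdot n i * b' = \<beta> * sdot n i"
    using sdot_lower_move(1)[OF i b' z] by auto
  have "sdot n i * b = sdot n i * b' * ?y p"
    unfolding b_eq using b'c by (simp add: mult_assoc_mat[of _ n])
  also have "\<dots> = \<beta> * (sdot n i * ?y p)"
    unfolding \<beta>(2) using ord_borel_carrier[OF \<beta>(1)] by (simp add: mult_assoc_mat[of _ n])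
  also have "\<dots> = \<beta> * x_mat n i (- p) * sdot n i"
    unfolding sdot_mult_transpose_x[OF i]
    using ord_borel_carrier[OF \<beta>(1)] by (simp add: mult_assoc_mat[of _ n])
  finally show ?thesis using \<beta>(1) by blast
qed

text \<open>The \<open>2 \<times> 2\<close> identity
  \<open>x(t) = x(1/t)\<^sup>T s (1/t, 0; 1, t)\<close> moves an \<open>x\<^sub>i(t)\<close> into the cell of \<open>s\<^sub>i\<close>.\<close>

lemma x_mat_in_sdot_cell:
  assumes i: "Suc i < n" and t: "t \<noteq> 0"
  shows "\<exists>c\<in>ord_borel n lower. x_mat n i t = transpose_mat (x_mat n i (inverse t)) * (sdot n i * c)"
proof -
  define c where "c = mat n n (\<lambda>(a, b). if a = b then if a = i then inverse t else if a = Suc i then t else 1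
      else if a = Suc i \<and> b = i then 1 else 0)"
  have cc: "c \<in> carrier_mat n n" by (simp add: c_def)
  have in': "i < n" using i by simp
  have eq: "x_mat n i t = transpose_mat (x_mat n i (inverse t)) * (sdot n i * c)"
  proof (rule eq_matI)
    fix a b assume "a < dim_row (transpose_mat (x_mat n i (inverse t)) * (sdot n i * c))"
      "b < dim_col (transpose_mat (x_mat n i (inverse t)) * (sdot n i * c))"
    then have ab: "a < n" "b < n" using cc by auto
    have 1: "(sdot n i * c) $$ (r, b) = (if r = i then c $$ (Suc i, b) else if r = Suc i then - c $$ (i, b) else c $$ (r, b))"
      if "r < n" for r using that ab i cc by (simp add: sdot_mult_nth[where p = n])
    have 2: "(transpose_mat (x_mat n i (inverse t)) * (sdot n i * c)) $$ (a, b) =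
       (sdot n i * c) $$ (a, b) + (if a = Suc i then inverse t * (sdot n i * c) $$ (i, b) else 0)"
      using cc ab i by (intro transpose_x_mult_nth[where p = n]) auto
    show "x_mat n i t $$ (a, b) = (transpose_mat (x_mat n i (inverse t)) * (sdot n i * c)) $$ (a, b)"
      unfolding 2 using ab i in' t
      by (simp add: 1) (auto simp: c_def x_mat_nth)
  qed (use cc in auto)
  have tri: "c \<in> ord_tri n lower" by (auto simp: ord_tri_def c_def)
  have "det (x_mat n i t) = det c"
    unfolding eq using i cc by (simp add: det_mult[of _ n] det_sdot det_transpose[of _ n] det_x_mat)
  then have "c \<in> ord_borel n lower" using tri i by (simp add: ord_borel_def det_x_mat)
  then show ?thesis using eq by blast
qed

lemma x_mat_peel:
  assumes i: "Suc i < n" and t: "t \<noteq> 0" and b: "b \<in> ord_borel n lower"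
  shows "\<exists>\<beta>\<in>ord_borel n lower. \<exists>p. x_mat n i t * b = \<beta> * x_mat n i p * sdot n i"
proof -
  let ?y = "transpose_mat (x_mat n i (inverse t))"
  obtain c where c: "c \<in> ord_borel n lower" "x_mat n i t = ?y * (sdot n i * c)"
    using x_mat_in_sdot_cell[OF i t] by blast
  obtain \<beta> p where \<beta>: "\<beta> \<in> ord_borel n lower" "sdot n i * (c * b) = \<beta> * x_mat n i p * sdot n i"
    using sdot_peel[OF i ord_borel_mult[OF c(1) b]] by blast
  have car: "c \<in> carrier_mat n n" "b \<in> carrier_mat n n" "\<beta> \<in> carrier_mat n n" "?y \<in> carrier_mat n n"
    using c b \<beta> by (simp_all add: ord_borel_carrier)
  have "x_mat n i t * b = ?y * (sdot n i * (c * b))"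
    unfolding c(2) using car by (simp add: mult_assoc_mat[of _ n])
  also have "\<dots> = ?y * \<beta> * x_mat n i p * sdot n i"
    unfolding \<beta>(2) using car by (simp add: mult_assoc_mat[of _ n])
  finally show ?thesis using ord_borel_mult[OF transpose_x_borel[OF i] \<beta>(1)] by blast
qed

text \<open>A diagonal matrix is triangular for every order, hence the quantifier over
  \<open>g\<close>: in the base case of \<open>cell_factorization\<close> the same \<open>d\<close>
  serves as the upper factor \<open>U\<close> and as the lower factor \<open>b'\<close>.\<close>

lemma ord_borel_split_diag:
  assumes "inj_on f {..<n}" "b \<in> ord_borel n f"
  shows "\<exists>z d. z \<in> ord_unip n f \<and> b = z * d \<and> (\<forall>g. d \<in> ord_borel n g)"
proof -
  have bc: "b \<in> carrier_mat n n" using assms(2) by (rule ord_borel_carrier)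
  define d where "d = mat n n (\<lambda>(r, c). if r = c then b $$ (r, r) else 0)"
  define z where "z = mat n n (\<lambda>(r, c). b $$ (r, c) / b $$ (c, c))"
  have nz: "b $$ (a, a) \<noteq> 0" if "a < n" for a by (rule ord_borel_diag_nonzero[OF assms that])
  have z: "z \<in> ord_unip n f"
    using assms nz by (auto simp: ord_unip_def ord_borel_def ord_tri_def z_def)
  have dt: "d \<in> ord_tri n g" for g by (auto simp: ord_tri_def d_def)
  have "b $$ (r, c) = (z * d) $$ (r, c)" if "r < n" "c < n" for r c
  proof -
    have "(z * d) $$ (r, c) = (\<Sum>k<n. z $$ (r, k) * d $$ (k, c))"
      using that by (intro mult_mat_nth) (auto simp: z_def d_def)
    also have "\<dots> = z $$ (r, c) * d $$ (c, c)"
      using that by (intro sum_one_support) (auto simp: d_def)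
    also have "\<dots> = b $$ (r, c)" using nz that by (simp add: z_def d_def)
    finally show ?thesis ..
  qed
  then have eq: "b = z * d" using bc by (intro eq_matI) (auto simp: z_def d_def)
  have zc: "z \<in> carrier_mat n n" "d \<in> carrier_mat n n" by (auto simp: z_def d_def)
  have "det z = 1" using ord_unip_borel[OF assms(1) z] by (simp add: ord_borel_def)
  then have "det d = 1" using assms(2) unfolding eq by (simp add: ord_borel_def det_mult[OF zc])
  then have "d \<in> ord_borel n g" for g using dt by (simp add: ord_borel_def)
  then show ?thesis using z eq by blast
qed

section \<open>The partial products of \<open>g\<close> and their Bruhat cells\<close>

locale mr_word = ascending n m i UNIV for n m i +
  fixes J :: "nat set" and t :: "nat \<Rightarrow> complex"
  assumes t_nonzero: "k < m \<Longrightarrow> k \<in> J \<Longrightarrow> t k \<noteq> 0"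
begin

definition E :: "nat \<Rightarrow> complex mat" where
  "E k = (if k \<in> J then x_mat n (i k) (t k) else sdot n (i k))"

abbreviation "G \<equiv> mseq n E"

text \<open>The vacuous membership test makes \<open>W\<close> literally the product
  \<open>V\<close> of the locale \<open>ascending\<close> for \<open>K = UNIV\<close>.\<close>

abbreviation "W \<equiv> mseq n (\<lambda>k. if k \<in> UNIV then sdot n (i k) else 1\<^sub>m n)"

lemma E_carrier [simp]: "E k \<in> carrier_mat n n" by (simp add: E_def)

lemma det_E: "k < m \<Longrightarrow> det (E k) = 1"
  by (simp add: E_def det_sdot det_x_mat bound)

lemma G_carrier [simp]: "k \<le> m \<Longrightarrow> G k \<in> carrier_mat n n"
  by (rule mseq_carrier) auto

lemma det_G: "k \<le> m \<Longrightarrow> det (G k) = 1"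
  by (rule det_mseq) (auto simp: det_E)

lemma E_peel:
  assumes "k < m" "b \<in> ord_borel n lower"
  shows "\<exists>\<beta>\<in>ord_borel n lower. \<exists>p. E k * b = \<beta> * x_mat n (i k) p * sdot n (i k)"
  using sdot_peel[OF bound[OF assms(1)] assms(2)]
    x_mat_peel[OF bound[OF assms(1)] t_nonzero[OF assms(1)] assms(2)] by (simp add: E_def)

text \<open>
  \<open>G k\<close> lies in the Bruhat cell \<open>B\<^sub>- w B\<^sub>-\<close>; here the elements of the coset \<open>G k B\<^sub>-\<close> are factored
  so that the middle factor lies in \<open>B \<inter> w B\<^sub>- w\<inverse>\<close>.
\<close>

lemma cell_factorization:
  assumes "k \<le> m" "b \<in> ord_borel n lower"
  shows "\<exists>Z U b'. Z \<in> ord_unip n lower \<and> U \<in> ord_borel n int \<and> b' \<in> ord_borel n lower \<and>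
    G k * b = Z * U * W k \<and> U * W k = W k * b'"
  using assms
proof (induction k arbitrary: b)
  case 0
  obtain z d where zd: "z \<in> ord_unip n lower" "b = z * d" "\<forall>g. d \<in> ord_borel n g"
    using ord_borel_split_diag[OF inj_lower 0(2)] by blast
  have "z \<in> carrier_mat n n" "d \<in> carrier_mat n n"
    using zd ord_borel_carrier ord_unip_carrier by blast+
  then have "G 0 * b = z * d * W 0" "d * W 0 = W 0 * d" using zd(2) by simp_all
  then show ?case using zd by blast
next
  case (Suc k)
  have i: "Suc (i k) < n" and k: "k < m" "k \<le> m" using Suc.prems bound by auto
  have Gc: "G k \<in> carrier_mat n n" and Wc: "W k \<in> carrier_mat n n"
    by (rule G_carrier[OF k(2)], rule V_carrier[OF k(2)])
  obtain \<beta> p where \<beta>: "\<beta> \<in> ord_borel n lower" "E k * b = \<beta> * x_mat n (i k) p * sdot n (i k)"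
    using E_peel[OF k(1) Suc.prems(2)] by blast
  obtain Z U b1 where IH: "Z \<in> ord_unip n lower" "U \<in> ord_borel n int" "b1 \<in> ord_borel n lower"
    "G k * \<beta> = Z * U * W k" "U * W k = W k * b1"
    using Suc.IH[OF k(2) \<beta>(1)] by blast
  let ?x = "x_mat n (i k) p" and ?s = "sdot n (i k)"
  have up: "\<pi> k (i k) < \<pi> k (Suc (i k))" using asc[OF k(1)] by simp
  \<comment> \<open>The letter is an ascent of \<open>\<pi> k\<close>, so conjugation by
    \<open>W k\<close> sends this root subgroup to another one inside \<open>N\<close>.\<close>
  have "?x \<in> ord_unip n (int \<circ> \<pi> k)" using up i by (intro x_mat_ord_unip) auto
  then obtain X where X: "X \<in> ord_unip n int" "W k * ?x = X * W k"
    using V_move_left[OF k(2)] by blast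
  have car: "b \<in> carrier_mat n n" "\<beta> \<in> carrier_mat n n" "Z \<in> carrier_mat n n" "U \<in> carrier_mat n n"
    "b1 \<in> carrier_mat n n" "X \<in> carrier_mat n n" "?x \<in> carrier_mat n n" "?s \<in> carrier_mat n n"
    using Suc.prems(2) \<beta>(1) IH(1-3) X(1) by (simp_all add: ord_borel_carrier ord_unip_carrier)
  have "G (Suc k) * b = G k * (E k * b)" using Gc car by (simp add: mult_assoc_mat[of _ n])
  also have "\<dots> = G k * \<beta> * ?x * ?s" unfolding \<beta>(2) using Gc car by (simp add: mult_assoc_mat[of _ n])
  also have "\<dots> = Z * U * (W k * ?x) * ?s" unfolding IH(4) using Wc car by (simp add: mult_assoc_mat[of _ n])
  also have "\<dots> = Z * (U * X) * W (Suc k)"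
    unfolding X(2) using Wc car by (simp add: mult_assoc_mat[of _ n])
  finally have eq: "G (Suc k) * b = Z * (U * X) * W (Suc k)" .
  \<comment> \<open>\<open>b1\<close> is the conjugate of the upper triangular \<open>U\<close> by
    \<open>W k\<close>, so it is triangular for the order \<open>\<pi> k\<close> as well. The ascent
    at \<open>k\<close> then forces this entry to vanish, which lets \<open>b1\<close> cross the
    next \<open>sdot\<close>.\<close>
  have b1z: "b1 $$ (Suc (i k), i k) = 0"
  proof -
    obtain Y where Y: "Y \<in> ord_borel n (int \<circ> \<pi> k)" "U * W k = W k * Y"
      using V_move_right(2)[OF k(2) IH(2)] by blast
    have "b1 = Y"
      by (rule mult_left_cancel_mat[OF Wc _ car(5) ord_borel_carrier[OF Y(1)]])
        (use det_V[OF k(2)] IH(5) Y(2) in auto)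
    then show ?thesis using Y(1) up i by (auto simp: ord_borel_def intro: ord_triD)
  qed
  obtain b2 where b2: "b2 \<in> ord_borel n lower" "b1 * ?s = ?s * b2"
    using sdot_lower_move(2)[OF i IH(3) b1z] by blast
  let ?y = "transpose_mat (x_mat n (i k) (- p))"
  have car2: "b2 \<in> carrier_mat n n" "?y \<in> carrier_mat n n" using b2(1) by (simp_all add: ord_borel_carrier)
  have xs: "?x * ?s = ?s * ?y" using sdot_mult_transpose_x[OF i, of "- p"] by simp
  have "U * X * W (Suc k) = U * (X * W k) * ?s"
    using Wc car by (simp add: mult_assoc_mat[of _ n])
  also have "\<dots> = U * W k * (?x * ?s)"
    unfolding X(2)[symmetric] using Wc car by (simp add: mult_assoc_mat[of _ n])
  also have "\<dots> = W k * (b1 * ?s) * ?y"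
    unfolding xs IH(5) using Wc car car2 by (simp add: mult_assoc_mat[of _ n])
  also have "\<dots> = W (Suc k) * (b2 * ?y)"
    unfolding b2(2) using Wc car car2 by (simp add: mult_assoc_mat[of _ n])
  finally have eq2: "U * X * W (Suc k) = W (Suc k) * (b2 * ?y)" .
  have "U * X \<in> ord_borel n int"
    using IH(2) ord_unip_borel[OF _ X(1)] by (auto intro: ord_borel_mult)
  moreover have "b2 * ?y \<in> ord_borel n lower"
    using b2(1) transpose_x_borel[OF i] by (rule ord_borel_mult)
  ultimately show ?case using IH(1) eq eq2 by blast
qed

text \<open>Removing the last \<open>sdot\<close> gives \<open>Z W_k = G_k c\<close>, where
  \<open>c\<close> is lower triangular except possibly at \<open>(i, Suc i)\<close>. To exclude that
  entry, \<open>G_k\<close> is replaced by its cell factorization \<open>Z' W_k b1\<close>: then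
  \<open>b1 * c\<close> is the conjugate by \<open>W_k\<close> of an element of \<open>N_-\<close>,
  and the ascent at \<open>k\<close> forbids an entry at \<open>(i, Suc i)\<close>.\<close>

lemma coset_step_back:
  assumes k: "k < m" and Z: "Z \<in> ord_unip n lower" and b: "b \<in> ord_borel n lower"
    and eq: "Z * W (Suc k) = G (Suc k) * b"
  shows "\<exists>b'\<in>ord_borel n lower. Z * W k = G k * b'"
proof -
  let ?s = "sdot n (i k)" and ?t = "transpose_mat (sdot n (i k))"
  let ?i = "i k"
  have i: "Suc ?i < n" "?i < n" and kk: "k \<le> m" using k bound[OF k] by auto
  have Gc: "G k \<in> carrier_mat n n" and Wc: "W k \<in> carrier_mat n n"
    by (rule G_carrier[OF kk], rule V_carrier[OF kk])
  have car: "Z \<in> carrier_mat n n" "b \<in> carrier_mat n n" "?s \<in> carrier_mat n n" "?t \<in> carrier_mat n n"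
    "E k \<in> carrier_mat n n"
    using Z b by (simp_all add: ord_borel_carrier ord_unip_carrier)
  define c where "c = E k * b * ?t"
  have cc: "c \<in> carrier_mat n n" unfolding c_def using car by simp
  have "G k * c = Z * W (Suc k) * ?t"
    unfolding eq c_def using Gc car by (simp add: mult_assoc_mat[of _ n])
  also have "\<dots> = Z * W k * (?s * ?t)" using Wc car by (simp add: mult_assoc_mat[of _ n])
  also have "\<dots> = Z * W k" unfolding sdot_orth(1)[OF i(1)] using Wc car by simp
  finally have ZG: "Z * W k = G k * c" ..
  have Eb: "(E k * b) $$ (r, a) = (if k \<in> J then b $$ (r, a) + (if r = ?i then t k * b $$ (Suc ?i, a) else 0)
      else if r = ?i then b $$ (Suc ?i, a) else if r = Suc ?i then - b $$ (?i, a) else b $$ (r, a))"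
    if "r < n" "a < n" for r a
    using that i car by (simp add: E_def sdot_mult_nth[where p = n] x_mat_mult_nth[where p = n])
  have bz: "b $$ (r, a) = 0" if "r < a" "r < n" "a < n" for r a
    using b that by (auto simp: ord_borel_def intro: ord_triD)
  have cz: "c $$ (r, a) = 0" if "r < a" "r < n" "a < n" "\<not> (r = ?i \<and> a = Suc ?i)" for r a
  proof -
    have "c $$ (r, a) = (if a = ?i then (E k * b) $$ (r, Suc ?i) else if a = Suc ?i then - (E k * b) $$ (r, ?i)
        else (E k * b) $$ (r, a))"
      unfolding c_def using that i car by (intro mult_transpose_sdot_nth[where p = n]) auto
    then show ?thesis using that i by (auto simp: Eb bz)
  qed
  have "c $$ (?i, Suc ?i) = 0"
  proof -
    obtain Z' U b1 where f: "Z' \<in> ord_unip n lower" "U \<in> ord_borel n int" "b1 \<in> ord_borel n lower"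
      "G k * 1\<^sub>m n = Z' * U * W k" "U * W k = W k * b1"
      using cell_factorization[OF kk one_ord_borel] by blast
    obtain Zi where Zi: "Zi \<in> ord_unip n lower" "Z' * Zi = 1\<^sub>m n" "Zi * Z' = 1\<^sub>m n"
      by (rule ord_unip_inverse[OF inj_lower f(1)])
    have car2: "Z' \<in> carrier_mat n n" "U \<in> carrier_mat n n" "b1 \<in> carrier_mat n n" "Zi \<in> carrier_mat n n"
      using f(1-3) Zi(1) by (simp_all add: ord_borel_carrier ord_unip_carrier)
    have "G k = Z' * (U * W k)" using f(4) Gc Wc car2 by (simp add: mult_assoc_mat[of _ n])
    then have Gk: "G k = Z' * (W k * b1)" unfolding f(5) .
    have "Zi * Z * W k = Zi * (Z * W k)" using Wc car car2 by (simp add: mult_assoc_mat[of _ n])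
    also have "\<dots> = Zi * Z' * (W k * b1 * c)"
      unfolding ZG Gk using Wc cc car2 by (simp add: mult_assoc_mat[of _ n])
    also have "\<dots> = W k * (b1 * c)"
      unfolding Zi(3) using Wc cc car2 by (simp add: mult_assoc_mat[of _ n])
    finally have e1: "Zi * Z * W k = W k * (b1 * c)" .
    obtain Y where Y: "Y \<in> ord_unip n (lower \<circ> \<pi> k)" "Zi * Z * W k = W k * Y"
      using V_move_right(1)[OF kk ord_unip_mult[OF inj_lower Zi(1) Z]] by blast
    have "b1 * c = Y"
      by (rule mult_left_cancel_mat[OF Wc _ _ ord_unip_carrier[OF Y(1)]])
        (use det_V[OF kk] e1 Y(2) car2 cc in auto)
    moreover have "Y $$ (?i, Suc ?i) = 0"
      using Y(1) asc[OF k] i by (auto simp: ord_unip_def intro: ord_triD)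
    \<comment> \<open>Row \<open>?i\<close> of \<open>b1\<close> ends at the diagonal and column
      \<open>Suc ?i\<close> of \<open>c\<close> starts at row \<open>?i\<close>, so the two overlap
      in one term.\<close>
    moreover have "(b1 * c) $$ (?i, Suc ?i) = b1 $$ (?i, ?i) * c $$ (?i, Suc ?i)"
    proof -
      have "(b1 * c) $$ (?i, Suc ?i) = (\<Sum>a<n. b1 $$ (?i, a) * c $$ (a, Suc ?i))"
        using i by (intro mult_mat_nth[OF car2(3) cc]) auto
      also have "\<dots> = b1 $$ (?i, ?i) * c $$ (?i, Suc ?i)"
      proof (rule sum_one_support[OF i(2)])
        fix a assume a: "a < n" "a \<noteq> ?i"
        show "b1 $$ (?i, a) * c $$ (a, Suc ?i) = 0"
        proof (cases "a < ?i")
          case True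
          then show ?thesis using cz[of a "Suc ?i"] a i by simp
        next
          case False
          then have "b1 $$ (?i, a) = 0" using f(3) a i by (auto simp: ord_borel_def intro: ord_triD)
          then show ?thesis by simp
        qed
      qed
      finally show ?thesis .
    qed
    moreover have "b1 $$ (?i, ?i) \<noteq> 0" by (rule ord_borel_diag_nonzero[OF inj_lower f(3) i(2)])
    ultimately show ?thesis by simp
  qed
  then have "c $$ (r, a) = 0" if "r < a" "r < n" "a < n" for r a using cz that by blast
  then have tri: "c \<in> ord_tri n lower" using cc by (force simp: ord_tri_def not_le[symmetric])
  have "det c = 1"
    using car b k i by (simp add: c_def det_mult[of _ n] det_E det_transpose[of _ n] det_sdot ord_borel_def)
  then have "c \<in> ord_borel n lower" using tri by (simp add: ord_borel_def)
  then show ?thesis using ZG by blast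
qed

lemma coset_chain:
  assumes Z: "Z \<in> ord_unip n lower" and b: "b \<in> ord_borel n lower" and eq: "Z * W m = G m * b"
  obtains \<beta> where "\<And>k. k \<le> m \<Longrightarrow> \<beta> k \<in> ord_borel n lower" "\<And>k. k \<le> m \<Longrightarrow> Z * W k = G k * \<beta> k"
proof -
  have "\<exists>b\<in>ord_borel n lower. Z * W k = G k * b" if "k \<le> m" for k
    using that
  proof (induction rule: inc_induct)
    case base
    then show ?case using b eq by blast
  next
    case (step k)
    then show ?case using coset_step_back[OF _ Z] by blast
  qed
  then have "\<forall>k\<in>{..m}. \<exists>b. b \<in> ord_borel n lower \<and> Z * W k = G k * b" by auto
  then obtain \<beta> where "\<forall>k\<in>{..m}. \<beta> k \<in> ord_borel n lower \<and> Z * W k = G k * \<beta> k" by metis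
  then show ?thesis using that by auto
qed

text \<open>Cancelling \<open>G_k\<close> leaves \<open>b s = E_k b'\<close>, of which the three
  formulas are entries. The strand at height \<open>i k\<close> rises to \<open>Suc (i k)\<close>,
  so the first formula divides its weight by \<open>q\<close>; the second multiplies the weight of
  the falling strand by \<open>q\<close>. Used letters are included with
  \<open>q = 1\<close>.\<close>

lemma diag_recursion:
  assumes k: "k < m" and Z: "Z \<in> carrier_mat n n"
    and b: "b \<in> ord_borel n lower" "Z * W k = G k * b"
    and b': "b' \<in> ord_borel n lower" "Z * W (Suc k) = G (Suc k) * b'"
    and q: "q = (if k \<in> J then t k else 1)"
  shows "b $$ (i k, i k) = q * b' $$ (Suc (i k), Suc (i k))"
    "b' $$ (i k, i k) = q * b $$ (Suc (i k), Suc (i k))"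
    "j < n \<Longrightarrow> j \<noteq> i k \<Longrightarrow> j \<noteq> Suc (i k) \<Longrightarrow> b' $$ (j, j) = b $$ (j, j)"
proof -
  let ?i = "i k"
  have i: "Suc ?i < n" "?i < n" and kk: "k \<le> m" using k bound[OF k] by auto
  have Gc: "G k \<in> carrier_mat n n" and Wc: "W k \<in> carrier_mat n n"
    by (rule G_carrier[OF kk], rule V_carrier[OF kk])
  have car: "b \<in> carrier_mat n n" "b' \<in> carrier_mat n n" using b b' by (auto simp: ord_borel_carrier)
  have "G k * (b * sdot n ?i) = G k * (E k * b')"
  proof -
    have "G k * (b * sdot n ?i) = Z * W k * sdot n ?i"
      unfolding b(2) using Gc car by (simp add: mult_assoc_mat[of _ n])
    also have "\<dots> = Z * W (Suc k)" using Wc Z by (simp add: mult_assoc_mat[of _ n])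
    also have "\<dots> = G k * (E k * b')" unfolding b'(2) using Gc car by (simp add: mult_assoc_mat[of _ n])
    finally show ?thesis .
  qed
  then have eq: "b * sdot n ?i = E k * b'"
    by (rule mult_left_cancel_mat[OF Gc, rotated 3]) (use det_G[OF kk] car in auto)
  have L: "(b * sdot n ?i) $$ (r, c) = (if c = ?i then - b $$ (r, Suc ?i) else if c = Suc ?i then b $$ (r, ?i) else b $$ (r, c))"
    if "r < n" "c < n" for r c using that i car by (simp add: mult_sdot_nth[where p = n])
  have R: "(E k * b') $$ (r, a) = (if k \<in> J then b' $$ (r, a) + (if r = ?i then t k * b' $$ (Suc ?i, a) else 0)
      else if r = ?i then b' $$ (Suc ?i, a) else if r = Suc ?i then - b' $$ (?i, a) else b' $$ (r, a))"
    if "r < n" "a < n" for r a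
    using that i car by (simp add: E_def sdot_mult_nth[where p = n] x_mat_mult_nth[where p = n])
  have e: "(b * sdot n ?i) $$ (r, c) = (E k * b') $$ (r, c)" for r c using eq by simp
  have z: "b $$ (?i, Suc ?i) = 0" "b' $$ (?i, Suc ?i) = 0"
    using b(1) b'(1) i by (auto simp: ord_borel_def intro: ord_triD)
  show "b $$ (?i, ?i) = q * b' $$ (Suc ?i, Suc ?i)"
    using e[of ?i "Suc ?i"] i z by (simp add: L R q split: if_splits)
  show "b' $$ (?i, ?i) = q * b $$ (Suc ?i, Suc ?i)"
  proof (cases "k \<in> J")
    case True
    \<comment> \<open>The off-diagonal entry of \<open>b'\<close> at \<open>(Suc ?i, ?i)\<close> is
      the link: row \<open>?i\<close> of the matrix identity ties it to the diagonal of
      \<open>b'\<close>, row \<open>Suc ?i\<close> to the diagonal of \<open>b\<close>.\<close>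
    have "b' $$ (?i, ?i) + t k * b' $$ (Suc ?i, ?i) = 0" using e[of ?i ?i] True i z by (simp add: L R)
    moreover have "b' $$ (Suc ?i, ?i) = - b $$ (Suc ?i, Suc ?i)"
      using e[of "Suc ?i" ?i] True i by (simp add: L R)
    ultimately show ?thesis using True by (simp add: q)
  next
    case False
    then show ?thesis using e[of "Suc ?i" ?i] i by (simp add: L R q)
  qed
  show "j < n \<Longrightarrow> j \<noteq> ?i \<Longrightarrow> j \<noteq> Suc ?i \<Longrightarrow> b' $$ (j, j) = b $$ (j, j)"
    using e[of j j] by (simp add: L R split: if_splits)
qed

end


section \<open>Chamber minors and representatives of cosets\<close>

lemma unip_borel_unique:
  assumes inj: "inj_on f {..<n}"
    and y: "y \<in> ord_unip n f" "y' \<in> ord_unip n f"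
    and b: "b \<in> ord_borel n (\<lambda>a. - f a)" "b' \<in> ord_borel n (\<lambda>a. - f a)"
    and eq: "y * b = y' * b'"
  shows "y' = y"
proof -
  have inj': "inj_on (\<lambda>a. - f a) {..<n}" using inj by (simp add: inj_on_def)
  obtain z where z: "z \<in> ord_unip n f" "y * z = 1\<^sub>m n" "z * y = 1\<^sub>m n"
    by (rule ord_unip_inverse[OF inj y(1)])
  obtain c where c: "c \<in> ord_borel n (\<lambda>a. - f a)" "b' * c = 1\<^sub>m n" "c * b' = 1\<^sub>m n"
    by (rule ord_borel_inverse[OF inj' b(2)])
  have car: "y \<in> carrier_mat n n" "y' \<in> carrier_mat n n" "z \<in> carrier_mat n n"
    "b \<in> carrier_mat n n" "b' \<in> carrier_mat n n" "c \<in> carrier_mat n n"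
    using y b z(1) c(1) by (simp_all add: ord_unip_carrier ord_borel_carrier)
  have "z * y' = z * (y' * b') * c" using car c(2) by (simp add: mult_assoc_mat[of _ n])
  also have "\<dots> = z * y * (b * c)"
    unfolding eq[symmetric] using car by (simp add: mult_assoc_mat[of _ n])
  also have "\<dots> = b * c" unfolding z(3) using car by simp
  finally have zy: "z * y' = b * c" .
  have "z * y' = 1\<^sub>m n"
    by (rule ord_unip_opposite_trivial[OF inj])
      (use ord_unip_mult[OF inj z(1) y(2)] ord_borel_mult[OF b(1) c(1)] zy in auto)
  then have "y * (z * y') = y" using car by simp
  then show "y' = y" using car z(2) by (simp add: mult_assoc_mat[of _ n, symmetric])
qed

lemma left_unip_eq:
  assumes y: "y \<in> Unip n" and b: "b \<in> Borel_minus n" and g: "g = y * b"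
  shows "left_unip n g = y"
  unfolding left_unip_def
proof (rule the_equality)
  show "y \<in> Unip n \<and> (\<exists>b\<in>Borel_minus n. g = y * b)" using assms by blast
next
  fix y' assume "y' \<in> Unip n \<and> (\<exists>b\<in>Borel_minus n. g = y' * b)"
  then obtain b' where y': "y' \<in> Unip n" and b': "b' \<in> Borel_minus n" "g = y' * b'" by blast
  have eq: "y * b = y' * b'" by (rule trans[OF g[symmetric] b'(2)])
  note u = y[unfolded Unip_eq] y'[unfolded Unip_eq] b[unfolded Borel_minus_eq] b'(1)[unfolded Borel_minus_eq]
  show "y' = y" by (rule unip_borel_unique[OF _ u eq]) simp
qed

lemma right_unip_eq:
  assumes y: "y \<in> Unip n" and b: "b \<in> Borel_minus n" and g: "g = b * y"
  shows "right_unip n g = y"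
  unfolding right_unip_def
proof (rule the_equality)
  show "y \<in> Unip n \<and> (\<exists>b\<in>Borel_minus n. g = b * y)" using assms by blast
next
  fix y' assume "y' \<in> Unip n \<and> (\<exists>b\<in>Borel_minus n. g = b * y')"
  then obtain b' where y': "y' \<in> ord_unip n int" and b': "b' \<in> ord_borel n lower" "b * y = b' * y'"
    using g by (auto simp: Unip_eq Borel_minus_eq)
  note yb = y[unfolded Unip_eq] b[unfolded Borel_minus_eq]
  have "transpose_mat y * transpose_mat b = transpose_mat y' * transpose_mat b'"
    using arg_cong[OF b'(2), of transpose_mat] transpose_mult[OF ord_borel_carrier ord_unip_carrier]
      yb y' b'(1) by metis
  then have "transpose_mat y' = transpose_mat y"
    using unip_borel_unique[OF inj_lower transpose_ord_unip[OF yb(1)] transpose_ord_unip[OF y']]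
      transpose_ord_borel[OF yb(2)] transpose_ord_borel[OF b'(1)] by simp
  then show "y' = y" by (metis transpose_transpose)
qed

text \<open>The factor \<open>l\<close> does not change the coset, and two elements of
  \<open>v N\<close> in one coset of \<open>B_-\<close> differ by an element of
  \<open>N \<inter> B_- = 1\<close>. The matrix \<open>a'\<close> witnesses membership in
  \<open>N v\<close>.\<close>

lemma cap_rep_eq:
  assumes V: "dot n v \<in> carrier_mat n n" "det (dot n v) = 1"
    and a: "a \<in> Unip n" "dot n v * a = a' * dot n v" "a' \<in> Unip n"
    and l: "l \<in> Borel_minus n" and g: "g = dot n v * a * l"
  shows "cap_rep n v g = dot n v * a"
  unfolding cap_rep_def
proof (rule the_equality)
  let ?V = "dot n v"
  note al = a(1)[unfolded Unip_eq] l[unfolded Borel_minus_eq]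
  have inj: "inj_on int {..<n}" by simp
  have car: "a \<in> carrier_mat n n" "l \<in> carrier_mat n n"
    using al by (simp_all add: ord_unip_carrier ord_borel_carrier)
  obtain c where c: "c \<in> ord_borel n lower" "l * c = 1\<^sub>m n" "c * l = 1\<^sub>m n"
    by (rule ord_borel_inverse[OF inj_lower al(2)])
  have cc: "c \<in> carrier_mat n n" using c(1) by (rule ord_borel_carrier)
  have "(\<lambda>b. g * b) ` Borel_minus n = (\<lambda>b. ?V * a * b) ` Borel_minus n"
  proof (intro subset_antisym image_subsetI)
    fix b assume b: "b \<in> Borel_minus n"
    have bc: "b \<in> carrier_mat n n" using b by (simp add: Borel_minus_eq ord_borel_carrier)
    show "g * b \<in> (\<lambda>b. ?V * a * b) ` Borel_minus n"
      using l b car bc V by (intro image_eqI[of _ _ "l * b"])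
        (auto simp: g mult_assoc_mat[of _ n] Borel_minus_eq intro: ord_borel_mult)
    have "?V * a * b = g * (c * b)"
    proof -
      have "g * (c * b) = ?V * a * (l * c) * b" using car bc V cc by (simp add: g mult_assoc_mat[of _ n])
      then show ?thesis unfolding c(2) using car bc V by simp
    qed
    then show "?V * a * b \<in> (\<lambda>b. g * b) ` Borel_minus n"
      using c(1) b by (intro image_eqI[of _ _ "c * b"]) (auto simp: Borel_minus_eq intro: ord_borel_mult)
  qed
  moreover have "?V * a \<in> (\<lambda>x. x * ?V) ` Unip n" unfolding a(2) using a(3) by (rule imageI)
  moreover have "?V * a \<in> (\<lambda>x. ?V * x) ` Unip n" using a(1) by (rule imageI)
  ultimately show "?V * a \<in> (\<lambda>x. x * ?V) ` Unip n \<inter> (\<lambda>x. ?V * x) ` Unip n \<and>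
     (\<lambda>b. g * b) ` Borel_minus n = (\<lambda>b. ?V * a * b) ` Borel_minus n"
    by blast
next
  let ?V = "dot n v"
  note al = a(1)[unfolded Unip_eq] l[unfolded Borel_minus_eq]
  have inj: "inj_on int {..<n}" by simp
  fix h assume h: "h \<in> (\<lambda>x. x * ?V) ` Unip n \<inter> (\<lambda>x. ?V * x) ` Unip n \<and>
     (\<lambda>b. g * b) ` Borel_minus n = (\<lambda>b. h * b) ` Borel_minus n"
  then obtain x where x: "x \<in> ord_unip n int" "h = ?V * x" by (auto simp: Unip_eq)
  have xc: "x \<in> carrier_mat n n" using x(1) by (rule ord_unip_carrier)
  have "h * 1\<^sub>m n \<in> (\<lambda>b. h * b) ` Borel_minus n"
    by (rule imageI) (simp add: Borel_minus_eq one_ord_borel)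
  then obtain b where b: "b \<in> ord_borel n lower" "h = g * b"
    using h xc V x(2) by (auto simp: Borel_minus_eq)
  have car: "a \<in> carrier_mat n n" "l \<in> carrier_mat n n" "b \<in> carrier_mat n n"
    using al b by (simp_all add: ord_unip_carrier ord_borel_carrier)
  have "?V * x = ?V * (a * (l * b))"
    using x(2) b(2) car V by (simp add: g mult_assoc_mat[of _ n])
  then have eq: "x = a * (l * b)"
    by (rule mult_left_cancel_mat[OF V(1), rotated 3]) (use V xc car in auto)
  then have "x * 1\<^sub>m n = a * (l * b)" by (rule trans[OF right_mult_one_mat[OF xc]])
  from unip_borel_unique[OF inj al(1) x(1) _ _ this[symmetric]] have "x = a"
    using ord_borel_mult[OF al(2) b(1)] one_ord_borel by simp
  then show "h = ?V * a" using x(2) by simp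
qed

section \<open>Unipotent factors crossing a simple reflection\<close>

lemma transpose_x_ord_unip:
  assumes "Suc i < n" "f (Suc i) \<le> f i"
  shows "transpose_mat (x_mat n i t) \<in> ord_unip n f"
  using assms by (auto simp: ord_unip_def ord_tri_def x_mat_def)

lemma sdot_conj_ord_unip:
  assumes "X \<in> ord_unip n (g \<circ> simple_refl i)" "Suc i < n"
  shows "sdot n i * X * transpose_mat (sdot n i) \<in> ord_unip n g"
    "transpose_mat (sdot n i) * X * sdot n i \<in> ord_unip n g"
  using sdot_conj_ord_tri[of X n g i] sdot_conj_diag[OF ord_unip_carrier[OF assms(1)] assms(2)] assms
  by (auto simp: ord_unip_def simple_refl_less)

lemma ord_unip_int_refl:
  assumes "X \<in> ord_unip n int" "X $$ (i, Suc i) = 0"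
  shows "X \<in> ord_unip n (int \<circ> simple_refl i)"
proof -
  have "int (simple_refl i a) \<le> int (simple_refl i b)" if "X $$ (a, b) \<noteq> 0" "a < n" "b < n" for a b
  proof -
    have "a \<le> b" using assms that by (auto simp: ord_unip_def ord_tri_def)
    moreover have "\<not> (a = i \<and> b = Suc i)" using assms that by auto
    ultimately show ?thesis by (auto simp: simple_refl_def Transposition.transpose_def)
  qed
  then show ?thesis using assms by (auto simp: ord_unip_def ord_tri_def)
qed

lemma ord_unip_lower_refl:
  assumes "X \<in> ord_unip n lower" "X $$ (Suc i, i) = 0"
  shows "X \<in> ord_unip n (lower \<circ> simple_refl i)"
proof -
  have "lower (simple_refl i a) \<le> lower (simple_refl i b)" if "X $$ (a, b) \<noteq> 0" "a < n" "b < n" for a b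
  proof -
    have "b \<le> a" using assms that by (auto simp: ord_unip_def ord_tri_def)
    moreover have "\<not> (a = Suc i \<and> b = i)" using assms that by auto
    ultimately show ?thesis by (auto simp: simple_refl_def Transposition.transpose_def)
  qed
  then show ?thesis using assms by (auto simp: ord_unip_def ord_tri_def)
qed

lemma x_mat_inverse:
  assumes "Suc i < n"
  shows "x_mat n i t * x_mat n i (- t) = 1\<^sub>m n"
  using assms by (intro eq_matI) (auto simp: mult_x_mat_nth[where p = n] x_mat_nth)

context ascending
begin

text \<open>At a used crossing to the left of column \<open>k\<close>, the strand that enters from
  above leaves below the other one and stays below it. If it lies above \<open>h\<close> in column
  \<open>k\<close>, so does the other, which is the sign condition of \<open>minor_mult_V\<close>
  for the set of strands above \<open>h\<close>.\<close>

lemma minor_mult_V_top: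
  assumes B: "B \<in> carrier_mat n n" and R: "R \<subseteq> {..<n}" "card R = n - h" and k: "k \<le> m"
  shows "minor R (\<pi> k ` {h..<n}) B = minor R {h..<n} (B * V k)"
proof -
  let ?T = "\<pi> k ` {h..<n}"
  have inj: "inj (\<pi> k)" by (rule permutes_inj[OF pi_permutes[OF k]])
  have T: "?T \<subseteq> {..<n}" by (rule image_subsetI) (simp add: pi_less[OF k])
  have card: "card ?T = n - h" using inj by (simp add: card_image inj_on_def)
  have "minor R {c. c < n \<and> \<pi> k c \<in> ?T} (B * V k) = minor R {c. c < n \<and> \<pi> 0 c \<in> ?T} (B * V 0)"
  proof (rule minor_mult_V[OF B R(1) T _ _ k])
    fix l assume l: "l < k" "l \<in> K" "\<pi> l (Suc (i l)) \<in> ?T"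
    then obtain x' where x': "\<pi> l (Suc (i l)) = \<pi> k x'" "h \<le> x'" by auto
    have lm: "l < m" using l k by simp
    obtain y' where y': "\<pi> l (i l) = \<pi> k y'"
      using permutes_surj[OF pi_permutes[OF k]] by (metis surjD)
    have "\<pi> (Suc l) (i l) = \<pi> k x'" "\<pi> (Suc l) (Suc (i l)) = \<pi> k y'"
      using l(2) x'(1) y' by simp_all
    moreover have "\<pi> (Suc l) (Suc (i l)) < \<pi> (Suc l) (i l)" using l(2) asc[OF lm l(2)] by simp
    ultimately have "x' < y'" using l(1) k inversion_mono[of "Suc l" k "i l" x' "Suc (i l)" y'] by simp
    moreover have "y' < n" using y' pi_less[OF k, of y'] pi_less[of l "i l"] bound[OF lm] lm by simp
    ultimately show "\<pi> l (i l) \<in> ?T" using y' x'(2) by auto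
  qed (use R card in auto)
  also have "{c. c < n \<and> \<pi> k c \<in> ?T} = {h..<n}" by (auto simp: inj_image_mem_iff[OF inj])
  also have "{c. c < n \<and> \<pi> 0 c \<in> ?T} = ?T" using T by auto
  finally show ?thesis using B by simp
qed

end

context mr_word
begin

definition q :: "nat \<Rightarrow> complex" where "q k = (if k \<in> J then t k else 1)"

text \<open>One \<open>Z\<close> does two jobs. \<open>Z * U\<close> is the triangular factorization
  from which \<open>y\<close> is read off after a transposition; and since
  \<open>U * W m = W m * b'\<close>, the factor \<open>U\<close> can be absorbed into
  \<open>B_-\<close>, so that \<open>Z * W m\<close> lies in the coset of
  \<open>G m\<close>.\<close>

lemma opposite_factorization:
  assumes "b0 \<in> ord_borel n lower"
  obtains Z U b where "Z \<in> ord_unip n lower" "U \<in> ord_borel n int" "b \<in> ord_borel n lower"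
    "G m * b0 = Z * U * W m" "Z * W m = G m * b"
proof -
  obtain Z U b' where f: "Z \<in> ord_unip n lower" "U \<in> ord_borel n int" "b' \<in> ord_borel n lower"
    "G m * b0 = Z * U * W m" "U * W m = W m * b'"
    using cell_factorization[OF order_refl assms] by blast
  obtain c where c: "c \<in> ord_borel n lower" "b' * c = 1\<^sub>m n" "c * b' = 1\<^sub>m n"
    by (rule ord_borel_inverse[OF inj_lower f(3)])
  have Gc: "G m \<in> carrier_mat n n" and Wc: "W m \<in> carrier_mat n n"
    by (rule G_carrier[OF order_refl], rule V_carrier[OF order_refl])
  have car: "Z \<in> carrier_mat n n" "U \<in> carrier_mat n n" "b' \<in> carrier_mat n n" "c \<in> carrier_mat n n"
    "b0 \<in> carrier_mat n n"
    using f(1-3) c(1) assms by (simp_all add: ord_borel_carrier ord_unip_carrier)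
  have "G m * (b0 * c) = G m * b0 * c" by (rule mult_assoc_mat[symmetric]) (fact Gc car)+
  also have "\<dots> = Z * (U * W m) * c" unfolding f(4) using Wc car by (simp add: mult_assoc_mat[of _ n])
  also have "\<dots> = Z * W m * (b' * c)" unfolding f(5) using Wc car by (simp add: mult_assoc_mat[of _ n])
  also have "\<dots> = Z * W m" unfolding c(2) using Wc car by simp
  finally have "Z * W m = G m * (b0 * c)" ..
  then show ?thesis using that f(1,2,4) ord_borel_mult[OF assms c(1)] by blast
qed

lemma chamber_minors:
  assumes Z: "Z \<in> ord_unip n lower" and b: "b \<in> ord_borel n lower" and eq: "Z * W m = G m * b"
  obtains d where "\<And>j. j < n \<Longrightarrow> d 0 j = (1 :: complex)"
    and "\<And>k j. k \<le> m \<Longrightarrow> j < n \<Longrightarrow> d k j \<noteq> 0"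
    and "\<And>k. k < m \<Longrightarrow> d k (i k) = q k * d (Suc k) (Suc (i k))"
    and "\<And>k. k < m \<Longrightarrow> d (Suc k) (i k) = q k * d k (Suc (i k))"
    and "\<And>k j. k < m \<Longrightarrow> j < n \<Longrightarrow> j \<noteq> i k \<Longrightarrow> j \<noteq> Suc (i k) \<Longrightarrow> d (Suc k) j = d k j"
    and "\<And>k h R. k \<le> m \<Longrightarrow> R \<subseteq> {..<n} \<Longrightarrow> card R = n - h \<Longrightarrow>
      minor R (\<pi> k ` {h..<n}) Z = minor R {h..<n} (G k) * (\<Prod>j\<in>{h..<n}. d k j)"
proof -
  have "\<exists>\<beta>. \<forall>k\<le>m. \<beta> k \<in> ord_borel n lower \<and> Z * W k = G k * \<beta> k"
    by (rule coset_chain[OF assms]) blast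
  then obtain \<beta> where \<beta>: "\<And>k. k \<le> m \<Longrightarrow> \<beta> k \<in> ord_borel n lower"
    "\<And>k. k \<le> m \<Longrightarrow> Z * W k = G k * \<beta> k" by blast
  have Zc: "Z \<in> carrier_mat n n" using Z by (rule ord_unip_carrier)
  define d where "d = (\<lambda>k j. \<beta> k $$ (j, j))"
  have rec: "d k (i k) = q k * d (Suc k) (Suc (i k))" "d (Suc k) (i k) = q k * d k (Suc (i k))"
    "j < n \<Longrightarrow> j \<noteq> i k \<Longrightarrow> j \<noteq> Suc (i k) \<Longrightarrow> d (Suc k) j = d k j" if k: "k < m" for k j
  proof -
    note * = diag_recursion[OF k Zc \<beta>(1)[OF less_imp_le[OF k]] \<beta>(2)[OF less_imp_le[OF k]]
        \<beta>(1)[OF Suc_leI[OF k]] \<beta>(2)[OF Suc_leI[OF k]] q_def]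
    show "d k (i k) = q k * d (Suc k) (Suc (i k))" unfolding d_def by (rule *(1))
    show "d (Suc k) (i k) = q k * d k (Suc (i k))" unfolding d_def by (rule *(2))
    show "j < n \<Longrightarrow> j \<noteq> i k \<Longrightarrow> j \<noteq> Suc (i k) \<Longrightarrow> d (Suc k) j = d k j"
      unfolding d_def by (rule *(3))
  qed
  show ?thesis
  proof (rule that[of d])
    \<comment> \<open>In column 0 both products are empty, so \<open>\<beta> 0\<close> is the
      unipotent \<open>Z\<close>; hence all weights start at 1.\<close>
    have "\<beta> 0 \<in> carrier_mat n n" using \<beta>(1)[of 0] by (simp add: ord_borel_carrier)
    then have "\<beta> 0 = Z" using \<beta>(2)[of 0] Zc by simp
    then show "d 0 j = 1" if "j < n" for j using Z that by (simp add: d_def ord_unip_def)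
    show "d k j \<noteq> 0" if "k \<le> m" "j < n" for k j
      unfolding d_def by (rule ord_borel_diag_nonzero[OF inj_lower \<beta>(1)[OF that(1)] that(2)])
    show "minor R (\<pi> k ` {h..<n}) Z = minor R {h..<n} (G k) * (\<Prod>j\<in>{h..<n}. d k j)"
      if k: "k \<le> m" and R: "R \<subseteq> {..<n}" "card R = n - h" for k h R
      unfolding minor_mult_V_top[OF Zc R k] \<beta>(2)[OF k] d_def
      by (rule minor_mult_lower[OF G_carrier[OF k] _ R]) (use \<beta>(1)[OF k] in \<open>simp add: ord_borel_def\<close>)
  qed (use rec in auto)
qed

end

locale mr_pair = mr_word n m i J t + v: ascending n m i "- J" for n m i J t +
  assumes asc_J: "k < m \<Longrightarrow> k \<in> J \<Longrightarrow> pseq i (- J) k (i k) < pseq i (- J) k (Suc (i k))"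
begin

abbreviation "\<rho> \<equiv> pseq i (- J)"
abbreviation "V' \<equiv> mseq n (\<lambda>k. if k \<in> - J then sdot n (i k) else 1\<^sub>m n)"

lemma asc_all: "k < m \<Longrightarrow> \<rho> k (i k) < \<rho> k (Suc (i k))"
  using asc_J v.asc by (cases "k \<in> J") auto

lemma inj_int_rho: "k \<le> m \<Longrightarrow> inj_on (int \<circ> \<rho> k) {..<n}"
  using v.pi_inj by (auto simp: inj_on_def)

text \<open>\<open>a\<close> and \<open>l\<close> are the factors in \<open>N \<inter> v\<inverse> N v\<close> and \<open>N\<^sub>- \<inter> v\<inverse> N v\<close>, where \<open>v = \<rho> k\<close>.\<close>

lemma G_factorization:
  assumes "k \<le> m"
  shows "\<exists>a l. a \<in> ord_unip n int \<and> a \<in> ord_unip n (int \<circ> \<rho> k) \<and>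
    l \<in> ord_unip n lower \<and> l \<in> ord_unip n (int \<circ> \<rho> k) \<and> G k = V' k * a * l"
  using assms
proof (induction k)
  case 0
  show ?case by (intro exI[of _ "1\<^sub>m n"]) (auto simp: one_ord_unip)
next
  case (Suc k)
  then obtain a l where IH: "a \<in> ord_unip n int" "a \<in> ord_unip n (int \<circ> \<rho> k)"
    "l \<in> ord_unip n lower" "l \<in> ord_unip n (int \<circ> \<rho> k)" "G k = V' k * a * l"
    using Suc_leD by blast
  let ?i = "i k"
  let ?s = "sdot n ?i" and ?t = "transpose_mat (sdot n ?i)"
  have k: "k < m" "k \<le> m" and i: "Suc ?i < n" "?i < n" using Suc.prems bound[of k] by auto
  have Vc: "V' k \<in> carrier_mat n n" by (rule v.V_carrier[OF k(2)])
  have car: "a \<in> carrier_mat n n" "l \<in> carrier_mat n n" using IH by (simp_all add: ord_unip_carrier)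
  have inj: "inj_on int {..<n}" by simp
  have up: "\<rho> k ?i < \<rho> k (Suc ?i)" by (rule asc_all[OF k(1)])
  have lz: "l $$ (Suc ?i, ?i) = 0" using IH(4) up i by (auto simp: ord_unip_def intro: ord_triD)
  have ll: "l $$ (r, c) = 0" if "r < c" "r < n" "c < n" for r c
    using IH(3) that by (auto simp: ord_unip_def intro: ord_triD)
  have l1: "l $$ (r, r) = 1" if "r < n" for r using IH(3) that by (simp add: ord_unip_def)
  show ?case
  proof (cases "k \<in> J")
    case True
    let ?x = "x_mat n ?i (t k)" and ?x' = "x_mat n ?i (- t k)"
    \<comment> \<open>The new factor \<open>?x\<close> is pulled to the left of \<open>l\<close>.
      The conjugate stays lower triangular because the order \<open>\<rho> k\<close> forces
      \<open>l\<close> to vanish at \<open>(Suc ?i, ?i)\<close>.\<close>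
    define l' where "l' = ?x' * (l * ?x)"
    have x: "x_mat n ?i p \<in> ord_unip n int" "x_mat n ?i p \<in> ord_unip n (int \<circ> \<rho> k)" for p
      using i up by (auto intro!: x_mat_ord_unip)
    have l'r: "l' \<in> ord_unip n (int \<circ> \<rho> k)"
      unfolding l'_def by (intro ord_unip_mult inj_int_rho k x IH)
    have l'c: "l' \<in> carrier_mat n n" using l'r by (rule ord_unip_carrier)
    have "l' $$ (r, c) = 0" if "r < c" "r < n" "c < n" for r c
    proof -
      have lx: "(l * ?x) $$ (r, c) = l $$ (r, c) + (if c = Suc ?i then t k * l $$ (r, ?i) else 0)"
        if "r < n" for r using that \<open>c < n\<close> car i by (intro mult_x_mat_nth) auto
      have "l' $$ (r, c) = (l * ?x) $$ (r, c) + (if r = ?i then - t k * (l * ?x) $$ (Suc ?i, c) else 0)"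
        unfolding l'_def using that car i by (intro x_mat_mult_nth) auto
      then show ?thesis using that i lz l1 by (auto simp: lx ll)
    qed
    then have "l' \<in> ord_tri n lower" using l'c by (force simp: ord_tri_def not_le[symmetric])
    then have l'l: "l' \<in> ord_unip n lower" using l'r by (simp add: ord_unip_def)
    have "G (Suc k) = V' k * a * (l * ?x)"
      using True Vc car by (simp add: E_def IH(5) mult_assoc_mat[of _ n])
    also have "l * ?x = ?x * ?x' * (l * ?x)" unfolding x_mat_inverse[OF i(1)] using car by simp
    also have "\<dots> = ?x * l'" unfolding l'_def using car by (simp add: mult_assoc_mat[of _ n])
    also have "V' k * a * (?x * l') = V' (Suc k) * (a * ?x) * l'"
      using True Vc car l'c by (simp add: mult_assoc_mat[of _ n])
    finally have eq: "G (Suc k) = V' (Suc k) * (a * ?x) * l'" .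
    have rho: "\<rho> (Suc k) = \<rho> k" using True by simp
    show ?thesis
      unfolding rho using eq ord_unip_mult[OF inj IH(1) x(1)] l'l l'r
        ord_unip_mult[OF inj_int_rho[OF k(2)] IH(2) x(2)] by blast
  next
    case False
    \<comment> \<open>The coefficient at the one root that \<open>?s\<close> makes negative. It is
      split off from \<open>a\<close> as \<open>x_i(p)\<close>, crosses \<open>?s\<close> as the
      lower triangular \<open>?y\<close>, and joins \<open>l\<close>.\<close>
    define p where "p = a $$ (?i, Suc ?i)"
    let ?x = "x_mat n ?i p" and ?x' = "x_mat n ?i (- p)" and ?y = "transpose_mat (x_mat n ?i (- p))"
    define a1 where "a1 = a * ?x'"
    have x: "x_mat n ?i p \<in> ord_unip n int" "x_mat n ?i p \<in> ord_unip n (int \<circ> \<rho> k)" for p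
      using i up by (auto intro!: x_mat_ord_unip)
    have a1: "a1 \<in> ord_unip n int" "a1 \<in> ord_unip n (int \<circ> \<rho> k)"
      unfolding a1_def by (intro ord_unip_mult inj x inj_int_rho k IH)+
    have a1c: "a1 \<in> carrier_mat n n" using a1(1) by (rule ord_unip_carrier)
    have "a1 $$ (?i, Suc ?i) = a $$ (?i, Suc ?i) - p * a $$ (?i, ?i)"
      unfolding a1_def using car i by (subst mult_x_mat_nth[where p = n]) auto
    then have a1z: "a1 $$ (?i, Suc ?i) = 0" using IH(1) i by (simp add: p_def ord_unip_def)
    have aeq: "a = a1 * ?x"
      unfolding a1_def using x_mat_inverse[OF i(1), of "- p"] car by (simp add: mult_assoc_mat[of _ n])
    define a2 where "a2 = ?t * a1 * ?s"
    define l2 where "l2 = ?t * l * ?s"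
    have rs: "int \<circ> \<rho> k = int \<circ> \<rho> (Suc k) \<circ> simple_refl ?i" using False by (auto simp: fun_eq_iff)
    have a2: "a2 \<in> ord_unip n int" "a2 \<in> ord_unip n (int \<circ> \<rho> (Suc k))"
      unfolding a2_def
      using ord_unip_int_refl[OF a1(1) a1z] a1(2)[unfolded rs] by (auto intro!: sdot_conj_ord_unip(2) i)
    have l2: "l2 \<in> ord_unip n lower" "l2 \<in> ord_unip n (int \<circ> \<rho> (Suc k))"
      unfolding l2_def
      using ord_unip_lower_refl[OF IH(3) lz] IH(4)[unfolded rs] by (auto intro!: sdot_conj_ord_unip(2) i)
    have y: "?y \<in> ord_unip n lower" "?y \<in> ord_unip n (int \<circ> \<rho> (Suc k))"
      using up False i by (auto intro!: transpose_x_ord_unip)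
    have ls: "l * ?s = ?s * l2" unfolding l2_def by (rule sdot_conj_cancel(2)[symmetric]) (use car i in auto)
    have as: "a1 * ?s = ?s * a2" unfolding a2_def by (rule sdot_conj_cancel(2)[symmetric]) (use a1c i in auto)
    have xs: "?x * ?s = ?s * ?y" using sdot_mult_transpose_x[OF i(1), of "- p"] by simp
    have car2: "a2 \<in> carrier_mat n n" "l2 \<in> carrier_mat n n" "?y \<in> carrier_mat n n"
      using a2(1) l2(1) by (simp_all add: ord_unip_carrier)
    have "G (Suc k) = V' k * a * (l * ?s)"
      using False Vc car by (simp add: E_def IH(5) mult_assoc_mat[of _ n])
    also have "\<dots> = V' k * a1 * (?x * ?s) * l2"
      unfolding ls aeq using Vc car2 a1c by (simp add: mult_assoc_mat[of _ n])
    also have "\<dots> = V' k * (a1 * ?s) * ?y * l2"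
      unfolding xs using Vc car2 a1c by (simp add: mult_assoc_mat[of _ n])
    also have "\<dots> = V' (Suc k) * a2 * (?y * l2)"
      unfolding as using False Vc car2 by (simp add: mult_assoc_mat[of _ n])
    finally show ?thesis
      using a2 ord_unip_mult[OF inj_lower y(1) l2(1)] ord_unip_mult[OF inj_int_rho[OF Suc.prems] y(2) l2(2)]
      by blast
  qed
qed

text \<open>The factorization gives \<open>G k = Y * V' k\<close> with \<open>Y\<close> in
  \<open>N\<close>. The row set is the image of the column set under \<open>\<rho> k\<close>, so the
  minor becomes a principal minor of \<open>Y\<close>.\<close>

lemma minor_G_top:
  assumes k: "k \<le> m" and h: "h \<le> n"
  shows "minor (\<rho> k ` {h..<n}) {h..<n} (G k) = 1"
proof -
  obtain a l where al: "a \<in> ord_unip n (int \<circ> \<rho> k)" "l \<in> ord_unip n (int \<circ> \<rho> k)" "G k = V' k * a * l"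
    using G_factorization[OF k] by blast
  have car: "a \<in> carrier_mat n n" "l \<in> carrier_mat n n" using al by (simp_all add: ord_unip_carrier)
  obtain Y where Y: "Y \<in> ord_unip n int" "V' k * (a * l) = Y * V' k"
    using v.V_move_left[OF k ord_unip_mult[OF inj_int_rho[OF k] al(1,2)]] by blast
  have Yc: "Y \<in> carrier_mat n n" using Y(1) by (rule ord_unip_carrier)
  have GY: "G k = Y * V' k"
    unfolding Y(2)[symmetric] al(3) using car v.V_carrier[OF k] by (rule mult_assoc_mat[rotated])
  have R: "\<rho> k ` {h..<n} \<subseteq> {..<n}" by (rule image_subsetI) (simp add: v.pi_less[OF k])
  have "card (\<rho> k ` {h..<n}) = n - h"
    using permutes_inj[OF v.pi_permutes[OF k]] by (simp add: card_image inj_on_def)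
  from v.minor_mult_V_top[OF Yc R this k]
  have "minor (\<rho> k ` {h..<n}) {h..<n} (G k) = minor (\<rho> k ` {h..<n}) (\<rho> k ` {h..<n}) Y"
    unfolding GY ..
  also have "\<dots> = 1" by (rule minor_principal_ord_unip[OF _ Y(1) R]) simp
  finally show ?thesis .
qed

end


section \<open>The flip\<close>

text \<open>Transposition in the antidiagonal: an anti-automorphism that preserves \<open>N\<close>, \<open>B\<^sub>-\<close>, the
  \<open>x\<^sub>i(t)\<close> and the representatives of the \<open>s\<^sub>i\<close>. It exchanges the two halves of the theorem.\<close>

definition flip :: "nat \<Rightarrow> complex mat \<Rightarrow> complex mat" where
  "flip n A = mat n n (\<lambda>(r, c). A $$ (n - Suc c, n - Suc r))"

lemma flip_carrier [simp]: "flip n A \<in> carrier_mat n n" "dim_row (flip n A) = n" "dim_col (flip n A) = n"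
  by (simp_all add: flip_def)

lemma flip_nth: "r < n \<Longrightarrow> c < n \<Longrightarrow> flip n A $$ (r, c) = A $$ (n - Suc c, n - Suc r)"
  by (simp add: flip_def)

lemma flip_flip: "A \<in> carrier_mat n n \<Longrightarrow> flip n (flip n A) = A"
  by (rule eq_matI) (auto simp: flip_nth)

lemma flip_mult:
  assumes "A \<in> carrier_mat n n" "B \<in> carrier_mat n n"
  shows "flip n (A * B) = flip n B * flip n A"
proof (rule eq_matI)
  fix r c assume "r < dim_row (flip n B * flip n A)" "c < dim_col (flip n B * flip n A)"
  then have rc: "r < n" "c < n" by auto
  have "flip n (A * B) $$ (r, c) = (\<Sum>k<n. A $$ (n - Suc c, k) * B $$ (k, n - Suc r))"
    using rc by (simp add: flip_nth mult_mat_nth[OF assms])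
  also have "\<dots> = (\<Sum>k<n. A $$ (n - Suc c, n - Suc k) * B $$ (n - Suc k, n - Suc r))"
    by (rule sum.reindex_bij_witness[of _ "\<lambda>k. n - Suc k" "\<lambda>k. n - Suc k"]) auto
  also have "\<dots> = (\<Sum>k<n. flip n B $$ (r, k) * flip n A $$ (k, c))"
    using rc by (intro sum.cong) (auto simp: flip_nth)
  also have "\<dots> = (flip n B * flip n A) $$ (r, c)"
    using rc by (intro mult_mat_nth[symmetric]) auto
  finally show "flip n (A * B) $$ (r, c) = (flip n B * flip n A) $$ (r, c)" .
qed auto

lemma flip_one: "flip n (1\<^sub>m n) = 1\<^sub>m n"
  by (rule eq_matI) (auto simp: flip_nth)

lemma reverse_eq_iff:
  assumes "c < n" "i < n"
  shows "n - Suc c = i \<longleftrightarrow> c = n - Suc i"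
  using assms by arith

lemma flip_x_mat:
  assumes i: "Suc i < n"
  shows "flip n (x_mat n i t) = x_mat n (n - Suc (Suc i)) t"
proof (rule eq_matI)
  fix r c assume "r < dim_row (x_mat n (n - Suc (Suc i)) t)" "c < dim_col (x_mat n (n - Suc (Suc i)) t)"
  then have rc: "r < n" "c < n" by auto
  have "n - Suc c < n" "n - Suc r < n" "i < n" using rc i by auto
  moreover have "Suc (n - Suc (Suc i)) = n - Suc i" using i by arith
  moreover have "(n - Suc c = n - Suc r) = (r = c)" using rc by arith
  ultimately show "flip n (x_mat n i t) $$ (r, c) = x_mat n (n - Suc (Suc i)) t $$ (r, c)"
    using rc i by (simp only: flip_nth x_mat_nth reverse_eq_iff conj_commute)
qed auto

lemma flip_sdot:
  assumes i: "Suc i < n"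
  shows "flip n (sdot n i) = sdot n (n - Suc (Suc i))"
proof (rule eq_matI)
  fix r c assume "r < dim_row (sdot n (n - Suc (Suc i)))" "c < dim_col (sdot n (n - Suc (Suc i)))"
  then have rc: "r < n" "c < n" by auto
  have 1: "n - Suc c < n" "n - Suc r < n" "i < n" using rc i by auto
  have 2: "Suc (n - Suc (Suc i)) = n - Suc i" using i by arith
  have 3: "(n - Suc c = n - Suc r) = (r = c)" using rc by arith
  have "n - Suc i \<noteq> n - Suc (Suc i)" using i by arith
  then show "flip n (sdot n i) $$ (r, c) = sdot n (n - Suc (Suc i)) $$ (r, c)"
    using rc i 1 unfolding flip_nth[OF rc] sdot_nth[OF 1(1,2)] sdot_nth[OF rc] 2 3
    by (simp only: reverse_eq_iff) auto
qed auto

lemma flip_ord_tri: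
  assumes "A \<in> ord_tri n f" "\<And>a b. a < n \<Longrightarrow> b < n \<Longrightarrow> f (n - Suc b) \<le> f (n - Suc a) \<Longrightarrow> g a \<le> g b"
  shows "flip n A \<in> ord_tri n g"
proof -
  have "g a \<le> g b" if "a < n" "b < n" "A $$ (n - Suc b, n - Suc a) \<noteq> 0" for a b
    using that assms(1) by (intro assms(2)) (auto simp: ord_tri_def)
  then show ?thesis by (simp add: ord_tri_def flip_nth)
qed

lemma flip_ord_tri_int: "A \<in> ord_tri n int \<Longrightarrow> flip n A \<in> ord_tri n int"
  by (erule flip_ord_tri) simp

lemma flip_ord_tri_lower: "A \<in> ord_tri n lower \<Longrightarrow> flip n A \<in> ord_tri n lower"
  by (erule flip_ord_tri) simp

lemma det_flip: "A \<in> carrier_mat n n \<Longrightarrow> det (flip n A) = det A"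
proof -
  assume A: "A \<in> carrier_mat n n"
  have "flip n A = transpose_mat (mat n n (\<lambda>(a, b). A $$ (n - Suc a, n - Suc b)))"
    by (rule eq_matI) (auto simp: flip_nth)
  then show ?thesis using det_reverse[OF A] by (simp add: det_transpose[of _ n])
qed

lemma flip_ord_borel_int: "A \<in> ord_borel n int \<Longrightarrow> flip n A \<in> ord_borel n int"
  using det_flip[of A n] by (auto simp: ord_borel_def flip_ord_tri_int ord_tri_carrier)

lemma flip_ord_unip_lower: "A \<in> ord_unip n lower \<Longrightarrow> flip n A \<in> ord_unip n lower"
  by (simp add: ord_unip_def flip_ord_tri_lower) (simp add: flip_nth)

lemma simple_refl_reverse:
  assumes "Suc i < n" "a < n"
  shows "simple_refl (n - Suc (Suc i)) (n - Suc a) = n - Suc (simple_refl i a)"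
  using assms by (auto simp: simple_refl_def Transposition.transpose_def)

section \<open>The half turn of the diagram and the tails of the product\<close>

context mr_pair
begin

text \<open>The diagram after a half turn: the crossings are read from right to left and the heights
  are turned upside down. The pair of heights \<open>i, Suc i\<close> becomes
  \<open>n - Suc (Suc i), n - Suc i\<close>, and a letter names the lower of the two.\<close>

definition i' :: "nat \<Rightarrow> nat" where "i' k = n - Suc (Suc (i (m - Suc k)))"
definition J' :: "nat set" where "J' = {k. m - Suc k \<in> J}"
definition t' :: "nat \<Rightarrow> complex" where "t' k = t (m - Suc k)"

text \<open>\<open>e\<close> is the right endpoint of the strand at height \<open>a\<close> in
  column \<open>m - k\<close>. After the half turn the right endpoints, reflected, become the labels
  of the strands.\<close>

lemma reversed_perm:
  assumes "k \<le> m" "a < n" "\<pi> m e = \<pi> (m - k) a"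
  shows "pseq i' UNIV k (n - Suc a) = n - Suc e"
  using assms
proof (induction k arbitrary: a)
  case 0
  then show ?case by (simp add: pi_inj)
next
  case (Suc k)
  let ?c = "m - Suc k"
  have c: "?c < m" "Suc ?c = m - k" using Suc.prems by auto
  have i: "Suc (i ?c) < n" by (rule bound[OF c(1)])
  have "\<pi> m e = \<pi> (Suc ?c) (simple_refl (i ?c) a)" using Suc.prems by simp
  then have "pseq i' UNIV k (n - Suc (simple_refl (i ?c) a)) = n - Suc e"
    unfolding c(2) using Suc.prems i by (intro Suc.IH) (auto simp: simple_refl_less)
  moreover have "i' k = n - Suc (Suc (i ?c))" by (simp add: i'_def)
  ultimately show ?case using i Suc.prems(2) by (simp add: simple_refl_reverse)
qed

lemma pi_end:
  assumes "k \<le> m" "a < n"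
  obtains e where "e < n" "\<pi> m e = \<pi> k a"
proof -
  have "\<pi> k a \<in> {..<n}" using assms pi_less by simp
  then have "\<pi> k a \<in> \<pi> m ` {..<n}" using permutes_image[OF pi_permutes[OF order_refl]] by simp
  then show ?thesis using that by auto
qed

lemma reversed_bound: "k < m \<Longrightarrow> Suc (i' k) < n"
  using bound[of "m - Suc k"] by (simp add: i'_def)

text \<open>Reducedness survives the half turn, because two strands that leave a crossing in
  exchanged order keep that order up to the right end.\<close>

lemma reversed_asc:
  assumes "k < m"
  shows "pseq i' UNIV k (i' k) < pseq i' UNIV k (Suc (i' k))"
proof -
  let ?c = "m - Suc k"
  have c: "?c < m" "Suc ?c = m - k" using assms by auto
  have i: "Suc (i ?c) < n" "i ?c < n" using bound[OF c(1)] by auto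
  obtain e e' where e: "e < n" "\<pi> m e = \<pi> (m - k) (i ?c)" and e': "e' < n" "\<pi> m e' = \<pi> (m - k) (Suc (i ?c))"
    using pi_end[of "m - k"] i by (metis diff_le_self)
  have 1: "pseq i' UNIV k (Suc (i' k)) = n - Suc e"
    using reversed_perm[of k "i ?c" e] assms e i by (simp add: i'_def Suc_diff_Suc)
  have 2: "pseq i' UNIV k (i' k) = n - Suc e'"
    using reversed_perm[of k "Suc (i ?c)" e'] assms e' i by (simp add: i'_def)
  have "\<pi> (Suc ?c) (i ?c) = \<pi> m e" "\<pi> (Suc ?c) (Suc (i ?c)) = \<pi> m e'" using e e' c by simp_all
  moreover have "\<pi> (Suc ?c) (Suc (i ?c)) < \<pi> (Suc ?c) (i ?c)" using asc[OF c(1)] by simp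
  ultimately have "e < e'"
    using c inversion_mono[of "Suc ?c" m "i ?c" e "Suc (i ?c)" e'] by simp
  then show ?thesis using 1 2 e' by simp
qed

text \<open>The half turn makes a rightmost subexpression leftmost, which in general is not positive
  distinguished. Hence only \<open>mr_word\<close> is instantiated for the rotated data, and the
  unit minors come from \<open>minor_S_initial\<close>, about tails of the original product, in
  place of \<open>minor_G_top\<close>.\<close>

sublocale r: mr_word n m i' J' t'
proof
  show "Suc (i' k) < n" if "k < m" for k using that by (rule reversed_bound)
  show "pseq i' UNIV k (i' k) < pseq i' UNIV k (Suc (i' k))" if "k < m" for k using that by (rule reversed_asc)
  show "t' k \<noteq> 0" if "k < m" "k \<in> J'" for k
    using that t_nonzero[of "m - Suc k"] by (simp add: t'_def J'_def)
qed

lemma reversed_E: "k < m \<Longrightarrow> r.E k = flip n (E (m - Suc k))"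
proof -
  assume k: "k < m"
  have "i' k = n - Suc (Suc (i (m - Suc k)))" "t' k = t (m - Suc k)" "k \<in> J' \<longleftrightarrow> m - Suc k \<in> J"
    by (simp_all add: i'_def t'_def J'_def)
  then show ?thesis using bound[of "m - Suc k"] k by (simp add: r.E_def E_def flip_x_mat flip_sdot)
qed

text \<open>\<open>S k\<close> is the product of the last \<open>m - k\<close> factors of \<open>G m\<close>.\<close>

definition S :: "nat \<Rightarrow> complex mat" where "S k = flip n (r.G (m - k))"

lemma S_last: "S m = 1\<^sub>m n" by (simp add: S_def flip_one)

lemma S_step: "k < m \<Longrightarrow> S k = E k * S (Suc k)"
proof -
  assume k: "k < m"
  have "m - k = Suc (m - Suc k)" using k by simp
  then have "S k = flip n (r.G (m - Suc k) * r.E (m - Suc k))" by (simp add: S_def)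
  also have "\<dots> = flip n (r.E (m - Suc k)) * S (Suc k)"
    unfolding S_def by (rule flip_mult) (auto intro!: r.G_carrier)
  also have "flip n (r.E (m - Suc k)) = E k" using k by (simp add: reversed_E flip_flip)
  finally show ?thesis .
qed

lemma S_carrier [simp]: "S k \<in> carrier_mat n n" by (simp add: S_def)

lemma G_mult_S: "k \<le> m \<Longrightarrow> G k * S k = G m"
proof (induction rule: inc_induct)
  case base
  show ?case unfolding S_last by (rule right_mult_one_mat[OF G_carrier[OF order_refl]])
next
  case (step k)
  then show ?case
    using mult_assoc_mat[OF G_carrier E_carrier S_carrier, of k k "Suc k"] by (simp add: S_step)
qed

lemma flip_reversed_G: "flip n (r.G m) = G m"
proof -
  have "S 0 = G m" using G_mult_S[of 0] S_carrier[of 0] by simp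
  then show ?thesis by (simp add: S_def)
qed

lemma flip_reversed_W: "k \<le> m \<Longrightarrow> W k * flip n (r.W (m - k)) = W m"
proof (induction rule: inc_induct)
  case base
  then show ?case using V_carrier[of m] by (simp add: flip_one)
next
  case (step k)
  have i: "Suc (i k) < n" using bound[OF step(2)] .
  have "m - k = Suc (m - Suc k)" using step by simp
  then have "r.W (m - k) = r.W (m - Suc k) * sdot n (i' (m - Suc k))" by simp
  then have "flip n (r.W (m - k)) = flip n (sdot n (i' (m - Suc k))) * flip n (r.W (m - Suc k))"
    by (simp only:) (rule flip_mult, auto intro!: r.V_carrier[simplified])
  also have "flip n (sdot n (i' (m - Suc k))) = sdot n (i k)"
  proof -
    have "i' (m - Suc k) = n - Suc (Suc (i k))" using step by (simp add: i'_def)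
    moreover have "n - Suc (Suc (n - Suc (Suc (i k)))) = i k" using i by arith
    moreover have "Suc (n - Suc (Suc (i k))) < n" using i by arith
    ultimately show ?thesis by (simp add: flip_sdot)
  qed
  finally have "W k * flip n (r.W (m - k)) = W k * sdot n (i k) * flip n (r.W (m - Suc k))"
    using step V_carrier[of k] by (simp add: mult_assoc_mat[of _ n])
  also have "\<dots> = W (Suc k) * flip n (r.W (m - Suc k))" by simp
  finally show ?case using step by simp
qed

lemma S_factorization:
  assumes "k \<le> m"
  shows "\<exists>X\<in>ord_unip n (int \<circ> \<rho> k). S k = X * transpose_mat (V' k) * V' m"
  using assms
proof (induction rule: inc_induct)
  case base
  then show ?case using v.V_orth'[of m] v.V_carrier[of m]
    by (intro bexI[of _ "1\<^sub>m n"]) (auto simp: S_last one_ord_unip)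
next
  case (step k)
  then obtain X where X: "X \<in> ord_unip n (int \<circ> \<rho> (Suc k))" "S (Suc k) = X * transpose_mat (V' (Suc k)) * V' m"
    by blast
  have k: "k < m" "k \<le> m" and i: "Suc (i k) < n" using step bound by auto
  have Xc: "X \<in> carrier_mat n n" using X(1) by (rule ord_unip_carrier)
  have Vc: "V' k \<in> carrier_mat n n" "V' m \<in> carrier_mat n n"
    by (rule v.V_carrier[OF k(2)], rule v.V_carrier[OF order_refl])
  show ?case
  proof (cases "k \<in> J")
    case True
    have rho: "\<rho> (Suc k) = \<rho> k" and V: "V' (Suc k) = V' k" using True Vc(1) by simp_all
    have "x_mat n (i k) (t k) \<in> ord_unip n (int \<circ> \<rho> k)"
      using asc_all[OF k(1)] i by (intro x_mat_ord_unip) auto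
    moreover have "X \<in> ord_unip n (int \<circ> \<rho> k)" using X(1) unfolding rho .
    moreover have "S k = (x_mat n (i k) (t k) * X) * transpose_mat (V' k) * V' m"
      using S_step[OF k(1)] True Xc Vc unfolding X(2) V by (simp add: E_def mult_assoc_mat[of _ n])
    ultimately show ?thesis using ord_unip_mult[OF inj_int_rho[OF k(2)]] by blast
  next
    case False
    let ?s = "sdot n (i k)"
    have rs: "int \<circ> \<rho> (Suc k) = (int \<circ> \<rho> k) \<circ> simple_refl (i k)" using False by (simp add: fun_eq_iff)
    have "?s * X * transpose_mat ?s \<in> ord_unip n (int \<circ> \<rho> k)"
      using X(1) unfolding rs by (rule sdot_conj_ord_unip(1)) (rule i)
    moreover have "V' (Suc k) = V' k * ?s" using False by simp
    then have "transpose_mat (V' (Suc k)) = transpose_mat ?s * transpose_mat (V' k)"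
      using Vc by (simp add: transpose_mult[of _ n n _ n])
    then have "S k = (?s * X * transpose_mat ?s) * transpose_mat (V' k) * V' m"
      using S_step[OF k(1)] False Xc Vc unfolding X(2) by (simp add: E_def mult_assoc_mat[of _ n])
    ultimately show ?thesis by blast
  qed
qed

lemma minor_S_initial:
  assumes k: "k \<le> m" and h: "h \<le> n"
  shows "minor {..<h} {c. c < n \<and> \<rho> m c \<in> \<rho> k ` {..<h}} (S k) = 1"
proof -
  obtain X where X: "X \<in> ord_unip n (int \<circ> \<rho> k)" "S k = X * transpose_mat (V' k) * V' m"
    using S_factorization[OF k] by blast
  have Xc: "X \<in> carrier_mat n n" using X(1) by (rule ord_unip_carrier)
  have Vc: "V' k \<in> carrier_mat n n" by (rule v.V_carrier[OF k])
  let ?B = "X * transpose_mat (V' k)" and ?T = "\<rho> k ` {..<h}"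
  have inj: "inj (\<rho> k)" by (rule permutes_inj[OF v.pi_permutes[OF k]])
  have T: "?T \<subseteq> {..<n}" using h by (intro image_subsetI) (simp add: v.pi_less[OF k])
  have card: "card {..<h} = card ?T" using inj by (simp add: card_image inj_on_def)
  have hn: "{..<h} \<subseteq> {..<n}" using h by auto
  have Bc: "?B \<in> carrier_mat n n" using Xc Vc by simp
  have "minor {..<h} {c. c < n \<and> \<rho> m c \<in> ?T} (?B * V' m) = minor {..<h} {c. c < n \<and> \<rho> k c \<in> ?T} (?B * V' k)"
  proof (rule v.minor_mult_V[OF Bc hn T card k order_refl])
    fix l assume l: "k \<le> l" "l < m" "l \<in> - J" "\<rho> l (Suc (i l)) \<in> ?T"
    then obtain x where x: "\<rho> l (Suc (i l)) = \<rho> k x" "x < h" by auto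
    obtain y where y: "\<rho> l (i l) = \<rho> k y"
      using permutes_surj[OF v.pi_permutes[OF k]] by (metis surjD)
    \<comment> \<open>\<open>x\<close> and \<open>y\<close> are the heights in column
      \<open>k\<close> of the strands that fall and rise at crossing \<open>l\<close>. With
      \<open>x < y\<close> the pair would already be inverted in column \<open>k\<close> and would
      cross a second time at \<open>l\<close>.\<close>
    have "\<not> x < y"
    proof
      assume "x < y"
      moreover have "\<rho> k y < \<rho> k x" using v.asc[OF l(2,3)] unfolding x(1) y .
      ultimately have "Suc (i l) < i l"
        using l v.inversion_mono[OF l(1) less_imp_le[OF l(2)] x(1)[symmetric] y[symmetric]] by simp
      then show False by simp
    qed
    then show "\<rho> l (i l) \<in> ?T" using x(2) unfolding y by auto
  qed
  also have "{c. c < n \<and> \<rho> k c \<in> ?T} = {..<h}" using h by (auto simp: inj_image_mem_iff[OF inj])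
  also have "?B * V' k = X" using v.V_orth'[OF k] Xc Vc by (simp add: mult_assoc_mat[of _ n])
  also have "minor {..<h} {..<h} X = 1" by (rule minor_principal_ord_unip[OF inj_int_rho[OF k] X(1) hn])
  finally show ?thesis unfolding X(2) .
qed

end


section \<open>Both chamber formulas in terms of diagonal weights\<close>

context mr_pair
begin

lemma chamber_left:
  assumes dot: "dot n v = V' m"
  obtains d where "\<And>j. j < n \<Longrightarrow> d 0 j = (1 :: complex)"
    and "\<And>k j. k \<le> m \<Longrightarrow> j < n \<Longrightarrow> d k j \<noteq> 0"
    and "\<And>k. k < m \<Longrightarrow> d k (i k) = q k * d (Suc k) (Suc (i k))"
    and "\<And>k. k < m \<Longrightarrow> d (Suc k) (i k) = q k * d k (Suc (i k))"
    and "\<And>k j. k < m \<Longrightarrow> j < n \<Longrightarrow> j \<noteq> i k \<Longrightarrow> j \<noteq> Suc (i k) \<Longrightarrow> d (Suc k) j = d k j"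
    and "\<And>k h. k \<le> m \<Longrightarrow> h \<le> n \<Longrightarrow>
      minor (\<pi> k ` {h..<n}) (\<rho> k ` {h..<n})
        (right_unip n (W m * transpose_mat (cap_rep n v (G m)))) = (\<Prod>j\<in>{h..<n}. d k j)"
proof -
  have Vc: "V' m \<in> carrier_mat n n" "det (V' m) = 1"
    by (rule v.V_carrier[OF order_refl], rule v.det_V[OF order_refl])
  have Wc: "W m \<in> carrier_mat n n" by (rule V_carrier[OF order_refl])
  obtain a l where al: "a \<in> ord_unip n int" "a \<in> ord_unip n (int \<circ> \<rho> m)" "l \<in> ord_unip n lower"
    "G m = V' m * a * l"
    using G_factorization[OF order_refl] by blast
  have l: "l \<in> ord_borel n lower" by (rule ord_unip_borel[OF inj_lower al(3)])
  obtain a' where a': "a' \<in> ord_unip n int" "V' m * a = a' * V' m"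
    using v.V_move_left[OF order_refl al(2)] by blast
  have cap: "cap_rep n v (G m) = V' m * a"
    using cap_rep_eq[of n v a a' l "G m"] Vc al a' l by (simp only: dot Unip_eq Borel_minus_eq)
  obtain c where c: "c \<in> ord_borel n lower" "l * c = 1\<^sub>m n" "c * l = 1\<^sub>m n"
    by (rule ord_borel_inverse[OF inj_lower l])
  have car: "a \<in> carrier_mat n n" "l \<in> carrier_mat n n" "c \<in> carrier_mat n n"
    using al(1) l c(1) by (simp_all add: ord_unip_carrier ord_borel_carrier)
  have "G m * c = V' m * a * (l * c)" unfolding al(4) using Vc car by (simp add: mult_assoc_mat[of _ n])
  then have cap': "cap_rep n v (G m) = G m * c" unfolding cap c(2) using Vc car by simp
  \<comment> \<open>The factorization starts from \<open>G m * c\<close> because \<open>y\<close> is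
    defined through \<open>g_cap\<close>, whereas the resulting coset relation
    \<open>Z * W m = G m * b\<close> again involves only \<open>G m\<close>.\<close>
  obtain Z U b where f: "Z \<in> ord_unip n lower" "U \<in> ord_borel n int" "b \<in> ord_borel n lower"
    "G m * c = Z * U * W m" "Z * W m = G m * b"
    by (rule opposite_factorization[OF c(1)])
  have Zc: "Z \<in> carrier_mat n n" "U \<in> carrier_mat n n"
    using f(1,2) by (simp_all add: ord_unip_carrier ord_borel_carrier)
  \<comment> \<open>Transposition puts \<open>U\<close> into \<open>B_-\<close> and \<open>Z\<close>
    into \<open>N\<close>, and the transpose of the orthogonal \<open>W m\<close> cancels against
    \<open>W m\<close>. What remains is the factorization that defines
    \<open>right_unip\<close>.\<close>
  have "transpose_mat (Z * U * W m) = transpose_mat (W m) * (transpose_mat U * transpose_mat Z)"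
    using Zc Wc by (simp add: transpose_mult[of _ n n _ n])
  then have "W m * transpose_mat (G m * c) = W m * transpose_mat (W m) * (transpose_mat U * transpose_mat Z)"
    unfolding f(4) using Zc Wc by (simp add: mult_assoc_mat[of _ n])
  also have "\<dots> = transpose_mat U * transpose_mat Z"
    unfolding V_orth[OF order_refl] using Zc by simp
  finally have eq: "W m * transpose_mat (cap_rep n v (G m)) = transpose_mat U * transpose_mat Z"
    unfolding cap' .
  have y: "right_unip n (W m * transpose_mat (cap_rep n v (G m))) = transpose_mat Z"
    unfolding eq
    by (rule right_unip_eq[of _ _ "transpose_mat U"])
      (use transpose_ord_unip[OF f(1)] transpose_ord_borel[OF f(2)] in \<open>simp_all add: Unip_eq Borel_minus_eq\<close>)
  obtain d where d: "\<And>j. j < n \<Longrightarrow> d 0 j = (1 :: complex)"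
    "\<And>k j. k \<le> m \<Longrightarrow> j < n \<Longrightarrow> d k j \<noteq> 0"
    "\<And>k. k < m \<Longrightarrow> d k (i k) = q k * d (Suc k) (Suc (i k))"
    "\<And>k. k < m \<Longrightarrow> d (Suc k) (i k) = q k * d k (Suc (i k))"
    "\<And>k j. k < m \<Longrightarrow> j < n \<Longrightarrow> j \<noteq> i k \<Longrightarrow> j \<noteq> Suc (i k) \<Longrightarrow> d (Suc k) j = d k j"
    "\<And>k h R. k \<le> m \<Longrightarrow> R \<subseteq> {..<n} \<Longrightarrow> card R = n - h \<Longrightarrow>
      minor R (\<pi> k ` {h..<n}) Z = minor R {h..<n} (G k) * (\<Prod>j\<in>{h..<n}. d k j)"
    by (rule chamber_minors[OF f(1,3,5)]) blast
  show ?thesis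
  proof (rule that[of d])
    fix k h assume k: "k \<le> m" and h: "h \<le> n"
    have R: "\<pi> k ` {h..<n} \<subseteq> {..<n}" "\<rho> k ` {h..<n} \<subseteq> {..<n}"
      by (rule image_subsetI, simp add: pi_less[OF k], rule image_subsetI, simp add: v.pi_less[OF k])
    have card: "card (\<rho> k ` {h..<n}) = n - h" "card (\<pi> k ` {h..<n}) = n - h"
      using card_image[OF inj_on_subset[OF permutes_inj[OF v.pi_permutes[OF k]] subset_UNIV]]
        card_image[OF inj_on_subset[OF permutes_inj[OF pi_permutes[OF k]] subset_UNIV]] by simp_all
    have "minor (\<pi> k ` {h..<n}) (\<rho> k ` {h..<n}) (transpose_mat Z) = minor (\<rho> k ` {h..<n}) (\<pi> k ` {h..<n}) Z"
      by (rule minor_transpose[OF Zc(1) R(2) R(1)]) (simp only: card)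
    also have "\<dots> = (\<Prod>j\<in>{h..<n}. d k j)"
      using d(6)[OF k R(2) card(1)] minor_G_top[OF k h] by simp
    finally show "minor (\<pi> k ` {h..<n}) (\<rho> k ` {h..<n})
        (right_unip n (W m * transpose_mat (cap_rep n v (G m)))) = (\<Prod>j\<in>{h..<n}. d k j)"
      unfolding y .
  qed (fact d)+
qed

lemma chamber_right:
  obtains d where "\<And>j. j < n \<Longrightarrow> d m j = (1 :: complex)"
    and "\<And>k j. k \<le> m \<Longrightarrow> j < n \<Longrightarrow> d k j \<noteq> 0"
    and "\<And>k. k < m \<Longrightarrow> d k (Suc (i k)) = q k * d (Suc k) (i k)"
    and "\<And>k. k < m \<Longrightarrow> d (Suc k) (Suc (i k)) = q k * d k (i k)"
    and "\<And>k j. k < m \<Longrightarrow> j < n \<Longrightarrow> j \<noteq> i k \<Longrightarrow> j \<noteq> Suc (i k) \<Longrightarrow> d (Suc k) j = d k j"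
    and "\<And>k h. k \<le> m \<Longrightarrow> h \<le> n \<Longrightarrow>
      minor {c. c < n \<and> \<rho> m c \<in> \<rho> k ` {..<h}} {c. c < n \<and> \<pi> m c \<in> \<pi> k ` {..<h}}
        (left_unip n (transpose_mat (G m) * W m)) = (\<Prod>j<h. d k j)"
proof -
  have Wc: "W m \<in> carrier_mat n n" by (rule V_carrier[OF order_refl])
  have rc: "r.G m \<in> carrier_mat n n" "r.W m \<in> carrier_mat n n"
    by (rule r.G_carrier[OF order_refl], rule r.V_carrier[OF order_refl])
  obtain Z U b where f: "Z \<in> ord_unip n lower" "U \<in> ord_borel n int" "b \<in> ord_borel n lower"
    "r.G m * 1\<^sub>m n = Z * U * r.W m" "Z * r.W m = r.G m * b"
    by (rule r.opposite_factorization[OF one_ord_borel])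
  have Zc: "Z \<in> carrier_mat n n" "U \<in> carrier_mat n n"
    using f(1,2) by (simp_all add: ord_unip_carrier ord_borel_carrier)
  have W0: "flip n (r.W m) = W m" using flip_reversed_W[of 0] by simp
  have "flip n (r.G m) = flip n (Z * U * r.W m)" using f(4) rc by simp
  also have "\<dots> = flip n (r.W m) * (flip n U * flip n Z)"
    using Zc rc by (simp only: flip_mult square_mult_carrier)
  finally have "G m = W m * (flip n U * flip n Z)"
    unfolding flip_reversed_G W0 .
  then have "transpose_mat (G m) = transpose_mat (flip n U * flip n Z) * transpose_mat (W m)"
    using transpose_mult[OF Wc, of "flip n U * flip n Z" n] by simp
  also have "transpose_mat (flip n U * flip n Z) = transpose_mat (flip n Z) * transpose_mat (flip n U)"
    by (rule transpose_mult[of _ n n _ n]) auto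
  finally have "transpose_mat (G m) * W m =
      transpose_mat (flip n Z) * transpose_mat (flip n U) * (transpose_mat (W m) * W m)"
    using Wc by (simp add: mult_assoc_mat[of _ n])
  then have eq: "transpose_mat (G m) * W m = transpose_mat (flip n Z) * transpose_mat (flip n U)"
    unfolding V_orth'[OF order_refl]
    using right_mult_one_mat[OF square_mult_carrier, of "transpose_mat (flip n Z)" n "transpose_mat (flip n U)"]
    by simp
  define y where "y = transpose_mat (flip n Z)"
  have y: "left_unip n (transpose_mat (G m) * W m) = y"
    unfolding eq y_def
    by (rule left_unip_eq[of _ _ "transpose_mat (flip n U)"])
      (use transpose_ord_unip[OF flip_ord_unip_lower[OF f(1)]] transpose_ord_borel[OF flip_ord_borel_int[OF f(2)]]
        in \<open>simp_all add: Unip_eq Borel_minus_eq\<close>)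
  have yc: "y \<in> carrier_mat n n" by (simp add: y_def)
  \<comment> \<open>The flip followed by a transposition only reverses the order of rows and
    columns, so minors of \<open>y\<close> are minors of \<open>Z\<close> with reflected index
    sets.\<close>
  have Zy: "mat n n (\<lambda>(r, c). y $$ (n - Suc r, n - Suc c)) = Z"
    using Zc by (intro eq_matI) (auto simp: y_def flip_nth)
  let ?P = "\<lambda>a. n - Suc a"
  obtain d where d: "\<And>j. j < n \<Longrightarrow> d 0 j = (1 :: complex)"
    "\<And>k j. k \<le> m \<Longrightarrow> j < n \<Longrightarrow> d k j \<noteq> 0"
    "\<And>k. k < m \<Longrightarrow> d k (i' k) = r.q k * d (Suc k) (Suc (i' k))"
    "\<And>k. k < m \<Longrightarrow> d (Suc k) (i' k) = r.q k * d k (Suc (i' k))"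
    "\<And>k j. k < m \<Longrightarrow> j < n \<Longrightarrow> j \<noteq> i' k \<Longrightarrow> j \<noteq> Suc (i' k) \<Longrightarrow> d (Suc k) j = d k j"
    "\<And>k h R. k \<le> m \<Longrightarrow> R \<subseteq> {..<n} \<Longrightarrow> card R = n - h \<Longrightarrow>
      minor R (pseq i' UNIV k ` {h..<n}) Z = minor R {h..<n} (r.G k) * (\<Prod>j\<in>{h..<n}. d k j)"
    by (rule r.chamber_minors[OF f(1,3,5)]) blast
  \<comment> \<open>The weights of the rotated diagram, carried back by the half turn. The rising
    and the falling strand exchange roles, which explains the positions of \<open>i k\<close> and
    \<open>Suc (i k)\<close> in the recursion for \<open>e\<close>.\<close>
  define e where "e = (\<lambda>k j. d (m - k) (n - Suc j))"
  have rev: "i' (m - Suc k) = n - Suc (Suc (i k))" "r.q (m - Suc k) = q k"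
    "Suc (i' (m - Suc k)) = n - Suc (i k)" "Suc (m - Suc k) = m - k" if "k < m" for k
  proof -
    have "Suc (i k) < n" by (rule bound[OF that])
    then show "i' (m - Suc k) = n - Suc (Suc (i k))" "Suc (i' (m - Suc k)) = n - Suc (i k)"
      using that by (simp_all add: i'_def)
    have "m - Suc k \<in> J' \<longleftrightarrow> k \<in> J" "t' (m - Suc k) = t k"
      using that by (simp_all add: J'_def t'_def)
    then show "r.q (m - Suc k) = q k" by (simp add: r.q_def q_def)
    show "Suc (m - Suc k) = m - k" using that by simp
  qed
  have aux: "Suc (n - Suc (Suc (i k))) = n - Suc (i k)" if "k < m" for k
    using bound[OF that] by arith
  show ?thesis
  proof (rule that[of e])
    show "e m j = 1" if "j < n" for j using d(1) that by (simp add: e_def)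
    show "e k j \<noteq> 0" if "k \<le> m" "j < n" for k j using d(2) that by (simp add: e_def)
    show "e k (Suc (i k)) = q k * e (Suc k) (i k)" if "k < m" for k
      using d(4)[of "m - Suc k"] that unfolding rev[OF that] by (simp add: e_def aux)
    show "e (Suc k) (Suc (i k)) = q k * e k (i k)" if "k < m" for k
      using d(3)[of "m - Suc k"] that unfolding rev[OF that] by (simp add: e_def aux)
    show "e (Suc k) j = e k j" if "k < m" "j < n" "j \<noteq> i k" "j \<noteq> Suc (i k)" for k j
    proof -
      have "Suc (i k) < n" by (rule bound[OF that(1)])
      then have "?P j \<noteq> ?P (Suc (i k))" "?P j \<noteq> ?P (i k)" "?P j < n" using that by auto
      then show ?thesis
        using d(5)[of "m - Suc k" "?P j"] that(1) unfolding rev[OF that(1)] by (simp add: e_def aux)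
    qed
    fix k h assume k: "k \<le> m" and h: "h \<le> n"
    let ?I = "{c. c < n \<and> \<rho> m c \<in> \<rho> k ` {..<h}}" and ?K = "{c. c < n \<and> \<pi> m c \<in> \<pi> k ` {..<h}}"
    have hn: "{..<h} \<subseteq> {..<n}" using h by auto
    have card: "card {c. c < n \<and> u c \<in> u' ` {..<h}} = h"
      if u: "u permutes {..<n}" "u' permutes {..<n}" for u u'
    proof -
      have sub: "u' ` {..<h} \<subseteq> u ` {..<n}"
        unfolding permutes_image[OF u(1)] using image_mono[OF hn, of u'] unfolding permutes_image[OF u(2)] .
      have "u ` {c. c < n \<and> u c \<in> u' ` {..<h}} = u' ` {..<h}"
      proof (intro subset_antisym subsetI)
        fix x assume x: "x \<in> u' ` {..<h}"
        then obtain c where "c < n" "x = u c" using sub by blast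
        then show "x \<in> u ` {c. c < n \<and> u c \<in> u' ` {..<h}}" using x by blast
      qed blast
      then have "card {c. c < n \<and> u c \<in> u' ` {..<h}} = card (u' ` {..<h})"
        using card_image[OF inj_on_subset[OF permutes_inj[OF u(1)] subset_UNIV],
            of "{c. c < n \<and> u c \<in> u' ` {..<h}}"] by (simp only:)
      also have "\<dots> = h" using card_image[OF inj_on_subset[OF permutes_inj[OF u(2)] subset_UNIV]] by simp
      finally show ?thesis .
    qed
    have cI: "card ?I = h" by (rule card[OF v.pi_permutes[OF order_refl] v.pi_permutes[OF k]])
    have cK: "card ?K = h" by (rule card[OF pi_permutes[OF order_refl] pi_permutes[OF k]])
    have sub: "?I \<subseteq> {..<n}" "?K \<subseteq> {..<n}" by auto
    have injP: "inj_on ?P {..<n}" by (auto simp: inj_on_def)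
    have PIs: "?P ` ?I \<subseteq> {..<n}" by auto
    have PIc: "card (?P ` ?I) = n - (n - h)"
      using card_image[OF inj_on_subset[OF injP sub(1)]] cI h by simp
    have Ph: "?P ` {..<h} = {n - h..<n}"
    proof (intro subset_antisym subsetI)
      fix x assume "x \<in> {n - h..<n}"
      then show "x \<in> ?P ` {..<h}" using h by (intro image_eqI[of _ _ "?P x"]) auto
    qed (use h in auto)
    \<comment> \<open>Right endpoints of the strands below height \<open>h\<close> in column
      \<open>k\<close> become, after the half turn, left endpoints of the strands at heights from
      \<open>n - h\<close> on in column \<open>m - k\<close>.\<close>
    have PK: "?P ` ?K = pseq i' UNIV (m - k) ` {n - h..<n}"
    proof (intro subset_antisym subsetI)
      fix x assume "x \<in> ?P ` ?K"
      then obtain c a where ca: "x = ?P c" "c < n" "a < h" "\<pi> m c = \<pi> k a" by auto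
      then have "pseq i' UNIV (m - k) (?P a) = ?P c"
        using reversed_perm[of "m - k" a c] k h by simp
      then show "x \<in> pseq i' UNIV (m - k) ` {n - h..<n}"
        unfolding Ph[symmetric] ca(1) using ca(3) by force
    next
      fix x assume "x \<in> pseq i' UNIV (m - k) ` {n - h..<n}"
      then obtain a where a: "a < h" "x = pseq i' UNIV (m - k) (?P a)" unfolding Ph[symmetric] by auto
      have "a < n" using a h by simp
      then obtain c where c: "c < n" "\<pi> m c = \<pi> k a" using pi_end[OF k] by metis
      have "x = ?P c" unfolding a(2) using reversed_perm[of "m - k" a c] k \<open>a < n\<close> c by simp
      then show "x \<in> ?P ` ?K" using c a by auto
    qed
    have rk: "m - k \<le> m" by simp
    have Sk: "S k \<in> carrier_mat n n" by simp
    have rG: "r.G (m - k) \<in> carrier_mat n n" by (rule r.G_carrier[OF rk])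
    have "minor ?I ?K y = minor (?P ` ?I) (?P ` ?K) Z"
      using minor_reverse[OF yc sub] cI cK unfolding Zy by simp
    also have "\<dots> = minor (?P ` ?I) {n - h..<n} (r.G (m - k)) * (\<Prod>j\<in>{n - h..<n}. d (m - k) j)"
      unfolding PK by (rule d(6)[OF rk PIs PIc])
    \<comment> \<open>Up to a reflection of the indices and a transposition, the rotated partial
      product is the tail \<open>S k\<close>.\<close>
    also have "minor (?P ` ?I) {n - h..<n} (r.G (m - k)) = 1"
    proof -
      have "r.G (m - k) = mat n n (\<lambda>(r, c). transpose_mat (S k) $$ (n - Suc r, n - Suc c))"
        using carrier_matD[OF rG] by (intro eq_matI) (auto simp: S_def flip_nth)
      then have "minor (?P ` ?I) {n - h..<n} (r.G (m - k)) = minor ?I {..<h} (transpose_mat (S k))"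
        using minor_reverse[of "transpose_mat (S k)" n ?I "{..<h}"] sub(1) hn cI unfolding Ph by simp
      also have "\<dots> = minor {..<h} ?I (S k)"
        using cI by (intro minor_transpose[OF Sk hn sub(1)]) simp
      also have "\<dots> = 1" by (rule minor_S_initial[OF k h])
      finally show ?thesis .
    qed
    also have "(\<Prod>j\<in>{n - h..<n}. d (m - k) j) = (\<Prod>j<h. e k j)"
      unfolding Ph[symmetric] e_def
      by (subst prod.reindex) (use inj_on_subset[OF injP hn] in auto)
    finally show "minor ?I ?K (left_unip n (transpose_mat (G m) * W m)) = (\<Prod>j<h. e k j)"
      unfolding y by simp
  qed
qed

end

section \<open>Weights multiplied along strands\<close>

primrec path :: "(nat \<Rightarrow> nat) \<Rightarrow> nat \<Rightarrow> nat \<Rightarrow> nat" where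
  "path i x 0 = x"
| "path i x (Suc k) = simple_refl (i k) (path i x k)"

lemma prod_if_eq:
  assumes "finite A"
  shows "(\<Prod>x\<in>A. if x = a then f else (1::'a::comm_monoid_mult)) = (if a \<in> A then f else 1)"
  using assms by simp

context mr_word
begin

abbreviation "st \<equiv> path i"
text \<open>\<open>lo r\<close> and \<open>hi r\<close> are the left endpoints of the strands that
  rise and fall at crossing \<open>r\<close>.\<close>

abbreviation "lo r \<equiv> \<pi> r (i r)"
abbreviation "hi r \<equiv> \<pi> r (Suc (i r))"

lemma strand_perm:
  assumes k: "k \<le> m"
  shows "\<pi> k (st x k) = x"
  using assms by (induction k) simp_all

text \<open>Otherwise the pair would be inverted in column \<open>k\<close>, hence still inverted in
  column \<open>r\<close>, where \<open>lo r\<close> sits at height \<open>i r\<close> and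
  \<open>hi r\<close> directly above it.\<close>

lemma strand_before:
  assumes r: "r < m" "k \<le> r"
  shows "st (lo r) k < st (hi r) k"
proof (rule ccontr)
  note p = strand_perm
  have km: "k \<le> m" using r by simp
  have up: "lo r < hi r" using asc[OF r(1)] by simp
  assume "\<not> ?thesis"
  moreover have "st (lo r) k \<noteq> st (hi r) k" using p[OF km, of "lo r"] p[OF km, of "hi r"] up by auto
  ultimately have "st (hi r) k < st (lo r) k" by simp
  then have "Suc (i r) < i r"
    using inversion_mono[OF r(2) less_imp_le[OF r(1)], of "st (hi r) k" "Suc (i r)" "st (lo r) k" "i r"]
      p[OF km] up by simp
  then show False by simp
qed

lemma strand_after:
  assumes r: "r < k" "k \<le> m"
  shows "st (hi r) k < st (lo r) k"
proof -
  note p = strand_perm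
  have up: "lo r < hi r" using asc[of r] r by simp
  show ?thesis
    using inversion_mono[of "Suc r" k "i r" "st (hi r) k" "Suc (i r)" "st (lo r) k"] r p[OF r(2)] up by simp
qed

lemma strand_bij:
  assumes k: "k \<le> m"
  shows "(\<Prod>j\<in>{j. j < n \<and> Q j}. f j) = (\<Prod>x\<in>{x. x < n \<and> Q (st x k)}. f (st x k))"
proof -
  note p = strand_perm[OF k]
  have st_pi: "st (\<pi> k j) k = j" for j using p[of "\<pi> k j"] k by (simp add: pi_inj)
  have st_n: "st x k < n \<longleftrightarrow> x < n" for x using p[of x] pi_less[OF k, of "st x k"] by simp
  show ?thesis
    by (rule prod.reindex_bij_witness[of _ "\<lambda>x. st x k" "\<pi> k"])
      (simp_all add: st_pi st_n p pi_less[OF k])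
qed

lemma strand_at:
  assumes k: "k < m"
  shows "st x k = i k \<longleftrightarrow> x = lo k" "st x k = Suc (i k) \<longleftrightarrow> x = hi k"
  using strand_perm[OF less_imp_le[OF k], of x] pi_inj[OF less_imp_le[OF k], of "st x k"] by auto

lemma lo_hi: "r < m \<Longrightarrow> lo r < n" "r < m \<Longrightarrow> hi r < n" "r < m \<Longrightarrow> lo r \<noteq> hi r"
  using bound[of r] asc[of r] by (auto simp: pi_less)

text \<open>The weights of the strands are regrouped by crossings. A crossing with both strands in
  \<open>Q\<close> contributes \<open>inverse (q r) * q r\<close>, one with neither contributes 1.
  The hypothesis excludes that only the falling strand is in \<open>Q\<close>, so what remains is
  one inverse for each crossing whose strands \<open>Q\<close> separates.\<close>

lemma weight_swap:
  assumes C: "\<And>r. r \<in> A \<Longrightarrow> r < m \<and> (Q (hi r) \<longrightarrow> Q (lo r))"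
    and fin: "finite A"
  shows "(\<Prod>x\<in>{x. x < n \<and> Q x}. \<Prod>r\<in>A. if x = lo r then inverse (q r) else if x = hi r then q r else 1)
    = (\<Prod>r\<in>A. if Q (lo r) \<and> \<not> Q (hi r) then inverse (q r) else 1)"
proof -
  have "(\<Prod>x\<in>{x. x < n \<and> Q x}. \<Prod>r\<in>A. if x = lo r then inverse (q r) else if x = hi r then q r else 1)
    = (\<Prod>r\<in>A. \<Prod>x\<in>{x. x < n \<and> Q x}. if x = lo r then inverse (q r) else if x = hi r then q r else 1)"
    by (rule prod.swap)
  also have "\<dots> = (\<Prod>r\<in>A. if Q (lo r) \<and> \<not> Q (hi r) then inverse (q r) else 1)"
  proof (rule prod.cong[OF refl])
    fix r assume r: "r \<in> A"
    have qnz: "q r \<noteq> 0" using C[OF r] t_nonzero by (auto simp: q_def)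
    have ne: "lo r \<noteq> hi r" "lo r < n" "hi r < n" using C[OF r] lo_hi by auto
    have "(\<Prod>x\<in>{x. x < n \<and> Q x}. if x = lo r then inverse (q r) else if x = hi r then q r else 1)
      = (\<Prod>x\<in>{x. x < n \<and> Q x}. (if x = lo r then inverse (q r) else 1) * (if x = hi r then q r else 1))"
      using ne by (intro prod.cong) auto
    also have "\<dots> = (if Q (lo r) then inverse (q r) else 1) * (if Q (hi r) then q r else 1)"
      using ne by (simp add: prod.distrib prod_if_eq)
    also have "\<dots> = (if Q (lo r) \<and> \<not> Q (hi r) then inverse (q r) else 1)"
      using C[OF r] qnz by auto
    finally show "(\<Prod>x\<in>{x. x < n \<and> Q x}. if x = lo r then inverse (q r) else if x = hi r then q r else 1)
      = (if Q (lo r) \<and> \<not> Q (hi r) then inverse (q r) else 1)" .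
  qed
  finally show ?thesis .
qed

lemma q_to_t:
  assumes "finite A" "\<And>r. r \<in> A \<Longrightarrow> r < m"
  shows "(\<Prod>r\<in>A. if P r then inverse (q r) else 1) = (\<Prod>r\<in>{r \<in> A. r \<in> J \<and> P r}. inverse (t r))"
proof -
  have "(\<Prod>r\<in>A. if P r then inverse (q r) else 1) = (\<Prod>r\<in>A. if r \<in> J \<and> P r then inverse (t r) else 1)"
    by (intro prod.cong) (auto simp: q_def)
  then show ?thesis using assms(1) by (simp add: prod.If_cases Int_def conj_commute)
qed

lemma left_weights_prod:
  assumes d0: "\<And>j. j < n \<Longrightarrow> d 0 j = (1 :: complex)"
    and d1: "\<And>k. k < m \<Longrightarrow> d k (i k) = q k * d (Suc k) (Suc (i k))"
    and d2: "\<And>k. k < m \<Longrightarrow> d (Suc k) (i k) = q k * d k (Suc (i k))"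
    and d3: "\<And>k j. k < m \<Longrightarrow> j < n \<Longrightarrow> j \<noteq> i k \<Longrightarrow> j \<noteq> Suc (i k) \<Longrightarrow> d (Suc k) j = d k j"
    and k: "k \<le> m"
  shows "(\<Prod>j\<in>{h..<n}. d k j) =
    (\<Prod>r\<in>{r. r < m \<and> r \<in> J \<and> st (hi r) k < h \<and> h \<le> st (lo r) k}. inverse (t r))"
proof -
  note p = strand_perm
  have qnz: "q r \<noteq> 0" if "r < m" for r using that t_nonzero by (auto simp: q_def)
  \<comment> \<open>The recursion telescopes along the strand with left endpoint \<open>x\<close>,
    starting from weight 1 in column 0.\<close>
  have w: "d k (st x k) = (\<Prod>r<k. if x = lo r then inverse (q r) else if x = hi r then q r else 1)"
    if x: "x < n" for x
    using k
  proof (induction k)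
    case 0
    then show ?case using d0 x by simp
  next
    case (Suc k)
    then have km: "k < m" by simp
    have stn: "st x k < n" using p[of k x] pi_less[of k "st x k"] km x by simp
    have "d (Suc k) (st x (Suc k)) =
       d k (st x k) * (if x = lo k then inverse (q k) else if x = hi k then q k else 1)"
      unfolding strand_at[OF km, symmetric]
      using d1[OF km] d2[OF km] d3[OF km stn] qnz[OF km]
      by (cases "st x k = i k"; cases "st x k = Suc (i k)") (simp_all add: field_simps)
    then show ?case using Suc by simp
  qed
  have "(\<Prod>j\<in>{h..<n}. d k j) = (\<Prod>j\<in>{j. j < n \<and> h \<le> j}. d k j)"
    by (rule prod.cong) auto
  also have "\<dots> = (\<Prod>x\<in>{x. x < n \<and> h \<le> st x k}. d k (st x k))"
    by (rule strand_bij[OF k])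
  also have "\<dots> = (\<Prod>x\<in>{x. x < n \<and> h \<le> st x k}. \<Prod>r<k. if x = lo r then inverse (q r) else if x = hi r then q r else 1)"
    by (rule prod.cong) (auto simp: w)
  also have "\<dots> = (\<Prod>r<k. if h \<le> st (lo r) k \<and> \<not> h \<le> st (hi r) k then inverse (q r) else 1)"
    by (rule weight_swap) (use strand_after[OF _ k] k in force)+
  also have "\<dots> = (\<Prod>r\<in>{r \<in> {..<k}. r \<in> J \<and> h \<le> st (lo r) k \<and> \<not> h \<le> st (hi r) k}. inverse (t r))"
    using k by (intro q_to_t) auto
  also have "{r \<in> {..<k}. r \<in> J \<and> h \<le> st (lo r) k \<and> \<not> h \<le> st (hi r) k} =
      {r. r < m \<and> r \<in> J \<and> st (hi r) k < h \<and> h \<le> st (lo r) k}"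
    using k strand_before by (force simp: not_le)
  finally show ?thesis .
qed

text \<open>The weights are now 1 at the right end and telescope to the left, so the crossings from
  column \<open>k\<close> on contribute, and \<open>strand_before\<close> takes the place of
  \<open>strand_after\<close>.\<close>

lemma right_weights_prod:
  assumes d0: "\<And>j. j < n \<Longrightarrow> d m j = (1 :: complex)"
    and d1: "\<And>k. k < m \<Longrightarrow> d k (Suc (i k)) = q k * d (Suc k) (i k)"
    and d2: "\<And>k. k < m \<Longrightarrow> d (Suc k) (Suc (i k)) = q k * d k (i k)"
    and d3: "\<And>k j. k < m \<Longrightarrow> j < n \<Longrightarrow> j \<noteq> i k \<Longrightarrow> j \<noteq> Suc (i k) \<Longrightarrow> d (Suc k) j = d k j"
    and k: "k \<le> m" and h: "h \<le> n"
  shows "(\<Prod>j<h. d k j) =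
    (\<Prod>r\<in>{r. r < m \<and> r \<in> J \<and> st (lo r) k < h \<and> h \<le> st (hi r) k}. inverse (t r))"
proof -
  note p = strand_perm
  have qnz: "q r \<noteq> 0" if "r < m" for r using that t_nonzero by (auto simp: q_def)
  have w: "d k (st x k) = (\<Prod>r\<in>{k..<m}. if x = lo r then inverse (q r) else if x = hi r then q r else 1)"
    if x: "x < n" for x
    using k
  proof (induction rule: inc_induct)
    case base
    have "st x m < n" using p[of m x] pi_less[of m "st x m"] x by simp
    then show ?case using d0 by simp
  next
    case (step k)
    then have km: "k < m" by simp
    have stn: "st x k < n" using p[of k x] pi_less[of k "st x k"] km x by simp
    have "d k (st x k) =
       (if x = lo k then inverse (q k) else if x = hi k then q k else 1) * d (Suc k) (st x (Suc k))"
      unfolding strand_at[OF km, symmetric]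
      using d1[OF km] d2[OF km] d3[OF km stn] qnz[OF km]
      by (cases "st x k = i k"; cases "st x k = Suc (i k)") (simp_all add: field_simps)
    then show ?case using step by (simp add: prod.atLeast_Suc_lessThan)
  qed
  have "(\<Prod>j<h. d k j) = (\<Prod>j\<in>{j. j < n \<and> j < h}. d k j)"
    using h by (intro prod.cong) auto
  also have "\<dots> = (\<Prod>x\<in>{x. x < n \<and> st x k < h}. d k (st x k))"
    by (rule strand_bij[OF k])
  also have "\<dots> = (\<Prod>x\<in>{x. x < n \<and> st x k < h}. \<Prod>r\<in>{k..<m}. if x = lo r then inverse (q r) else if x = hi r then q r else 1)"
    by (rule prod.cong) (auto simp: w)
  also have "\<dots> = (\<Prod>r\<in>{k..<m}. if st (lo r) k < h \<and> \<not> st (hi r) k < h then inverse (q r) else 1)"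
    by (rule weight_swap) (use strand_before in force)+
  also have "\<dots> = (\<Prod>r\<in>{r \<in> {k..<m}. r \<in> J \<and> st (lo r) k < h \<and> \<not> st (hi r) k < h}. inverse (t r))"
    by (intro q_to_t) auto
  also have "{r \<in> {k..<m}. r \<in> J \<and> st (lo r) k < h \<and> \<not> st (hi r) k < h} =
      {r. r < m \<and> r \<in> J \<and> st (lo r) k < h \<and> h \<le> st (hi r) k}"
    using k strand_after[OF _ k] by (force simp: not_le not_less)
  finally show ?thesis .
qed

end


section \<open>Reduced words and Bruhat order\<close>

lemma word_perm_simps [simp]:
  "word_perm [] = id" "word_perm (i # ws) = simple_refl i \<circ> word_perm ws"
  by (simp_all add: word_perm_def)

lemma word_perm_append: "word_perm (xs @ ys) = word_perm xs \<circ> word_perm ys"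
  by (induction xs) (auto simp: comp_assoc)

lemma pseq_word: "k \<le> length ws \<Longrightarrow> pseq (\<lambda>k. ws ! k) UNIV k = word_perm (take k ws)"
  by (induction k) (simp_all add: take_Suc_conv_app_nth word_perm_append)

lemma is_word_permutes: "is_word n ws u \<Longrightarrow> u permutes {..<n}"
proof (induction ws arbitrary: u)
  case Nil
  then have "u = id" by (simp only: is_word_def word_perm_simps)
  then show ?case by (simp only: permutes_id)
next
  case (Cons i ws)
  then have "is_word n ws (word_perm ws)" "u = simple_refl i \<circ> word_perm ws" "Suc i < n"
    by (auto simp: is_word_def)
  then show ?case using permutes_compose[OF Cons.IH simple_refl_permutes] by blast
qed

lemma is_word_append: "is_word n xs u \<Longrightarrow> is_word n ys u' \<Longrightarrow> is_word n (xs @ ys) (u \<circ> u')"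
  by (auto simp: is_word_def word_perm_append)

lemma transposition_word:
  assumes "a < b" "b < n"
  shows "\<exists>ws. is_word n ws (Transposition.transpose a b)"
  using assms
proof (induction b)
  case (Suc b)
  show ?case
  proof (cases "a = b")
    case True
    then show ?thesis using Suc by (intro exI[of _ "[b]"]) (simp add: is_word_def simple_refl_def)
  next
    case False
    then obtain ws where "is_word n ws (Transposition.transpose a b)" using Suc by auto
    moreover have s: "is_word n [b] (simple_refl b)" using Suc by (simp add: is_word_def)
    ultimately have "is_word n ([b] @ ws @ [b]) (simple_refl b \<circ> (Transposition.transpose a b \<circ> simple_refl b))"
      by (intro is_word_append)
    moreover have "simple_refl b \<circ> (Transposition.transpose a b \<circ> simple_refl b) = Transposition.transpose a (Suc b)"
      using False Suc by (auto simp: fun_eq_iff simple_refl_def Transposition.transpose_def)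
    ultimately show ?thesis by auto
  qed
qed simp

lemma permutation_word:
  assumes "u permutes {..<n}"
  shows "\<exists>ws. is_word n ws u"
  using assms finite_lessThan[of n]
proof (induction rule: permutes_induct)
  case id
  show ?case by (intro exI[of _ "[]"]) (simp only: is_word_def word_perm_simps list.set ball_empty)
next
  case (swap a b p)
  then obtain ws where ws: "is_word n ws p" by auto
  have "\<exists>ws. is_word n ws (Transposition.transpose a b)"
    using transposition_word[of a b n] transposition_word[of b a n] swap
    by (cases "a < b") (auto simp: transpose_commute)
  then show ?case using is_word_append[OF _ ws] by blast
qed

lemma coxeter_length_le: "is_word n ws u \<Longrightarrow> coxeter_length n u \<le> length ws"
  unfolding coxeter_length_def by (rule Least_le) auto

lemma reduced_word_exists: "u permutes {..<n} \<Longrightarrow> \<exists>ws. reduced_word n ws u"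
  using LeastI_ex[of "\<lambda>k. \<exists>ws. length ws = k \<and> is_word n ws u"] permutation_word[of u n]
  by (auto simp: reduced_word_def coxeter_length_def)

text \<open>The strong exchange property. Either the inversion of \<open>a\<close> and
  \<open>b\<close> is already present after the first letter is removed, and induction applies; or
  the first letter creates it, and dropping that letter has the same effect as the
  transposition.\<close>

lemma exchange:
  assumes "is_word n ws u" "a < b" "u b < u a"
  shows "\<exists>ws'. is_word n ws' (u \<circ> Transposition.transpose a b) \<and> length ws' < length ws"
  using assms
proof (induction ws arbitrary: u)
  case Nil
  then show ?case by (simp add: is_word_def)
next
  case (Cons i ws)
  define u' where "u' = word_perm ws"
  have u: "u = simple_refl i \<circ> u'" and w': "is_word n ws u'" and i: "Suc i < n"
    using Cons.prems by (auto simp: is_word_def u'_def)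
  have inj: "inj u'" using permutes_inj[OF is_word_permutes[OF w']] .
  show ?case
  proof (cases "u' b < u' a")
    case True
    then obtain ws' where ws': "is_word n ws' (u' \<circ> Transposition.transpose a b)" "length ws' < length ws"
      using Cons.IH[OF w' Cons.prems(2) True] by blast
    then have "is_word n (i # ws') (u \<circ> Transposition.transpose a b)"
      using i by (auto simp: is_word_def u comp_assoc)
    moreover have "length (i # ws') < length (i # ws)" using ws'(2) by simp
    ultimately show ?thesis by blast
  next
    case False
    have "u' a \<noteq> u' b" using inj Cons.prems(2) by (auto dest: injD)
    then have "u' a < u' b" using False by simp
    then have ab: "u' a = i" "u' b = Suc i"
      using Cons.prems(3) by (auto simp: u simple_refl_def Transposition.transpose_def split: if_splits)
    have "u \<circ> Transposition.transpose a b = u'"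
    proof
      fix x
      have "u' x = i \<longleftrightarrow> x = a" "u' x = Suc i \<longleftrightarrow> x = b"
        using inj_eq[OF inj, of x a] inj_eq[OF inj, of x b] unfolding ab by simp_all
      then show "(u \<circ> Transposition.transpose a b) x = u' x"
        using ab by (cases "x = a"; cases "x = b") (simp_all add: u Transposition.transpose_def)
    qed
    then show ?thesis using w' by (intro exI[of _ ws]) simp
  qed
qed

lemma coxeter_length_less:
  assumes u: "u permutes {..<n}" and ab: "a < b" "u b < u a"
  shows "coxeter_length n (u \<circ> Transposition.transpose a b) < coxeter_length n u"
proof -
  obtain ws where ws: "is_word n ws u" "length ws = coxeter_length n u"
    using reduced_word_exists[OF u] by (auto simp: reduced_word_def)
  obtain ws' where "is_word n ws' (u \<circ> Transposition.transpose a b)" "length ws' < length ws"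
    using exchange[OF ws(1) ab] by auto
  then show ?thesis using coxeter_length_le ws(2) by fastforce
qed

lemma coxeter_length_less_iff:
  assumes u: "u permutes {..<n}" and ab: "a < b" "b < n"
  shows "coxeter_length n u < coxeter_length n (u \<circ> Transposition.transpose a b) \<longleftrightarrow> u a < u b"
proof -
  have ne: "u a \<noteq> u b" using permutes_inj[OF u] ab by (auto dest: injD)
  have ut: "u \<circ> Transposition.transpose a b permutes {..<n}"
    using ab by (intro permutes_compose[OF permutes_swap_id u]) auto
  have inv: "u \<circ> Transposition.transpose a b \<circ> Transposition.transpose a b = u"
    by (simp add: comp_assoc)
  show ?thesis
    using coxeter_length_less[OF u ab(1)] coxeter_length_less[OF ut ab(1)] ne
    by (cases "u a < u b") (auto simp: inv)
qed

text \<open>Turns the comparison of lengths into a comparison of two values of \<open>u\<close>, the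
  form in which lifting can be checked.\<close>

lemma bruhat_step_iff:
  "(u, u') \<in> bruhat_step n \<longleftrightarrow> u permutes {..<n} \<and>
    (\<exists>a b. a < b \<and> b < n \<and> u a < u b \<and> u' = u \<circ> Transposition.transpose a b)"
  unfolding bruhat_step_def mem_Collect_eq prod.case using coxeter_length_less_iff by blast

text \<open>At a descent, the exchange property would give a word for the prefix times letter
  \<open>k\<close> that is shorter than the prefix alone, hence a word for \<open>w\<close> shorter
  than its length.\<close>

lemma reduced_word_ascending:
  assumes "reduced_word n ws w" "k < length ws"
  shows "word_perm (take k ws) (ws ! k) < word_perm (take k ws) (Suc (ws ! k))"
proof (rule ccontr)
  let ?u = "word_perm (take k ws)" and ?i = "ws ! k"
  have w: "is_word n ws w" and len: "length ws = coxeter_length n w"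
    using assms(1) by (auto simp: reduced_word_def)
  have words: "is_word n (take k ws) ?u" "is_word n (drop (Suc k) ws) (word_perm (drop (Suc k) ws))"
    using w set_take_subset[of k ws] set_drop_subset[of "Suc k" ws] unfolding is_word_def by blast+
  assume "\<not> ?thesis"
  moreover have "?u ?i \<noteq> ?u (Suc ?i)"
    by (simp add: inj_eq[OF permutes_inj[OF is_word_permutes[OF words(1)]]])
  ultimately have "?u (Suc ?i) < ?u ?i" by simp
  then obtain ws' where ws': "is_word n ws' (?u \<circ> Transposition.transpose ?i (Suc ?i))"
      "length ws' < length (take k ws)"
    using exchange[OF words(1), of ?i "Suc ?i"] by auto
  have "w = word_perm (take k ws @ ws ! k # drop (Suc k) ws)"
    using w id_take_nth_drop[OF assms(2)] by (simp add: is_word_def)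
  also have "\<dots> = ?u \<circ> Transposition.transpose ?i (Suc ?i) \<circ> word_perm (drop (Suc k) ws)"
    by (simp add: word_perm_append simple_refl_def comp_assoc)
  finally have "is_word n (ws' @ drop (Suc k) ws) w"
    using is_word_append[OF ws'(1) words(2)] by simp
  from coxeter_length_le[OF this] show False using ws'(2) len assms(2) by simp
qed

text \<open>The smaller of \<open>u\<close> and \<open>u s_i\<close> in the Bruhat order. The
  positive distinguished subexpression is obtained by iterating it from the right.\<close>

definition lower_of :: "nat \<Rightarrow> (nat \<Rightarrow> nat) \<Rightarrow> nat \<Rightarrow> nat" where
  "lower_of i u = (if u (Suc i) < u i then u \<circ> simple_refl i else u)"

lemma bruhat_le_refl: "bruhat_le n u u"
  by (simp add: bruhat_le_def)

lemma bruhat_le_trans: "bruhat_le n u u' \<Longrightarrow> bruhat_le n u' u'' \<Longrightarrow> bruhat_le n u u''"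
  unfolding bruhat_le_def by (rule rtrancl_trans)

lemma bruhat_step_le: "(u, u') \<in> bruhat_step n \<Longrightarrow> bruhat_le n u u'"
  by (simp add: bruhat_le_def)

lemma bruhat_step_simple:
  assumes "u permutes {..<n}" "Suc i < n" "u i < u (Suc i)"
  shows "(u, u \<circ> simple_refl i) \<in> bruhat_step n"
  unfolding bruhat_step_iff using assms
  by (intro conjI exI[of _ i] exI[of _ "Suc i"]) (simp_all only: simple_refl_def lessI)

lemma transpose_comp_simple_refl:
  "Transposition.transpose a b \<circ> simple_refl i = simple_refl i \<circ> Transposition.transpose (simple_refl i a) (simple_refl i b)"
proof
  fix x
  have "simple_refl i x = a \<longleftrightarrow> x = simple_refl i a" "simple_refl i x = b \<longleftrightarrow> x = simple_refl i b"
    by (metis simple_refl_simps(3))+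
  then show "(Transposition.transpose a b \<circ> simple_refl i) x =
      (simple_refl i \<circ> Transposition.transpose (simple_refl i a) (simple_refl i b)) x"
    by (simp add: Transposition.transpose_def)
qed

text \<open>If \<open>y = x t\<close> with a transposition \<open>t \<noteq> s\<^sub>i\<close> and \<open>x < y\<close>, then also \<open>x s\<^sub>i < y s\<^sub>i\<close>, because
  \<open>s\<^sub>i t s\<^sub>i\<close> permutes two positions in the same order as \<open>t\<close>.\<close>

lemma lifting_step:
  assumes xy: "(x, y) \<in> bruhat_step n" and i: "Suc i < n"
  shows "bruhat_le n (lower_of i x) (lower_of i y)"
proof -
  obtain a b where x: "x permutes {..<n}" and ab: "a < b" "b < n" "x a < x b"
    and y: "y = x \<circ> Transposition.transpose a b"
    using xy by (auto simp: bruhat_step_iff)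
  have xs: "x \<circ> simple_refl i permutes {..<n}" by (rule permutes_compose[OF simple_refl_permutes[OF i] x])
  have yp: "y permutes {..<n}"
    unfolding y using ab by (intro permutes_compose[OF permutes_swap_id x]) auto
  show ?thesis
  proof (cases "a = i \<and> b = Suc i")
    case True
    then have "lower_of i x = x" "lower_of i y = x"
      using ab by (auto simp: lower_of_def y simple_refl_def comp_assoc)
    then show ?thesis by (simp add: bruhat_le_refl)
  next
    case False
    have "y \<circ> simple_refl i = x \<circ> simple_refl i \<circ> Transposition.transpose (simple_refl i a) (simple_refl i b)"
      unfolding y comp_assoc transpose_comp_simple_refl ..
    moreover have "simple_refl i a < simple_refl i b"
      using ab False by (auto simp: simple_refl_def Transposition.transpose_def)
    moreover have "simple_refl i b < n" using ab i by (simp add: simple_refl_less)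
    ultimately have s: "(x \<circ> simple_refl i, y \<circ> simple_refl i) \<in> bruhat_step n"
      unfolding bruhat_step_iff using xs ab
      by (intro conjI exI[of _ "simple_refl i a"] exI[of _ "simple_refl i b"]) auto
    have x1: "x i < x (Suc i) \<or> x (Suc i) < x i" using permutes_inj[OF x]
      by (metis injD less_linear n_not_Suc_n)
    have y1: "y i < y (Suc i) \<or> y (Suc i) < y i" using permutes_inj[OF yp]
      by (metis injD less_linear n_not_Suc_n)
    have up: "bruhat_le n u (u \<circ> simple_refl i)" if "u permutes {..<n}" "u i < u (Suc i)" for u
      using bruhat_step_le[OF bruhat_step_simple[OF that(1) i that(2)]] .
    have down: "bruhat_le n (u \<circ> simple_refl i) u" if "u permutes {..<n}" "u (Suc i) < u i" for u
      using up[of "u \<circ> simple_refl i"] permutes_compose[OF simple_refl_permutes[OF i] that(1)] that(2) by simp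
    consider "x i < x (Suc i)" "y i < y (Suc i)" | "x i < x (Suc i)" "y (Suc i) < y i"
      | "x (Suc i) < x i" "y i < y (Suc i)" | "x (Suc i) < x i" "y (Suc i) < y i"
      using x1 y1 by blast
    then show ?thesis
    proof cases
      case 1
      then show ?thesis using bruhat_step_le[OF xy] by (simp add: lower_of_def)
    next
      case 2
      then show ?thesis using bruhat_le_trans[OF up[OF x] bruhat_step_le[OF s]] by (simp add: lower_of_def)
    next
      case 3
      then show ?thesis using bruhat_le_trans[OF down[OF x] bruhat_step_le[OF xy]] by (simp add: lower_of_def)
    next
      case 4
      then show ?thesis using bruhat_step_le[OF s] by (simp add: lower_of_def)
    qed
  qed
qed

lemma lifting:
  assumes "bruhat_le n x y" "Suc i < n"
  shows "bruhat_le n (lower_of i x) (lower_of i y)"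
  using assms(1) unfolding bruhat_le_def
proof (induction rule: rtrancl_induct)
  case (step y z)
  show ?case
    by (rule rtrancl_trans[OF step(3) lifting_step[OF step(2) assms(2), unfolded bruhat_le_def]])
qed simp

lemma bruhat_le_length: "bruhat_le n x y \<Longrightarrow> x = y \<or> coxeter_length n x < coxeter_length n y"
  unfolding bruhat_le_def by (induction rule: rtrancl_induct) (auto simp: bruhat_step_def)

lemma bruhat_le_id: "bruhat_le n x id \<Longrightarrow> x = id"
  using bruhat_le_length[of n x id] coxeter_length_le[of n "[]" id] by (auto simp: is_word_def)

lemma bruhat_less_simple_iff:
  assumes u: "u permutes {..<n}" and i: "Suc i < n"
  shows "bruhat_less n (u \<circ> simple_refl i) u \<longleftrightarrow> u (Suc i) < u i"
proof
  assume "bruhat_less n (u \<circ> simple_refl i) u"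
  then have "coxeter_length n (u \<circ> simple_refl i) < coxeter_length n u"
    using bruhat_le_length by (auto simp: bruhat_less_def)
  moreover have "u i \<noteq> u (Suc i)" using permutes_inj[OF u] by (metis injD n_not_Suc_n)
  ultimately show "u (Suc i) < u i"
    using coxeter_length_less_iff[OF u, of i "Suc i"] i by (auto simp: simple_refl_def)
next
  assume lt: "u (Suc i) < u i"
  have "(u \<circ> simple_refl i, u \<circ> simple_refl i \<circ> simple_refl i) \<in> bruhat_step n"
    by (rule bruhat_step_simple) (use permutes_compose[OF simple_refl_permutes[OF i] u] i lt in auto)
  moreover have "u \<circ> simple_refl i \<noteq> u" using lt by (metis comp_apply less_irrefl simple_refl_simps(1))
  ultimately show "bruhat_less n (u \<circ> simple_refl i) u"
    by (auto simp: bruhat_less_def dest: bruhat_step_le)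
qed

section \<open>From the given words and subexpressions to the recursive products\<close>

lemma prod_mats_snoc:
  assumes "\<And>A. A \<in> set As \<Longrightarrow> A \<in> carrier_mat n n" "B \<in> carrier_mat n n"
  shows "prod_mats n (As @ [B]) = prod_mats n As * B"
proof -
  have car: "prod_mats n As \<in> carrier_mat n n" if "\<And>A. A \<in> set As \<Longrightarrow> A \<in> carrier_mat n n" for As
    using that by (induction As) (auto simp: prod_mats_def)
  show ?thesis using assms
  proof (induction As)
    case (Cons A As)
    then show ?case using car[of As] mult_assoc_mat[of A n "prod_mats n As" B] by (simp add: prod_mats_def)
  qed (simp add: prod_mats_def)
qed

lemma prod_mats_mseq:
  "(\<And>k. E k \<in> carrier_mat n n) \<Longrightarrow> prod_mats n (map E [0..<m]) = mseq n E m"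
proof (induction m)
  case (Suc m)
  have "prod_mats n (map E [0..<Suc m]) = prod_mats n (map E [0..<m] @ [E m])" by simp
  also have "\<dots> = prod_mats n (map E [0..<m]) * E m" using Suc.prems by (intro prod_mats_snoc) auto
  finally show ?case using Suc by simp
qed (simp add: prod_mats_def)

lemma reduced_word_locale:
  assumes "reduced_word n ws w"
  shows "ascending n (length ws) (\<lambda>k. ws ! k) UNIV"
  using assms reduced_word_ascending[OF assms]
  by unfold_locales (auto simp: pseq_word reduced_word_def is_word_def)

lemma dot_eq_signed_perm_mat:
  assumes "u permutes {..<n}"
  shows "dot n u = signed_perm_mat n u"
proof -
  define ws where "ws = (SOME ws. reduced_word n ws u)"
  have ws: "reduced_word n ws u" unfolding ws_def using reduced_word_exists[OF assms] by (rule someI_ex)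
  interpret ascending n "length ws" "\<lambda>k. ws ! k" UNIV by (rule reduced_word_locale[OF ws])
  have "dot n u = prod_mats n (map (sdot n) ws)" by (simp add: dot_def ws_def)
  also have "map (sdot n) ws = map (\<lambda>k. sdot n (ws ! k)) [0..<length ws]"
    by (rule nth_equalityI) auto
  also have "prod_mats n \<dots> = mseq n (\<lambda>k. sdot n (ws ! k)) (length ws)"
    by (rule prod_mats_mseq) simp
  also have "\<dots> = signed_perm_mat n (pseq (\<lambda>k. ws ! k) UNIV (length ws))"
    using V_eq_signed_perm_mat[OF order_refl] by simp
  also have "pseq (\<lambda>k. ws ! k) UNIV (length ws) = u"
    using ws by (simp add: pseq_word reduced_word_def is_word_def)
  finally show ?thesis .
qed

text \<open>The relation \<open>v_k \<le> w_k\<close> propagates from right to left: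
  \<open>lower_of\<close> applied to both sides gives \<open>v_k\<close> by the recursion for
  \<open>vs\<close>, gives \<open>w_k\<close> because the word is reduced, and respects the order by
  \<open>lifting\<close>.\<close>

lemma Red_subexpression:
  assumes R: "(vs, ws) \<in> Red n v w" and le: "bruhat_le n v w" and v: "v permutes {..<n}"
    and k: "k \<le> length ws"
  shows "bruhat_le n (vs ! k) (word_perm (take k ws))" "vs ! k permutes {..<n}"
    "k < length ws \<Longrightarrow> vs ! k = lower_of (ws ! k) (vs ! Suc k)"
proof -
  have red: "reduced_word n ws w" and pd: "pos_dist_subexpr n v ws vs" using R by (auto simp: Red_def)
  have wp: "word_perm ws = w" and bound: "\<And>k. k < length ws \<Longrightarrow> Suc (ws ! k) < n"
    using red by (auto simp: reduced_word_def is_word_def)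
  have step: "vs ! k = lower_of (ws ! k) (vs ! Suc k)"
    if "k < length ws" "vs ! Suc k permutes {..<n}" for k
    using pd that bruhat_less_simple_iff[OF that(2) bound[OF that(1)]]
    by (simp add: pos_dist_subexpr_def lower_of_def)
  have *: "bruhat_le n (vs ! k) (word_perm (take k ws)) \<and> vs ! k permutes {..<n}" if "k \<le> length ws" for k
    using that
  proof (induction rule: inc_induct)
    case base
    then show ?case using pd le v wp by (simp add: pos_dist_subexpr_def)
  next
    case (step k)
    have eq: "vs ! k = lower_of (ws ! k) (vs ! Suc k)" using step \<open>\<And>k. _ \<Longrightarrow> _ \<Longrightarrow> vs ! k = _\<close> by blast
    have i: "Suc (ws ! k) < n" using bound step by simp
    have "lower_of (ws ! k) (word_perm (take (Suc k) ws)) = word_perm (take k ws)"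
      using reduced_word_ascending[OF red step(2)] step(2)
      by (simp add: lower_of_def take_Suc_conv_app_nth word_perm_append)
    then have "bruhat_le n (vs ! k) (word_perm (take k ws))"
      unfolding eq using lifting[OF _ i, of "vs ! Suc k" "word_perm (take (Suc k) ws)"] step by simp
    moreover have "vs ! k permutes {..<n}"
      unfolding eq lower_of_def using step permutes_compose[OF simple_refl_permutes[OF i]] by simp
    ultimately show ?case by simp
  qed
  show "bruhat_le n (vs ! k) (word_perm (take k ws))" "vs ! k permutes {..<n}" using *[OF k] by auto
  show "k < length ws \<Longrightarrow> vs ! k = lower_of (ws ! k) (vs ! Suc k)" using step *[of "Suc k"] by simp
qed

text \<open>\<open>vs\<close> is defined from the right end, while the products start at the left
  end. Both agree because \<open>v \<le> w\<close> leaves only the identity for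
  \<open>vs ! 0\<close>.\<close>

lemma Red_pseq:
  assumes R: "(vs, ws) \<in> Red n v w" and le: "bruhat_le n v w" and v: "v permutes {..<n}"
    and k: "k \<le> length ws"
  shows "pseq (\<lambda>k. ws ! k) (- Jo vs) k = vs ! k"
  using k
proof (induction k)
  case 0
  have "bruhat_le n (vs ! 0) id" using Red_subexpression(1)[OF R le v, of 0] by simp
  then have "vs ! 0 = id" by (rule bruhat_le_id)
  then show ?case by (simp only: pseq.simps)
next
  case (Suc k)
  have len: "length vs = Suc (length ws)" using R by (auto simp: Red_def pos_dist_subexpr_def)
  have eq: "vs ! k = lower_of (ws ! k) (vs ! Suc k)"
    using Red_subexpression(3)[OF R le v, of k] Suc by simp
  show ?case
  proof (cases "k \<in> Jo vs")
    case True
    then show ?thesis using Suc by (simp add: Jo_def)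
  next
    case False
    then have "vs ! k \<noteq> vs ! Suc k" using Suc.prems len by (simp add: Jo_def)
    then have "vs ! k = vs ! Suc k \<circ> simple_refl (ws ! k)" using eq by (simp add: lower_of_def split: if_splits)
    then have "vs ! Suc k = vs ! k \<circ> simple_refl (ws ! k)" by simp
    then show ?thesis using False Suc by simp
  qed
qed

text \<open>A value of \<open>lower_of i\<close> never has a descent at \<open>i\<close>, whether or
  not the letter was used. This supplies both ascent conditions of \<open>mr_pair\<close>.\<close>

lemma Red_ascending:
  assumes R: "(vs, ws) \<in> Red n v w" and le: "bruhat_le n v w" and v: "v permutes {..<n}"
    and k: "k < length ws"
  shows "(vs ! k) (ws ! k) < (vs ! k) (Suc (ws ! k))"
proof -
  have "vs ! Suc k permutes {..<n}" using Red_subexpression(2)[OF R le v, of "Suc k"] k by simp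
  then have "(vs ! Suc k) (ws ! k) \<noteq> (vs ! Suc k) (Suc (ws ! k))"
    using permutes_inj by (metis injD n_not_Suc_n)
  then show ?thesis
    using Red_subexpression(3)[OF R le v, of k] k by (auto simp: lower_of_def)
qed


section \<open>Wiring diagrams\<close>

lemma simple_refl_less_iff: "h \<noteq> Suc i \<Longrightarrow> simple_refl i x < h \<longleftrightarrow> x < h"
  by (auto simp: simple_refl_def Transposition.transpose_def)

text \<open>A crossing exchanges two heights that are on different sides only of the level
  \<open>Suc (ws ! r)\<close>, and precisely there the two cells are not adjacent. As
  \<open>U\<close> is arbitrary, \<open>v\<close>-strands never cut through a chamber of the diagram
  of \<open>w\<close> either.\<close>

lemma strand_below_adj:
  "((c, h), (c', h')) \<in> cell_adj n ws \<Longrightarrow> strand ws U a c < h \<longleftrightarrow> strand ws U a c' < h'"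
  by (auto simp: cell_adj_def simple_refl_less_iff)

lemma strand_below_conn:
  assumes "(p, p') \<in> cell_conn n ws"
  shows "strand ws U a (fst p) < snd p \<longleftrightarrow> strand ws U a (fst p') < snd p'"
  using assms unfolding cell_conn_def
proof (induction rule: rtrancl_induct)
  case (step p' p'')
  then show ?case
    using strand_below_adj[of "fst p'" "snd p'" "fst p''" "snd p''" n ws U a]
      strand_below_adj[of "fst p''" "snd p''" "fst p'" "snd p'" n ws U a] by auto
qed simp

lemma cell_conn_cells:
  assumes "(p, p') \<in> cell_conn n ws" "p \<in> cells n ws"
  shows "p' \<in> cells n ws"
  using assms unfolding cell_conn_def
  by (induction rule: rtrancl_induct) (auto simp: cell_adj_def cells_def)

lemma chamber_of_mem: "p \<in> chamber_of n ws p"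
  by (simp add: chamber_of_def cell_conn_def)

lemma chambersE:
  assumes "C \<in> chambers n ws"
  obtains c h where "c \<le> length ws" "h \<le> n" "C = chamber_of n ws (c, h)"
  using assms by (auto simp: chambers_def quotient_def cells_def chamber_of_def)

lemma chamber_of_chambers: "c \<le> length ws \<Longrightarrow> h \<le> n \<Longrightarrow> chamber_of n ws (c, h) \<in> chambers n ws"
  by (auto simp: chambers_def chamber_of_def quotient_def cells_def)

lemma chamber_below:
  "(c', h') \<in> chamber_of n ws (c, h) \<Longrightarrow> strand ws U a c' < h' \<longleftrightarrow> strand ws U a c < h"
  using strand_below_conn[of "(c, h)" "(c', h')" n ws U a] by (simp add: chamber_of_def)

text \<open>A strand is on the same side of all cells of a chamber, so any representative cell
  decides. This reduces chamber minors to minors indexed by \<open>(c, h)\<close>.\<close>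

lemma passes_below_iff: "passes_below (strand ws U a) (chamber_of n ws (c, h)) \<longleftrightarrow> strand ws U a c < h"
proof
  assume "passes_below (strand ws U a) (chamber_of n ws (c, h))"
  then show "strand ws U a c < h"
    unfolding passes_below_def using chamber_of_mem[of "(c, h)" n ws] by blast
next
  assume "strand ws U a c < h"
  then show "passes_below (strand ws U a) (chamber_of n ws (c, h))"
    unfolding passes_below_def by (auto simp: chamber_below)
qed

lemma passes_above_iff: "passes_above (strand ws U a) (chamber_of n ws (c, h)) \<longleftrightarrow> h \<le> strand ws U a c"
proof
  assume "passes_above (strand ws U a) (chamber_of n ws (c, h))"
  then show "h \<le> strand ws U a c"
    unfolding passes_above_def using chamber_of_mem[of "(c, h)" n ws] by blast
next
  assume "h \<le> strand ws U a c"
  then show "passes_above (strand ws U a) (chamber_of n ws (c, h))"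
    unfolding passes_above_def not_less[symmetric] by (auto simp: chamber_below)
qed

lemma pseq_strand:
  "(\<And>r. r < c \<Longrightarrow> r \<in> U \<longleftrightarrow> r \<in> K) \<Longrightarrow> pseq (\<lambda>k. ws ! k) K c (strand ws U a c) = a"
  by (induction c) auto

lemma strand_eq_path: "c \<le> length ws \<Longrightarrow> strand ws {..<length ws} a c = path (\<lambda>k. ws ! k) a c"
  by (induction c) auto

lemma strands_above_eq:
  assumes inv: "\<And>a. u (s a) = a" and u: "u permutes {..<n}"
  shows "{a. a < n \<and> h \<le> s a} = u ` {h..<n}"
proof -
  have s: "s (u x) = x" for x using inv[of "u x"] inj_eq[OF permutes_inj[OF u]] by simp
  have un: "u x < n \<longleftrightarrow> x < n" for x using permutes_in_image[OF u, of x] by simp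
  show ?thesis
  proof (intro subset_antisym subsetI)
    fix a assume "a \<in> {a. a < n \<and> h \<le> s a}"
    then show "a \<in> u ` {h..<n}" using inv[of a] un[of "s a"] by (intro image_eqI[of _ _ "s a"]) auto
  qed (auto simp: s un)
qed

lemma strand_ends_below_eq:
  assumes inv: "\<And>a. u (s a) = a" "\<And>a. u' (s' a) = a" and u: "u permutes {..<n}" "u' permutes {..<n}"
    and h: "h \<le> n"
  shows "{s' a |a. a < n \<and> s a < h} = {c. c < n \<and> u' c \<in> u ` {..<h}}"
proof -
  have s: "s (u x) = x" for x using inv(1)[of "u x"] inj_eq[OF permutes_inj[OF u(1)]] by simp
  have s': "s' (u' x) = x" for x using inv(2)[of "u' x"] inj_eq[OF permutes_inj[OF u(2)]] by simp
  have un: "u x < n \<longleftrightarrow> x < n" "u' x < n \<longleftrightarrow> x < n" for x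
    using permutes_in_image[OF u(1), of x] permutes_in_image[OF u(2), of x] by simp_all
  show ?thesis
  proof (intro subset_antisym subsetI)
    fix x assume "x \<in> {s' a |a. a < n \<and> s a < h}"
    then obtain a where a: "x = s' a" "a < n" "s a < h" by auto
    have "x < n" using un(2)[of x] inv(2)[of a] a by simp
    moreover have "u' x \<in> u ` {..<h}" using a inv(1)[of a] inv(2)[of a] by (intro image_eqI[of _ _ "s a"]) auto
    ultimately show "x \<in> {c. c < n \<and> u' c \<in> u ` {..<h}}" by simp
  next
    fix x assume "x \<in> {c. c < n \<and> u' c \<in> u ` {..<h}}"
    then obtain y where y: "x < n" "u' x = u y" "y < h" by auto
    have "s (u' x) = y" unfolding y(2) by (rule s)
    then have "x = s' (u' x) \<and> u' x < n \<and> s (u' x) < h" using s'[of x] un(2)[of x] y by simp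
    then show "x \<in> {s' a |a. a < n \<and> s a < h}" by blast
  qed
qed

section \<open>The chambers matched with the matrix computation\<close>

locale wiring =
  fixes n :: nat and vs :: "(nat \<Rightarrow> nat) list" and ws :: "nat list" and t :: "nat \<Rightarrow> complex"
    and v w :: "nat \<Rightarrow> nat"
  assumes Red: "(vs, ws) \<in> Red n v w" and le: "bruhat_le n v w" and v: "v permutes {..<n}"
    and t: "r \<in> Jo vs \<Longrightarrow> t r \<noteq> 0"
begin

abbreviation "m \<equiv> length ws"
abbreviation "lt \<equiv> \<lambda>k. ws ! k"
abbreviation "J \<equiv> Jo vs"

lemma reduced: "reduced_word n ws w"
  using Red by (simp add: Red_def)

lemma length_vs: "length vs = Suc m"
  using Red by (simp add: Red_def pos_dist_subexpr_def)

lemma J_less: "r \<in> J \<Longrightarrow> r < m"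
  using length_vs by (simp add: Jo_def)

sublocale mr_pair n m lt J t
proof -
  interpret a: ascending n m lt UNIV by (rule reduced_word_locale[OF reduced])
  have asc: "pseq lt (- J) k (lt k) < pseq lt (- J) k (Suc (lt k))" if "k < m" for k
    using Red_ascending[OF Red le v that] Red_pseq[OF Red le v less_imp_le[OF that]] by simp
  show "mr_pair n m lt J t"
    by unfold_locales (use a.bound a.asc t asc in auto)
qed

lemma pi_last: "\<pi> m = w"
  using reduced by (simp add: pseq_word reduced_word_def is_word_def)

lemma rho_last: "\<rho> m = v"
  using Red_pseq[OF Red le v order_refl] Red by (simp add: Red_def pos_dist_subexpr_def)

lemma dot_w: "dot n w = W m"
  using dot_eq_signed_perm_mat[OF pi_permutes[OF order_refl]] V_eq_signed_perm_mat[OF order_refl]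
  unfolding pi_last by simp

lemma dot_v: "dot n v = V' m"
  using dot_eq_signed_perm_mat[OF v.pi_permutes[OF order_refl]] v.V_eq_signed_perm_mat[OF order_refl]
  unfolding rho_last by simp

lemma MR_param_eq: "MR_param n vs ws t = G m"
proof -
  have "MR_param n vs ws t = prod_mats n (map E [0..<m])"
    by (simp add: MR_param_def E_def[abs_def])
  then show ?thesis by (simp add: prod_mats_mseq)
qed

lemma pi_w_strand: "c \<le> m \<Longrightarrow> \<pi> c (w_strand ws a c) = a"
  by (rule pseq_strand) auto

lemma rho_v_strand: "c \<le> m \<Longrightarrow> \<rho> c (v_strand vs ws a c) = a"
  by (rule pseq_strand) auto

lemma Delta_left_eq:
  assumes "c \<le> m"
  shows "Delta_left n vs ws (chamber_of n ws (c, h)) y = minor (\<pi> c ` {h..<n}) (\<rho> c ` {h..<n}) y"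
  unfolding Delta_left_def passes_above_iff
    strands_above_eq[of "\<pi> c", OF pi_w_strand[OF assms] pi_permutes[OF assms]]
    strands_above_eq[of "\<rho> c", OF rho_v_strand[OF assms] v.pi_permutes[OF assms]] ..

lemma Delta_right_eq:
  assumes c: "c \<le> m" and h: "h \<le> n"
  shows "Delta_right n vs ws (chamber_of n ws (c, h)) y =
    minor {x. x < n \<and> \<rho> m x \<in> \<rho> c ` {..<h}} {x. x < n \<and> \<pi> m x \<in> \<pi> c ` {..<h}} y"
  unfolding Delta_right_def passes_below_iff
    strand_ends_below_eq[of "\<pi> c", OF pi_w_strand[OF c] pi_w_strand[OF order_refl] pi_permutes[OF c] pi_permutes[OF order_refl] h]
    strand_ends_below_eq[of "\<rho> c", OF rho_v_strand[OF c] rho_v_strand[OF order_refl] v.pi_permutes[OF c] v.pi_permutes[OF order_refl] h] ..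

lemma crossing_strands_iff:
  assumes "r < m"
  shows "crossing_strands n ws r a b \<longleftrightarrow> a = lo r \<and> b = hi r"
  using strand_at[OF assms] lo_hi[OF assms] assms
  by (auto simp: crossing_strands_def strand_eq_path)

lemma chamber_cells:
  "(c', h') \<in> chamber_of n ws (c, h) \<Longrightarrow> c \<le> m \<Longrightarrow> h \<le> n \<Longrightarrow> c' \<le> m"
  using cell_conn_cells[of "(c, h)" "(c', h')" n ws] by (simp add: chamber_of_def cells_def)

lemma chamber_path_below:
  assumes "(c', h') \<in> chamber_of n ws (c, h)" "c \<le> m" "h \<le> n"
  shows "st a c' < h' \<longleftrightarrow> st a c < h"
  using chamber_below[OF assms(1), of "{..<m}" a] chamber_cells[OF assms] assms by (simp add: strand_eq_path)

text \<open>The vertical order of \<open>lo r\<close> below \<open>hi r\<close> occurs exactly in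
  the columns up to \<open>r\<close>, so it encodes the upstream side; and the position relative to
  both strands is constant on a chamber.\<close>

lemma Up_wedge_iff:
  assumes r: "r < m" and c: "c \<le> m" and h: "h \<le> n"
  shows "chamber_of n ws (c, h) \<in> Up_wedge n ws r \<longleftrightarrow> st (lo r) c < h \<and> h \<le> st (hi r) c"
proof -
  let ?C = "chamber_of n ws (c, h)"
  let ?in = "\<lambda>c' h'. c' \<le> r \<and> between (w_strand ws (lo r)) (w_strand ws (hi r)) (c', h')"
  have "?C \<in> Up_wedge n ws r \<longleftrightarrow> (\<forall>(c', h')\<in>?C. ?in c' h')"
    using chamber_of_chambers[OF c h] by (auto simp: Up_wedge_def crossing_strands_iff[OF r])
  also have "\<dots> \<longleftrightarrow> st (lo r) c < h \<and> h \<le> st (hi r) c"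
  proof
    assume "\<forall>(c', h')\<in>?C. ?in c' h'"
    then have "?in c h" using chamber_of_mem[of "(c, h)" n ws] by blast
    then show "st (lo r) c < h \<and> h \<le> st (hi r) c"
      using strand_before[OF r, of c] c by (simp add: between_def strand_eq_path)
  next
    assume a: "st (lo r) c < h \<and> h \<le> st (hi r) c"
    show "\<forall>(c', h')\<in>?C. ?in c' h'"
    proof clarify
      fix c' h' assume C: "(c', h') \<in> ?C"
      have lt: "st (lo r) c' < h'" "\<not> st (hi r) c' < h'"
        using chamber_path_below[OF C c h] a by simp_all
      have "c' \<le> r"
        using strand_after[of r c'] chamber_cells[OF C c h] lt by (cases "c' \<le> r") auto
      then show "?in c' h'" using lt chamber_cells[OF C c h] by (simp add: between_def strand_eq_path)
    qed
  qed
  finally show ?thesis .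
qed

lemma Down_wedge_iff:
  assumes r: "r < m" and c: "c \<le> m" and h: "h \<le> n"
  shows "chamber_of n ws (c, h) \<in> Down_wedge n ws r \<longleftrightarrow> st (hi r) c < h \<and> h \<le> st (lo r) c"
proof -
  let ?C = "chamber_of n ws (c, h)"
  let ?in = "\<lambda>c' h'. r < c' \<and> between (w_strand ws (lo r)) (w_strand ws (hi r)) (c', h')"
  have "?C \<in> Down_wedge n ws r \<longleftrightarrow> (\<forall>(c', h')\<in>?C. ?in c' h')"
    using chamber_of_chambers[OF c h] by (auto simp: Down_wedge_def crossing_strands_iff[OF r])
  also have "\<dots> \<longleftrightarrow> st (hi r) c < h \<and> h \<le> st (lo r) c"
  proof
    assume "\<forall>(c', h')\<in>?C. ?in c' h'"
    then have "?in c h" using chamber_of_mem[of "(c, h)" n ws] by blast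
    then show "st (hi r) c < h \<and> h \<le> st (lo r) c"
      using strand_after[of r c] c by (simp add: between_def strand_eq_path)
  next
    assume a: "st (hi r) c < h \<and> h \<le> st (lo r) c"
    show "\<forall>(c', h')\<in>?C. ?in c' h'"
    proof clarify
      fix c' h' assume C: "(c', h') \<in> ?C"
      have lt: "st (hi r) c' < h'" "\<not> st (lo r) c' < h'"
        using chamber_path_below[OF C c h] a by simp_all
      have "r < c'"
        using strand_before[OF r, of c'] lt by (cases "c' \<le> r") auto
      then show "?in c' h'" using lt chamber_cells[OF C c h] by (simp add: between_def strand_eq_path)
    qed
  qed
  finally show ?thesis .
qed

lemma crossing_heights: "r < m \<Longrightarrow> Suc (Suc (lt r)) \<le> n"
  using bound[of r] by simp

theorem chamber_ansatz_left:
  defines "y \<equiv> right_unip n (dot n w * transpose_mat (cap_rep n v (MR_param n vs ws t)))"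
  shows "r \<in> J \<Longrightarrow> t r = Delta_left n vs ws (C_up n ws r) y * Delta_left n vs ws (C_down n ws r) y
      / (Delta_left n vs ws (C_left n ws r) y * Delta_left n vs ws (C_right n ws r) y)"
    and "C \<in> chambers n ws \<Longrightarrow>
      Delta_left n vs ws C y = (\<Prod>r\<in>{r \<in> J. C \<in> Down_wedge n ws r}. inverse (t r))"
proof -
  obtain d where d: "\<And>j. j < n \<Longrightarrow> d 0 j = (1 :: complex)"
    "\<And>k j. k \<le> m \<Longrightarrow> j < n \<Longrightarrow> d k j \<noteq> 0"
    "\<And>k. k < m \<Longrightarrow> d k (lt k) = q k * d (Suc k) (Suc (lt k))"
    "\<And>k. k < m \<Longrightarrow> d (Suc k) (lt k) = q k * d k (Suc (lt k))"
    "\<And>k j. k < m \<Longrightarrow> j < n \<Longrightarrow> j \<noteq> lt k \<Longrightarrow> j \<noteq> Suc (lt k) \<Longrightarrow> d (Suc k) j = d k j"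
    "\<And>k h. k \<le> m \<Longrightarrow> h \<le> n \<Longrightarrow> minor (\<pi> k ` {h..<n}) (\<rho> k ` {h..<n})
        (right_unip n (W m * transpose_mat (cap_rep n v (G m)))) = (\<Prod>j\<in>{h..<n}. d k j)"
    by (rule chamber_left[OF dot_v]) blast
  have y: "y = right_unip n (W m * transpose_mat (cap_rep n v (G m)))"
    unfolding y_def dot_w MR_param_eq ..
  have D: "Delta_left n vs ws (chamber_of n ws (c, h)) y = (\<Prod>j\<in>{h..<n}. d c j)"
    if "c \<le> m" "h \<le> n" for c h
    unfolding Delta_left_eq[OF that(1)] y by (rule d(6)[OF that])
  show "Delta_left n vs ws C y = (\<Prod>r\<in>{r \<in> J. C \<in> Down_wedge n ws r}. inverse (t r))"
    if CC: "C \<in> chambers n ws"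
  proof -
    obtain c h where ch: "c \<le> m" "h \<le> n" and C: "C = chamber_of n ws (c, h)"
      by (rule chambersE[OF CC])
    have "{r \<in> J. C \<in> Down_wedge n ws r} = {r. r < m \<and> r \<in> J \<and> st (hi r) c < h \<and> h \<le> st (lo r) c}"
      unfolding C using J_less Down_wedge_iff[OF _ ch] by blast
    then show ?thesis
      unfolding C D[OF ch] using left_weights_prod[OF d(1,3,4,5) ch(1)] by simp
  qed
  show "t r = Delta_left n vs ws (C_up n ws r) y * Delta_left n vs ws (C_down n ws r) y
      / (Delta_left n vs ws (C_left n ws r) y * Delta_left n vs ws (C_right n ws r) y)" if rJ: "r \<in> J"
  proof -
    let ?i = "lt r"
    have r: "r < m" by (rule J_less[OF rJ])
    have i: "Suc (Suc ?i) \<le> n" by (rule crossing_heights[OF r])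
    \<comment> \<open>The weights above the crossing are common to all four chambers and agree in
      columns \<open>r\<close> and \<open>Suc r\<close>.\<close>
    define X where "X = (\<Prod>j\<in>{Suc (Suc ?i)..<n}. d r j)"
    have X': "(\<Prod>j\<in>{Suc (Suc ?i)..<n}. d (Suc r) j) = X"
      unfolding X_def by (rule prod.cong) (auto simp: d(5)[OF r])
    have nz: "X \<noteq> 0" "d r (Suc ?i) \<noteq> 0" "d (Suc r) (Suc ?i) \<noteq> 0"
      using d(2) r i by (auto simp: X_def)
    have up: "Delta_left n vs ws (C_up n ws r) y = X"
      using D[of r "Suc (Suc ?i)"] r i by (simp add: C_up_def X_def)
    have down: "Delta_left n vs ws (C_down n ws r) y = d r ?i * (d r (Suc ?i) * X)"
      using D[of r ?i] r i by (simp add: C_down_def X_def prod.atLeast_Suc_lessThan)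
    have left: "Delta_left n vs ws (C_left n ws r) y = d r (Suc ?i) * X"
      using D[of r "Suc ?i"] r i by (simp add: C_left_def X_def prod.atLeast_Suc_lessThan)
    have right: "Delta_left n vs ws (C_right n ws r) y = d (Suc r) (Suc ?i) * X"
      using D[of "Suc r" "Suc ?i"] r i X' by (simp add: C_right_def prod.atLeast_Suc_lessThan)
    \<comment> \<open>Once \<open>X\<close> and the weight at \<open>Suc ?i\<close> in column
      \<open>r\<close> are cancelled, the quotient is \<open>d r ?i / d (Suc r) (Suc ?i)\<close>,
      which is \<open>q r\<close> by the recursion.\<close>
    show ?thesis
      unfolding up down left right d(3)[OF r] using nz rJ by (simp add: q_def)
  qed
qed

theorem chamber_ansatz_right:
  defines "y \<equiv> left_unip n (transpose_mat (MR_param n vs ws t) * dot n w)"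
  shows "r \<in> J \<Longrightarrow> t r = Delta_right n vs ws (C_up n ws r) y * Delta_right n vs ws (C_down n ws r) y
      / (Delta_right n vs ws (C_left n ws r) y * Delta_right n vs ws (C_right n ws r) y)"
    and "C \<in> chambers n ws \<Longrightarrow>
      Delta_right n vs ws C y = (\<Prod>r\<in>{r \<in> J. C \<in> Up_wedge n ws r}. inverse (t r))"
proof -
  obtain d where d: "\<And>j. j < n \<Longrightarrow> d m j = (1 :: complex)"
    "\<And>k j. k \<le> m \<Longrightarrow> j < n \<Longrightarrow> d k j \<noteq> 0"
    "\<And>k. k < m \<Longrightarrow> d k (Suc (lt k)) = q k * d (Suc k) (lt k)"
    "\<And>k. k < m \<Longrightarrow> d (Suc k) (Suc (lt k)) = q k * d k (lt k)"
    "\<And>k j. k < m \<Longrightarrow> j < n \<Longrightarrow> j \<noteq> lt k \<Longrightarrow> j \<noteq> Suc (lt k) \<Longrightarrow> d (Suc k) j = d k j"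
    "\<And>k h. k \<le> m \<Longrightarrow> h \<le> n \<Longrightarrow>
      minor {c. c < n \<and> \<rho> m c \<in> \<rho> k ` {..<h}} {c. c < n \<and> \<pi> m c \<in> \<pi> k ` {..<h}}
        (left_unip n (transpose_mat (G m) * W m)) = (\<Prod>j<h. d k j)"
    by (rule chamber_right) blast
  have y: "y = left_unip n (transpose_mat (G m) * W m)"
    unfolding y_def dot_w MR_param_eq ..
  have D: "Delta_right n vs ws (chamber_of n ws (c, h)) y = (\<Prod>j<h. d c j)"
    if "c \<le> m" "h \<le> n" for c h
    unfolding Delta_right_eq[OF that] y by (rule d(6)[OF that])
  show "Delta_right n vs ws C y = (\<Prod>r\<in>{r \<in> J. C \<in> Up_wedge n ws r}. inverse (t r))"
    if CC: "C \<in> chambers n ws"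
  proof -
    obtain c h where ch: "c \<le> m" "h \<le> n" and C: "C = chamber_of n ws (c, h)"
      by (rule chambersE[OF CC])
    have "{r \<in> J. C \<in> Up_wedge n ws r} = {r. r < m \<and> r \<in> J \<and> st (lo r) c < h \<and> h \<le> st (hi r) c}"
      unfolding C using J_less Up_wedge_iff[OF _ ch] by blast
    then show ?thesis
      unfolding C D[OF ch] using right_weights_prod[OF d(1,3,4,5) ch] by simp
  qed
  show "t r = Delta_right n vs ws (C_up n ws r) y * Delta_right n vs ws (C_down n ws r) y
      / (Delta_right n vs ws (C_left n ws r) y * Delta_right n vs ws (C_right n ws r) y)" if rJ: "r \<in> J"
  proof -
    let ?i = "lt r"
    have r: "r < m" by (rule J_less[OF rJ])
    have i: "Suc (Suc ?i) \<le> n" by (rule crossing_heights[OF r])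
    \<comment> \<open>Here chambers are measured by the strands below them, so the common factor
      lies below the crossing and the upper and lower chambers exchange roles.\<close>
    define X where "X = (\<Prod>j<?i. d r j)"
    have X': "(\<Prod>j<?i. d (Suc r) j) = X"
      unfolding X_def by (rule prod.cong) (use i in \<open>auto simp: d(5)[OF r]\<close>)
    have nz: "X \<noteq> 0" "d r ?i \<noteq> 0" "d (Suc r) ?i \<noteq> 0"
      using d(2) r i by (auto simp: X_def)
    have up: "Delta_right n vs ws (C_up n ws r) y = X * d r ?i * d r (Suc ?i)"
      using D[of r "Suc (Suc ?i)"] r i by (simp add: C_up_def X_def)
    have down: "Delta_right n vs ws (C_down n ws r) y = X"
      using D[of r ?i] r i by (simp add: C_down_def X_def)
    have left: "Delta_right n vs ws (C_left n ws r) y = X * d r ?i"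
      using D[of r "Suc ?i"] r i by (simp add: C_left_def X_def)
    have right: "Delta_right n vs ws (C_right n ws r) y = X * d (Suc r) ?i"
      using D[of "Suc r" "Suc ?i"] r i X' by (simp add: C_right_def)
    show ?thesis
      unfolding up down left right d(3)[OF r] using nz rJ by (simp add: q_def)
  qed
qed

end

theorem theorem2p15:
  fixes n :: nat
    and v w :: "nat \<Rightarrow> nat"
    and vs :: "(nat \<Rightarrow> nat) list"
    and ws :: "nat list"
    and t :: "nat \<Rightarrow> complex"
    and g g_cap y_right y_left :: "complex mat"
  assumes "n \<ge> 1"
    and "v permutes {..<n}" and "w permutes {..<n}"
    and "bruhat_le n v w"
    and "(vs, ws) \<in> Red n v w"
    and "\<forall>r\<in>Jo vs. t r \<noteq> 0"
    and "g = MR_param n vs ws t"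
    and "y_right = left_unip n (transpose_mat g * dot n w)"
    and "g_cap = cap_rep n v g"
    and "y_left = right_unip n (dot n w * transpose_mat g_cap)"
  shows
    "(\<forall>r\<in>Jo vs.
        t r = Delta_right n vs ws (C_up n ws r) y_right * Delta_right n vs ws (C_down n ws r) y_right
            / (Delta_right n vs ws (C_left n ws r) y_right * Delta_right n vs ws (C_right n ws r) y_right)
      \<and> t r = Delta_left n vs ws (C_up n ws r) y_left * Delta_left n vs ws (C_down n ws r) y_left
            / (Delta_left n vs ws (C_left n ws r) y_left * Delta_left n vs ws (C_right n ws r) y_left))
   \<and> (\<forall>C\<in>chambers n ws.
        Delta_right n vs ws C y_right = (\<Prod>r\<in>{r \<in> Jo vs. C \<in> Up_wedge n ws r}. inverse (t r))
      \<and> Delta_left n vs ws C y_left = (\<Prod>r\<in>{r \<in> Jo vs. C \<in> Down_wedge n ws r}. inverse (t r)))"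
proof -
  interpret wiring n vs ws t v w
    using assms(2,4-6) by unfold_locales auto
  show ?thesis
    unfolding assms(7-10)
    using chamber_ansatz_left chamber_ansatz_right by blast
qed

end
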